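(* Let $\mathcal{O}=\mathbb{Z}[\rho]$ with $\rho=\zeta_7+\zeta_7^{-1}$, $\zeta_7=\exp(2\pi i/7)$, and let $\alpha\in\mathcal{O}$ be totally positive. Then the following statements are equivalent: (1a) $\alpha$ is not a sum of squares of elements of $\mathcal{O}$; (1b) $\alpha$ is not a sum of four squares of elements of $\mathcal{O}$; (2a) the norm of $\alpha$ (from $\mathbb{Q}(\rho)$ to $\mathbb{Q}$) is $7$; (2b) $\alpha=u^2(1+\rho+\rho^2)$ for some unit $u\in\mathcal{O}$; (2c) $\alpha$ is indecomposable and not a square in $\mathcal{O}$.
   Context: $\mathcal{O}$ is the ring of integers of the totally real cubic field $\mathbb{Q}(\rho)$; $\rho$ has minimal polynomial $x^3+x^2-2x-1$. An element is totally positive if all its real embeddings are positive. A totally positive $\alpha\in\mathcal{O}$ is called indecomposable if it cannot be written as $\beta+\gamma$ with $\beta,\gamma\in\mathcal{O}$ both totally positive. *)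

theory Defs
  imports Complex_Main "HOL-Library.FuncSet" "HOL-Computational_Algebra.Polynomial"
begin

definition zeta7 :: complex where
  "zeta7 = exp (2 * of_real pi * \<i> / 7)"

definition rho :: complex where
  "rho = zeta7 + inverse zeta7"

definition K :: "complex set" where
  "K = {poly (map_poly of_rat p) rho / poly (map_poly of_rat q) rho | p q :: rat poly.
          poly (map_poly of_rat q) rho \<noteq> 0}"

definition \<O> :: "complex set" where
  "\<O> = {poly (map_poly of_int p) rho | p :: int poly. True}"

text \<open>
  Field embeddings of \<open>K\<close> into a field \<open>'a\<close>, used for \<open>'a = real\<close> and \<open>'a = complex\<close>.
  Requiring them to be \<^const>\<open>undefined\<close> outside \<open>K\<close> makes equality of functions
  equality of embeddings, so that the product in \<open>norm_K\<close> has one factor per embedding.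
\<close>
definition embeddings :: "(complex \<Rightarrow> 'a::field) set" where
  "embeddings = {\<sigma> \<in> extensional K. \<sigma> 1 = 1 \<and>
     (\<forall>x\<in>K. \<forall>y\<in>K. \<sigma> (x + y) = \<sigma> x + \<sigma> y \<and> \<sigma> (x * y) = \<sigma> x * \<sigma> y)}"

definition totally_positive :: "complex \<Rightarrow> bool" where
  "totally_positive \<alpha> \<longleftrightarrow> (\<forall>\<sigma> \<in> (embeddings :: (complex \<Rightarrow> real) set). \<sigma> \<alpha> > 0)"

definition norm_K :: "complex \<Rightarrow> complex" where
  "norm_K \<alpha> = (\<Prod>\<sigma> \<in> (embeddings :: (complex \<Rightarrow> complex) set). \<sigma> \<alpha>)"

definition indecomposable :: "complex \<Rightarrow> bool" where
  "indecomposable \<alpha> \<longleftrightarrow> \<alpha> \<in> \<O> \<and> totally_positive \<alpha> \<and>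
     \<not> (\<exists>\<beta>\<in>\<O>. \<exists>\<gamma>\<in>\<O>. totally_positive \<beta> \<and> totally_positive \<gamma> \<and> \<alpha> = \<beta> + \<gamma>)"

definition is_unit_O :: "complex \<Rightarrow> bool" where
  "is_unit_O u \<longleftrightarrow> u \<in> \<O> \<and> (\<exists>v\<in>\<O>. u * v = 1)"

definition sum_of_squares :: "complex \<Rightarrow> bool" where
  "sum_of_squares \<alpha> \<longleftrightarrow> (\<exists>xs. set xs \<subseteq> \<O> \<and> \<alpha> = (\<Sum>x\<leftarrow>xs. x\<^sup>2))"

definition sum_of_four_squares :: "complex \<Rightarrow> bool" where
  "sum_of_four_squares \<alpha> \<longleftrightarrow>
     (\<exists>a\<in>\<O>. \<exists>b\<in>\<O>. \<exists>c\<in>\<O>. \<exists>d\<in>\<O>. \<alpha> = a\<^sup>2 + b\<^sup>2 + c\<^sup>2 + d\<^sup>2)"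

end

theory Submission
  imports Defs "HOL-Analysis.Analysis" "HOL-Number_Theory.Cong"
begin

text \<open>
  The crux is that a totally positive \<open>\<alpha>\<close> whose norm is not \<open>7\<close> is a sum of four squares.
  Let \<open>H\<close> be the Hurwitz order tensored with \<open>\<O> = \<int>[\<rho>]\<close>. First, every totally positive
  element is the norm of an element of \<open>H\<close>. For a prime \<open>\<alpha>\<close>, Blichfeldt's refinement of
  Minkowski's theorem, applied in dimension \<open>12\<close> to the lattice of a left ideal above \<open>\<alpha>\<close>, yields a
  quaternion of norm \<open>\<alpha> * m\<close> where \<open>m\<close> has norm less than \<open>13\<close>. Such an \<open>m\<close> is a unit times \<open>1\<close>,
  \<open>2\<close> or \<open>\<delta> = 1 + \<rho> + \<rho>\<^sup>2\<close>, and factors of norm \<open>2\<close> and \<open>\<delta>\<close> split off; totally positive units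
  are squares.

  Secondly, \<open>2\<close> is inert, so that \<open>H\<close> modulo its prime above \<open>2\<close> is the field with \<open>64\<close> elements, in
  which the Lipschitz quaternions form the subfield with \<open>8\<close> elements. A quaternion of norm prime to
  \<open>2\<close> is thus a unit multiple of a Lipschitz quaternion, and its norm a sum of four squares, if and
  only if its class in a quotient of order \<open>3\<close> is trivial. The quaternions of norm \<open>\<delta>\<close> have
  nontrivial classes. If \<open>z x z\<close> with \<open>z\<close> of norm \<open>\<delta>\<close> is divisible by \<open>\<delta>\<close>, then \<open>z x z / \<delta>\<close> has
  the norm of \<open>x\<close> but another class. Up to unit factors such a \<open>z\<close> exists unless \<open>x\<close> is a scalar
  times a unit modulo \<open>\<delta>\<close>; then conjugation by suitable quaternions of norm \<open>\<delta>\<close> leads to an element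
  that is not. So a totally positive \<open>\<alpha>\<close> prime to \<open>\<delta>\<close> is represented in the trivial class and, when
  it is odd and not a unit, also in a nontrivial class. The latter serves for \<open>\<delta> * \<alpha>\<close>.

  Conversely \<open>\<delta>\<close> has trace \<open>7\<close>, which is too small for a sum of two or more squares and for a sum
  of two totally positive elements other than \<open>1 + (\<delta> - 1)\<close>.
\<close>

section \<open>The cubic ring\<close>

text \<open>The constant 13 governs the first half. It is the least prime that splits in the field,
  so below it the only positive norms are 1, 7 and 8. The lattice has index
  \<open>512 * N^2\<close>, where \<open>N\<close> is the norm of the prime, in a lattice of
  determinant \<open>7 ^ 4\<close>. With the AM-GM inequality between norm and trace, Blichfeldt's
  bound makes the norm of the cofactor smaller than 12, up to discretisation. Minkowski's theorem
  for a ball gives only about 35 and would leave norms such as 13, 27 and 29 to be treated.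

  The obstacle in the second half is that universality of the norm form does not control the class
  of the representing quaternion: \<open>dlt\<close> is a norm, but only from nontrivial classes.
  Modulo \<open>dlt\<close> the Hurwitz order becomes the ring of 2 by 2 matrices over the field
  with 7 elements, where a quaternion of norm \<open>dlt\<close> has rank one. Divisibility of z x z
  by \<open>dlt\<close> is therefore a single linear condition on x, and the search for z is a
  computation with \<open>7 ^ 4\<close> residues.\<close>

datatype cub = Cub (c0: int) (c1: int) (c2: int)

lemma cub_eq_iff: "x = y \<longleftrightarrow> c0 x = c0 y \<and> c1 x = c1 y \<and> c2 x = c2 y"
  by (cases x; cases y) auto

instantiation cub :: comm_ring_1
begin

definition "0 = Cub 0 0 0"
definition "1 = Cub 1 0 0"
definition "x + y = Cub (c0 x + c0 y) (c1 x + c1 y) (c2 x + c2 y)"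
definition "x - y = Cub (c0 x - c0 y) (c1 x - c1 y) (c2 x - c2 y)"
definition "- x = Cub (- c0 x) (- c1 x) (- c2 x)"
text \<open>Reduction modulo \<open>\<rho>\<^sup>3 = 1 + 2\<rho> - \<rho>\<^sup>2\<close> and \<open>\<rho>\<^sup>4 = - 1 - \<rho> + 3\<rho>\<^sup>2\<close>.\<close>
definition "x * y =
  (let m = c1 x * c2 y + c2 x * c1 y; n = c2 x * c2 y in
   Cub (c0 x * c0 y + m - n) (c0 x * c1 y + c1 x * c0 y + 2 * m - n)
     (c0 x * c2 y + c1 x * c1 y + c2 x * c0 y - m + 3 * n))"

instance
  by standard
    (auto simp: zero_cub_def one_cub_def plus_cub_def minus_cub_def uminus_cub_def times_cub_def
      Let_def algebra_simps)

end

lemma cub_sel [simp]: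
  "c0 0 = 0" "c1 0 = 0" "c2 0 = 0" "c0 1 = 1" "c1 1 = 0" "c2 1 = 0"
  "c0 (x + y) = c0 x + c0 y" "c1 (x + y) = c1 x + c1 y" "c2 (x + y) = c2 x + c2 y"
  "c0 (x - y) = c0 x - c0 y" "c1 (x - y) = c1 x - c1 y" "c2 (x - y) = c2 x - c2 y"
  "c0 (- x) = - c0 x" "c1 (- x) = - c1 x" "c2 (- x) = - c2 x"
  by (simp_all add: zero_cub_def one_cub_def plus_cub_def minus_cub_def uminus_cub_def)

lemma cub_sel_mult:
  "c0 (x * y) = c0 x * c0 y + c1 x * c2 y + c2 x * c1 y - c2 x * c2 y"
  "c1 (x * y) = c0 x * c1 y + c1 x * c0 y + 2 * (c1 x * c2 y + c2 x * c1 y) - c2 x * c2 y"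
  "c2 (x * y) = c0 x * c2 y + c1 x * c1 y + c2 x * c0 y - c1 x * c2 y - c2 x * c1 y + 3 * (c2 x * c2 y)"
  by (simp_all add: times_cub_def Let_def)

lemma cub_sel_of_nat [simp]: "c0 (of_nat n) = int n" "c1 (of_nat n) = 0" "c2 (of_nat n) = 0"
  by (induction n) simp_all

lemma cub_sel_of_int [simp]: "c0 (of_int n) = n" "c1 (of_int n) = 0" "c2 (of_int n) = 0"
  by (cases n rule: int_cases2; simp)+

lemma cub_sel_numeral [simp]:
  "c0 (numeral n) = numeral n" "c1 (numeral n) = 0" "c2 (numeral n) = 0"
  using cub_sel_of_int[of "numeral n"] by simp_all

text \<open>With \<open>trc\<close> and \<open>sym2\<close> below, the elementary symmetric
  functions of the three conjugates, expanded through the power sums of the roots. As integer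
  polynomials they reduce parity, residues modulo 7 and special values to evaluation.\<close>

definition nrm :: "cub \<Rightarrow> int" where
  "nrm x = (let a = c0 x; b = c1 x; c = c2 x in
     a^3 + b^3 + c^3 - a^2*b + 5*a^2*c - 2*a*b^2 + 6*a*c^2 - b^2*c - 2*b*c^2 - a*b*c)"

definition trc :: "cub \<Rightarrow> int" where
  "trc x = 3 * c0 x - c1 x + 5 * c2 x"

definition sym2 :: "cub \<Rightarrow> int" where
  "sym2 x = (let a = c0 x; b = c1 x; c = c2 x in
     3*a^2 - 2*b^2 + 6*c^2 - 2*a*b + 10*a*c - b*c)"

lemma trc_add: "trc (x + y) = trc x + trc y"
  by (simp add: trc_def)

text \<open>The product of the other two conjugates; \<open>mult_adj\<close> is the Cayley-Hamilton
  equation of \<open>x\<close>.\<close>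

definition adj :: "cub \<Rightarrow> cub" where
  "adj x = x * x - of_int (trc x) * x + of_int (sym2 x)"

lemma mult_adj: "x * adj x = of_int (nrm x)"
proof -
  have of_int: "of_int n = Cub n 0 0" for n
    by (simp add: cub_eq_iff)
  show ?thesis
    unfolding adj_def of_int
    by (simp add: cub_eq_iff cub_sel_mult nrm_def trc_def sym2_def Let_def)
       (simp add: algebra_simps power2_eq_square power3_eq_cube)
qed

lemma nrm_of_int: "nrm (of_int n) = n ^ 3"
  by (simp add: nrm_def Let_def)

lemma nrm_0 [simp]: "nrm 0 = 0" and nrm_1 [simp]: "nrm 1 = 1"
  by (simp_all add: nrm_def Let_def)

lemma nrm_numeral: "nrm (numeral n) = numeral n ^ 3"
  using nrm_of_int[of "numeral n"] by simp

lemma nrm_dvd: "x dvd of_int (nrm x)"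
  by (metis dvd_triv_left mult_adj)

lemma of_int_dvd_iff: "of_int n dvd x \<longleftrightarrow> n dvd c0 x \<and> n dvd c1 x \<and> n dvd c2 x"
proof
  assume "of_int n dvd x"
  then obtain y where "x = of_int n * y" ..
  then show "n dvd c0 x \<and> n dvd c1 x \<and> n dvd c2 x" by (simp add: cub_sel_mult)
next
  assume "n dvd c0 x \<and> n dvd c1 x \<and> n dvd c2 x"
  then obtain a b c where "c0 x = n * a" "c1 x = n * b" "c2 x = n * c" by (auto elim!: dvdE)
  then have "x = of_int n * Cub a b c" by (simp add: cub_eq_iff cub_sel_mult)
  then show "of_int n dvd x" by simp
qed

subsection \<open>Real embeddings\<close>

text \<open>Substitution of \<open>r\<close> for the generator, multiplicative when \<open>r\<close>
  is a root. The target is an arbitrary commutative ring, so that the real roots, the complex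
  generator and its images under embeddings are treated together.\<close>

definition ev :: "'a::comm_ring_1 \<Rightarrow> cub \<Rightarrow> 'a" where
  "ev r x = of_int (c0 x) + of_int (c1 x) * r + of_int (c2 x) * r ^ 2"

definition is_root :: "'a::comm_ring_1 \<Rightarrow> bool" where
  "is_root r \<longleftrightarrow> r ^ 3 = 1 + 2 * r - r ^ 2"

lemma ev_add: "ev r (x + y) = ev r x + ev r y"
  and ev_diff: "ev r (x - y) = ev r x - ev r y"
  and ev_minus: "ev r (- x) = - ev r x"
  and ev_0 [simp]: "ev r 0 = 0" and ev_1 [simp]: "ev r 1 = 1"
  and ev_of_int [simp]: "ev r (of_int n) = of_int n"
  and ev_numeral [simp]: "ev r (numeral m) = numeral m"
  by (simp_all add: ev_def algebra_simps)

lemma is_root_power4: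
  assumes "is_root r"
  shows "r ^ 4 = - 1 - r + 3 * r ^ 2"
proof -
  have r3: "r ^ 3 = 1 + 2 * r - r ^ 2" using assms by (simp add: is_root_def)
  have "r ^ 4 = r * r ^ 3" by (simp add: power3_eq_cube power4_eq_xxxx mult.assoc)
  also have "\<dots> = r * (1 + 2 * r - r ^ 2)" by (simp only: r3)
  also have "\<dots> = r + 2 * r ^ 2 - r ^ 3"
    by (simp add: algebra_simps power2_eq_square power3_eq_cube)
  finally show ?thesis by (simp add: r3)
qed

lemma ev_mult:
  assumes "is_root r"
  shows "ev r (x * y) = ev r x * ev r y"
proof -
  have r3: "r ^ 3 = 1 + 2 * r - r ^ 2" using assms by (simp add: is_root_def)
  have r4: "r ^ 4 = - 1 - r + 3 * r ^ 2" using assms by (rule is_root_power4)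
  have "ev r x * ev r y = of_int (c0 x * c0 y) + of_int (c0 x * c1 y + c1 x * c0 y) * r
     + of_int (c0 x * c2 y + c1 x * c1 y + c2 x * c0 y) * r ^ 2
     + of_int (c1 x * c2 y + c2 x * c1 y) * r ^ 3 + of_int (c2 x * c2 y) * r ^ 4"
    by (simp add: ev_def algebra_simps power2_eq_square power3_eq_cube power4_eq_xxxx)
  also have "\<dots> = ev r (x * y)"
    unfolding r3 r4 by (simp add: ev_def cub_sel_mult algebra_simps)
  finally show ?thesis ..
qed

lemma ev_power: "is_root r \<Longrightarrow> ev r (x ^ n) = ev r x ^ n"
  by (induction n) (simp_all add: ev_mult)

text \<open>The value is 2 cos (2 pi / 7). Choosing it in a short rational interval supplies the
  numerical bounds together with the equation. Doubling the angle sends \<open>r\<close> to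
  \<open>r ^ 2 - 2\<close> and gives the other two roots.\<close>

definition rt0 :: real where
  "rt0 = (SOME r. 12469/10000 \<le> r \<and> r \<le> 12470/10000 \<and> is_root r)"
definition rt1 :: real where "rt1 = rt0 ^ 2 - 2"
definition rt2 :: real where "rt2 = rt1 ^ 2 - 2"

lemma rt0: "12469/10000 \<le> rt0 \<and> rt0 \<le> 12470/10000 \<and> is_root rt0"
  unfolding rt0_def
proof (rule someI_ex)
  have "\<exists>r\<ge>12469/10000. r \<le> 12470/10000 \<and> r ^ 3 + r ^ 2 - 2 * r = (1::real)"
    by (rule IVT) (auto intro!: continuous_intros simp: power2_eq_square power3_eq_cube)
  then show "\<exists>r::real. 12469/10000 \<le> r \<and> r \<le> 12470/10000 \<and> is_root r"
    unfolding is_root_def by (auto simp: algebra_simps)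
qed

lemma is_root_conj:
  fixes r :: "'a::comm_ring_1"
  assumes "is_root r"
  shows "is_root (r ^ 2 - 2)"
proof -
  \<comment> \<open>For f = x^3 + x^2 - 2 x - 1 this is f(r^2 - 2) = - f(r) f(-r).\<close>
  have "(r ^ 2 - 2) ^ 3 - (1 + 2 * (r ^ 2 - 2) - (r ^ 2 - 2) ^ 2) =
    - (r ^ 3 - (1 + 2 * r - r ^ 2)) * (r ^ 2 + 2 * r - 1 - r ^ 3)"
    by (simp add: algebra_simps power2_eq_square power3_eq_cube)
  then show ?thesis using assms unfolding is_root_def by simp
qed

lemma root_conj_conj:
  fixes r :: "'a::comm_ring_1"
  assumes "is_root r"
  shows "(r ^ 2 - 2) ^ 2 - 2 = 1 - r - r ^ 2"
proof -
  have "(r ^ 2 - 2) ^ 2 - 2 = r ^ 4 - 4 * r ^ 2 + 2"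
    by (simp add: algebra_simps power2_eq_square power4_eq_xxxx)
  then show ?thesis by (simp add: is_root_power4[OF assms])
qed

lemma root_factor:
  fixes r x :: "'a::comm_ring_1"
  assumes "is_root r"
  shows "x ^ 3 + x ^ 2 - 2 * x - 1 = (x - r) * (x - (r ^ 2 - 2)) * (x - ((r ^ 2 - 2) ^ 2 - 2))"
proof -
  have "(x - r) * (x - (r ^ 2 - 2)) * (x - (1 - r - r ^ 2)) =
    x ^ 3 + x ^ 2 + x * (1 - r ^ 4 - r ^ 3 + 2 * r ^ 2 + r - 3) + (r ^ 2 - 2) * (r ^ 3 + r ^ 2 - r)"
    by (simp add: algebra_simps power2_eq_square power3_eq_cube power4_eq_xxxx)
  also have "r ^ 3 + r ^ 2 - r = 1 + r"
    using assms by (simp add: is_root_def)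
  also have "(r ^ 2 - 2) * (1 + r) = r ^ 3 + r ^ 2 - 2 * r - 2"
    by (simp add: algebra_simps power2_eq_square power3_eq_cube)
  also have "\<dots> = - 1"
    using assms by (simp add: is_root_def)
  also have "1 - r ^ 4 - r ^ 3 + 2 * r ^ 2 + r - 3 = - 2"
    using assms by (simp add: is_root_def is_root_power4[OF assms])
  finally show ?thesis
    by (simp add: root_conj_conj[OF assms])
qed

lemma rt_root [simp]: "is_root rt0" "is_root rt1" "is_root rt2"
  using rt0 is_root_conj by (auto simp: rt1_def rt2_def)

lemma rt_bounds:
  "12469/10000 \<le> rt0" "rt0 \<le> 12470/10000"
  "- 4453/10000 \<le> rt1" "rt1 \<le> - 4449/10000"
  "- 18021/10000 \<le> rt2" "rt2 \<le> - 18017/10000"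
proof -
  show a: "12469/10000 \<le> rt0" "rt0 \<le> 12470/10000" using rt0 by auto
  have "(12469/10000) ^ 2 \<le> rt0 ^ 2" "rt0 ^ 2 \<le> (12470/10000) ^ 2"
    using a by (auto intro!: power_mono)
  then show b: "- 4453/10000 \<le> rt1" "rt1 \<le> - 4449/10000"
    by (auto simp: rt1_def power2_eq_square)
  have "(4449/10000) ^ 2 \<le> (- rt1) ^ 2" "(- rt1) ^ 2 \<le> (4453/10000) ^ 2"
    using b by (intro power_mono; simp)+
  then show "- 18021/10000 \<le> rt2" "rt2 \<le> - 18017/10000"
    by (auto simp: rt2_def power2_eq_square)
qed

lemma rt2_eq: "rt2 = 1 - rt0 - rt0 ^ 2"
  unfolding rt2_def rt1_def by (rule root_conj_conj) simp

lemma rt_sym: "rt0 + rt1 + rt2 = -1" "rt0 * rt1 + rt1 * rt2 + rt2 * rt0 = -2" "rt0 * rt1 * rt2 = 1"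
proof -
  show "rt0 + rt1 + rt2 = -1" by (simp add: rt2_eq rt1_def)
  have r3: "rt0 ^ 3 = 1 + 2 * rt0 - rt0 ^ 2" using rt0 by (simp add: is_root_def)
  have r4: "rt0 ^ 4 = - 1 - rt0 + 3 * rt0 ^ 2" by (rule is_root_power4) simp
  have "rt0 * rt1 + rt1 * rt2 + rt2 * rt0 = 3 * rt0 ^ 2 - rt0 ^ 3 - rt0 ^ 4 - rt0 ^ 3 - rt0 ^ 2 + rt0 ^ 3 + rt0 - 2"
    by (simp add: rt2_eq rt1_def algebra_simps power2_eq_square power3_eq_cube power4_eq_xxxx)
  then show "rt0 * rt1 + rt1 * rt2 + rt2 * rt0 = -2" by (simp add: r3 r4)
  have "rt0 * rt1 * rt2 = (rt0 ^ 3 - 2 * rt0) * (1 - rt0 - rt0 ^ 2)"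
    by (simp add: rt2_eq rt1_def algebra_simps power2_eq_square power3_eq_cube)
  also have "\<dots> = (1 - rt0 ^ 2) * (1 - rt0 - rt0 ^ 2)" by (simp add: r3)
  also have "\<dots> = 1 - rt0 - 2 * rt0 ^ 2 + rt0 ^ 3 + rt0 ^ 4"
    by (simp add: algebra_simps power2_eq_square power3_eq_cube power4_eq_xxxx)
  finally show "rt0 * rt1 * rt2 = 1" by (simp add: r3 r4)
qed

lemma rt_cycle: "rt2 ^ 2 - 2 = rt0"
  using root_conj_conj[of rt1] rt_sym(1) by (simp add: rt2_def)

lemma rt_power_sums:
  "rt0 ^ 2 + rt1 ^ 2 + rt2 ^ 2 = 5"
  "rt0 ^ 2 * rt1 ^ 2 + rt1 ^ 2 * rt2 ^ 2 + rt2 ^ 2 * rt0 ^ 2 = 6"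
  "rt0 * rt1 ^ 2 + rt1 * rt2 ^ 2 + rt2 * rt0 ^ 2 + rt0 ^ 2 * rt1 + rt1 ^ 2 * rt2 + rt2 ^ 2 * rt0 = -1"
proof -
  have "rt0 ^ 2 + rt1 ^ 2 + rt2 ^ 2 = (rt0 + rt1 + rt2) ^ 2 - 2 * (rt0 * rt1 + rt1 * rt2 + rt2 * rt0)"
    by (simp add: power2_eq_square algebra_simps)
  then show "rt0 ^ 2 + rt1 ^ 2 + rt2 ^ 2 = 5" by (simp add: rt_sym)
  have "rt0 ^ 2 * rt1 ^ 2 + rt1 ^ 2 * rt2 ^ 2 + rt2 ^ 2 * rt0 ^ 2 =
    (rt0 * rt1 + rt1 * rt2 + rt2 * rt0) ^ 2 - 2 * (rt0 * rt1 * rt2) * (rt0 + rt1 + rt2)"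
    by (simp add: power2_eq_square algebra_simps)
  then show "rt0 ^ 2 * rt1 ^ 2 + rt1 ^ 2 * rt2 ^ 2 + rt2 ^ 2 * rt0 ^ 2 = 6"
    by (simp only: rt_sym) simp
  have "rt0 * rt1 ^ 2 + rt1 * rt2 ^ 2 + rt2 * rt0 ^ 2 + rt0 ^ 2 * rt1 + rt1 ^ 2 * rt2 + rt2 ^ 2 * rt0 =
    (rt0 + rt1 + rt2) * (rt0 * rt1 + rt1 * rt2 + rt2 * rt0) - 3 * (rt0 * rt1 * rt2)"
    by (simp add: power2_eq_square algebra_simps)
  then show "rt0 * rt1 ^ 2 + rt1 * rt2 ^ 2 + rt2 * rt0 ^ 2 + rt0 ^ 2 * rt1 + rt1 ^ 2 * rt2 + rt2 ^ 2 * rt0 = -1"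
    by (simp only: rt_sym)
qed

lemma ev_nrm: "ev rt0 x * ev rt1 x * ev rt2 x = of_int (nrm x)"
proof -
  have *: "(a + b * p + c * p ^ 2) * (a + b * q + c * q ^ 2) * (a + b * r + c * r ^ 2) =
      a^3 + b^3 * (p * q * r) + c^3 * (p * q * r) ^ 2 + a^2*b * (p + q + r) + a^2*c * (p ^ 2 + q ^ 2 + r ^ 2)
      + a*b^2 * (p * q + q * r + r * p) + a*c^2 * (p ^ 2 * q ^ 2 + q ^ 2 * r ^ 2 + r ^ 2 * p ^ 2)
      + b^2*c * (p * q * r) * (p + q + r) + b*c^2 * (p * q * r) * (p * q + q * r + r * p)
      + a*b*c * (p * q ^ 2 + q * r ^ 2 + r * p ^ 2 + p ^ 2 * q + q ^ 2 * r + r ^ 2 * p)"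
    for a b c p q r :: real
    by (simp add: algebra_simps power2_eq_square power3_eq_cube)
  show ?thesis
    unfolding ev_def * rt_sym rt_power_sums by (simp add: nrm_def Let_def)
qed

lemma ev_trc: "ev rt0 x + ev rt1 x + ev rt2 x = of_int (trc x)"
proof -
  have "ev rt0 x + ev rt1 x + ev rt2 x = 3 * of_int (c0 x) + of_int (c1 x) * (rt0 + rt1 + rt2)
    + of_int (c2 x) * (rt0 ^ 2 + rt1 ^ 2 + rt2 ^ 2)"
    by (simp add: ev_def algebra_simps)
  then show ?thesis unfolding rt_sym rt_power_sums by (simp add: trc_def)
qed

lemma ev_sym2: "ev rt0 x * ev rt1 x + ev rt1 x * ev rt2 x + ev rt2 x * ev rt0 x = of_int (sym2 x)"
proof -
  have *: "(a + b * p + c * p ^ 2) * (a + b * q + c * q ^ 2) +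
      (a + b * q + c * q ^ 2) * (a + b * r + c * r ^ 2) +
      (a + b * r + c * r ^ 2) * (a + b * p + c * p ^ 2) =
      3 * a^2 + 2 * a * b * (p + q + r) + 2 * a * c * (p ^ 2 + q ^ 2 + r ^ 2)
      + b^2 * (p * q + q * r + r * p) + c^2 * (p ^ 2 * q ^ 2 + q ^ 2 * r ^ 2 + r ^ 2 * p ^ 2)
      + b * c * (p * q ^ 2 + q * r ^ 2 + r * p ^ 2 + p ^ 2 * q + q ^ 2 * r + r ^ 2 * p)"
    for a b c p q r :: real
    by (simp add: algebra_simps power2_eq_square)
  show ?thesis
    unfolding ev_def * rt_sym rt_power_sums by (simp add: sym2_def Let_def)
qed

lemma nrm_mult: "nrm (x * y) = nrm x * nrm y"
proof -
  have "real_of_int (nrm (x * y)) = of_int (nrm x * nrm y)"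
    unfolding of_int_mult ev_nrm[symmetric] by (simp add: ev_mult)
  then show ?thesis by linarith
qed

lemma nrm_power: "nrm (x ^ n) = nrm x ^ n"
  by (induction n) (simp_all add: nrm_mult)

lemma nrm_minus: "nrm (- x) = - nrm x"
  by (simp add: nrm_def Let_def algebra_simps)

text \<open>The cubic has no root modulo 2, so 2 is inert and the norm form has no nontrivial zero
  over the field with 2 elements. Descent by division by 2 then gives
  \<open>nrm_eq_0_iff\<close>.\<close>

lemma even_nrm_imp:
  assumes "even (nrm x)" shows "even (c0 x) \<and> even (c1 x) \<and> even (c2 x)"
  using assms by (auto simp: nrm_def Let_def)

lemma nrm_eq_0_iff [simp]: "nrm x = 0 \<longleftrightarrow> x = 0"
proof
  have "\<And>x. nrm x = 0 \<Longrightarrow> nat (\<bar>c0 x\<bar> + \<bar>c1 x\<bar> + \<bar>c2 x\<bar>) = n \<Longrightarrow> x = 0" for n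
  proof (induction n rule: less_induct)
    case (less n)
    have "even (nrm x)" using less by simp
    from even_nrm_imp[OF this] have "of_int 2 dvd x" by (simp only: of_int_dvd_iff)
    then obtain y where y: "x = 2 * y" by (auto elim: dvdE)
    have "8 * nrm y = 0" using less.prems by (simp add: y nrm_mult nrm_numeral)
    moreover have "nat (\<bar>c0 y\<bar> + \<bar>c1 y\<bar> + \<bar>c2 y\<bar>) < n" if "x \<noteq> 0"
      using that less.prems(2) unfolding y by (simp add: cub_eq_iff cub_sel_mult abs_mult) linarith
    ultimately show ?case using less.IH y by fastforce
  qed
  then show "x = 0" if "nrm x = 0" using that by blast
qed simp

instance cub :: idom
proof
  fix x y :: cub
  assume "x \<noteq> 0" "y \<noteq> 0"
  then show "x * y \<noteq> 0" by (metis mult_eq_0_iff nrm_eq_0_iff nrm_mult)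
qed

instance cub :: ring_char_0
proof
  show "inj (of_nat :: nat \<Rightarrow> cub)"
    by (rule injI) (simp add: cub_eq_iff)
qed

lemma ev_eq_0_iff [simp]:
  "ev rt0 x = 0 \<longleftrightarrow> x = 0" "ev rt1 x = 0 \<longleftrightarrow> x = 0" "ev rt2 x = 0 \<longleftrightarrow> x = 0"
  using ev_nrm[of x] by auto

section \<open>Total positivity\<close>

definition tpos :: "cub \<Rightarrow> bool" where
  "tpos x \<longleftrightarrow> ev rt0 x > 0 \<and> ev rt1 x > 0 \<and> ev rt2 x > 0"

text \<open>A cubic X^3 - s X^2 + t X - n with s, t, n > 0 has only positive real roots. The
  criterion turns total positivity of explicit elements into integer arithmetic.\<close>

lemma tpos_iff: "tpos x \<longleftrightarrow> trc x > 0 \<and> sym2 x > 0 \<and> nrm x > 0"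
proof -
  have *: "(p > 0 \<and> q > 0 \<and> r > 0) \<longleftrightarrow>
     (p + q + r > 0 \<and> p * q + q * r + r * p > 0 \<and> p * q * r > 0)" for p q r :: real
  proof
    assume a: "p + q + r > 0 \<and> p * q + q * r + r * p > 0 \<and> p * q * r > 0"
    have key: "x > 0" if "x^3 - s * x^2 + t * x - n = 0" "s > 0" "t > 0" "n > 0" for x s t n :: real
    proof (rule ccontr)
      assume "\<not> x > 0"
      then have "x \<le> 0" by simp
      then have "x ^ 3 \<le> 0" "t * x \<le> 0" "0 \<le> s * x ^ 2"
        using that(2,3) by (simp_all add: power3_eq_cube mult_nonneg_nonpos mult_nonpos_nonpos)
      then show False using that by linarith
    qed
    have b: "y > 0" if "(y - p) * (y - q) * (y - r) = 0" for y
    proof (rule key)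
      show "y ^ 3 - (p + q + r) * y ^ 2 + (p * q + q * r + r * p) * y - p * q * r = 0"
        using that by (simp add: ring_distribs power2_eq_square power3_eq_cube mult_ac)
    qed (use a in blast)+
    show "p > 0 \<and> q > 0 \<and> r > 0"
      by (intro conjI; rule b) simp_all
  qed (simp add: add_pos_pos)
  show ?thesis
    using *[of "ev rt0 x" "ev rt1 x" "ev rt2 x"]
    unfolding tpos_def ev_trc ev_sym2 ev_nrm by simp
qed

lemma tpos_add: "tpos x \<Longrightarrow> tpos y \<Longrightarrow> tpos (x + y)"
  and tpos_mult: "tpos x \<Longrightarrow> tpos y \<Longrightarrow> tpos (x * y)"
  by (simp_all add: tpos_def ev_add ev_mult)

lemma tpos_square: "x \<noteq> 0 \<Longrightarrow> tpos (x ^ 2)"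
  by (simp add: tpos_def ev_power)

lemma tpos_cancel: "tpos (x * y) \<Longrightarrow> tpos x \<Longrightarrow> tpos y"
  by (auto simp: tpos_def ev_mult zero_less_mult_iff)

lemma tpos_nz: "tpos x \<Longrightarrow> x \<noteq> 0"
  by (auto simp: tpos_def)

lemma tpos_nrm_pos: "tpos x \<Longrightarrow> nrm x > 0"
  by (simp add: tpos_iff)

text \<open>Completing squares in the trace form. The triangular shape serves the enumeration of
  elements of small trace and the Cholesky factor.\<close>

lemma trc_square:
  "real_of_int (trc (x ^ 2)) =
    3 * (c0 x - c1 x / 3 + 5 * c2 x / 3) ^ 2 + 14/3 * (c1 x - c2 x / 2) ^ 2 + 7/2 * c2 x ^ 2"
  by (simp add: trc_def power2_eq_square cub_sel_mult field_simps)

section \<open>Arithmetic of the cubic ring\<close>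

lemma amgm3:
  fixes x y z :: real
  assumes "0 \<le> x" "0 \<le> y" "0 \<le> z"
  shows "27 * (x * y * z) \<le> (x + y + z) ^ 3"
    and "27 * (x * y * z) = (x + y + z) ^ 3 \<Longrightarrow> 0 < x + y + z \<Longrightarrow> x = y \<and> y = z"
proof -
  define P where "P = (x - y)^2 + (y - z)^2 + (z - x)^2"
  define Q where "Q = x * (y - z)^2 + y * (z - x)^2 + z * (x - y)^2"
  \<comment> \<open>\<open>P\<close> and \<open>Q\<close> are nonnegative, so the identity gives the
    inequality, and equality forces \<open>P = 0\<close> when the sum is positive.\<close>
  have eq: "2 * ((x + y + z) ^ 3 - 27 * (x * y * z)) = (x + y + z) * P + 6 * Q"
    unfolding P_def Q_def by (simp add: algebra_simps power2_eq_square power3_eq_cube)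
  have Q: "0 \<le> Q" using assms by (simp add: Q_def)
  have P: "0 \<le> P" by (simp add: P_def)
  have SP: "0 \<le> (x + y + z) * P" using assms P by (intro mult_nonneg_nonneg) auto
  have "0 \<le> (x + y + z) * P + 6 * Q" using Q SP by (intro add_nonneg_nonneg) auto
  then show "27 * (x * y * z) \<le> (x + y + z) ^ 3" unfolding eq[symmetric] by simp
  assume e: "27 * (x * y * z) = (x + y + z) ^ 3" and pos: "0 < x + y + z"
  have "(x + y + z) * P + 6 * Q = 0" unfolding eq[symmetric] e by simp
  then have "(x + y + z) * P = 0" using Q SP add_nonneg_eq_0_iff[of "(x + y + z) * P" "6 * Q"] by simp
  then have "P = 0" using pos by (simp only: mult_eq_0_iff) linarith
  moreover have "0 \<le> (x - y)^2" "0 \<le> (y - z)^2" "0 \<le> (z - x)^2" by (rule zero_le_power2)+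
  ultimately have "(x - y)^2 = 0" "(y - z)^2 = 0" unfolding P_def by linarith+
  then show "x = y \<and> y = z" by simp
qed

lemma tpos_nrm_le_trc:
  assumes "tpos x" shows "27 * nrm x \<le> trc x ^ 3"
proof -
  have "27 * (ev rt0 x * ev rt1 x * ev rt2 x) \<le> (ev rt0 x + ev rt1 x + ev rt2 x) ^ 3"
    using assms by (intro amgm3) (auto simp: tpos_def)
  then have "real_of_int (27 * nrm x) \<le> real_of_int (trc x ^ 3)"
    unfolding ev_nrm ev_trc by simp
  then show ?thesis by (simp only: of_int_le_iff)
qed

lemma tpos_trc_ge_3:
  assumes "tpos x" shows "3 \<le> trc x"
proof (rule ccontr)
  assume "\<not> 3 \<le> trc x"
  then have "trc x ^ 3 \<le> 2 ^ 3"
    using assms by (intro power_mono) (auto simp: tpos_iff)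
  then show False using tpos_nrm_le_trc[OF assms] tpos_nrm_pos[OF assms] by simp
qed

lemma tpos_trc_3:
  assumes "tpos x" "trc x = 3" shows "x = 1"
proof -
  have "27 * nrm x \<le> 27" using tpos_nrm_le_trc[OF assms(1)] assms(2) by simp
  then have "nrm x = 1" using tpos_nrm_pos[OF assms(1)] by simp
  then have "27 * (ev rt0 x * ev rt1 x * ev rt2 x) = (ev rt0 x + ev rt1 x + ev rt2 x) ^ 3"
    unfolding ev_nrm ev_trc using assms(2) by simp
  then have "ev rt0 x = ev rt1 x \<and> ev rt1 x = ev rt2 x"
    using assms(1) by (intro amgm3) (auto simp: tpos_def)
  then have "ev rt0 x = 1" using ev_trc[of x] assms(2) by simp
  then have "ev rt0 (x - 1) = 0" by (simp add: ev_diff)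
  then show ?thesis by simp
qed

section \<open>Euclidean division and prime elements\<close>

lemma sum_squares_roots:
  fixes a b c :: real
  shows "(a + b * rt0 + c * rt0 ^ 2) ^ 2 + (a + b * rt1 + c * rt1 ^ 2) ^ 2 + (a + b * rt2 + c * rt2 ^ 2) ^ 2
    = 3 * (a - b / 3 + 5 * c / 3) ^ 2 + 14/3 * (b - c / 2) ^ 2 + 7/2 * c ^ 2"
proof -
  have p4: "(a + b * r + c * r ^ 2) ^ 2 = a^2 - c^2 + 2 * b * c
      + (2 * a * b + 4 * b * c - c^2) * r + (b^2 + 2 * a * c - 2 * b * c + 3 * c^2) * r ^ 2"
    if "is_root r" for r
  proof -
    have "(a + b * r + c * r ^ 2) ^ 2 = a^2 + 2 * a * b * r + (b^2 + 2 * a * c) * r^2 + 2 * b * c * r^3 + c^2 * r^4"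
      by (simp add: algebra_simps power2_eq_square power3_eq_cube power4_eq_xxxx)
    then show ?thesis
      using that is_root_power4[OF that] unfolding is_root_def by (simp add: algebra_simps)
  qed
  have "(a + b * rt0 + c * rt0 ^ 2) ^ 2 + (a + b * rt1 + c * rt1 ^ 2) ^ 2 + (a + b * rt2 + c * rt2 ^ 2) ^ 2
    = 3 * (a^2 - c^2 + 2 * b * c) + (2 * a * b + 4 * b * c - c^2) * (rt0 + rt1 + rt2)
      + (b^2 + 2 * a * c - 2 * b * c + 3 * c^2) * (rt0 ^ 2 + rt1 ^ 2 + rt2 ^ 2)"
    unfolding p4[OF rt_root(1)] p4[OF rt_root(2)] p4[OF rt_root(3)] by (simp add: algebra_simps)
  also have "\<dots> = 3 * (a - b / 3 + 5 * c / 3) ^ 2 + 14/3 * (b - c / 2) ^ 2 + 7/2 * c ^ 2"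
    unfolding rt_sym rt_power_sums by (simp add: power2_eq_square field_simps)
  finally show ?thesis .
qed

text \<open>Rounding the coordinates of x / y from the last to the first makes the argument of each
  square in \<open>sum_squares_roots\<close> at most 1/2 in absolute value. The squared conjugates
  of the error then sum to at most (3 + 14/3 + 7/2) / 4 = 67/24 < 3, and AM-GM puts their product
  below 1.\<close>

lemma euclid:
  assumes "y \<noteq> 0"
  obtains q where "\<bar>nrm (x - q * y)\<bar> < \<bar>nrm y\<bar>"
proof -
  define n where "n = real_of_int (nrm y)"
  have n: "n \<noteq> 0" using assms by (simp add: n_def)
  define t where "t = x * adj y"
  define a b c where "a = c0 t / n" and "b = c1 t / n" and "c = c2 t / n"
  define q2 where "q2 = round c"
  define dc where "dc = c - q2"
  define q1 where "q1 = round (b - dc / 2)"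
  define db where "db = b - q1"
  define q0 where "q0 = round (a - db / 3 + 5 * dc / 3)"
  define da where "da = a - q0"
  have round: "\<bar>z - round z\<bar> \<le> 1/2" for z :: real
    using of_int_round_abs_le[of z] by (simp add: abs_minus_commute)
  have sq: "z ^ 2 \<le> (1/2) ^ 2" if "\<bar>z\<bar> \<le> 1/2" for z :: real
    using that by (metis abs_ge_zero power2_abs power_mono)
  have d: "\<bar>dc\<bar> \<le> 1/2" "\<bar>db - dc / 2\<bar> \<le> 1/2" "\<bar>da - db / 3 + 5 * dc / 3\<bar> \<le> 1/2"
    using round[of c] round[of "b - dc / 2"] round[of "a - db / 3 + 5 * dc / 3"]
    unfolding q0_def q1_def q2_def dc_def db_def da_def by (simp_all add: algebra_simps)
  define e where "e = (\<lambda>r. da + db * r + dc * r ^ 2)"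
  have "e rt0 ^ 2 + e rt1 ^ 2 + e rt2 ^ 2 \<le> 3 * (1/2)^2 + 14/3 * (1/2)^2 + 7/2 * (1/2)^2"
    unfolding e_def sum_squares_roots using d by (intro add_mono mult_left_mono sq) auto
  then have "(e rt0 ^ 2 + e rt1 ^ 2 + e rt2 ^ 2) ^ 3 \<le> (67/24) ^ 3"
    by (intro power_mono) (auto simp: power2_eq_square)
  then have "27 * (e rt0 ^ 2 * e rt1 ^ 2 * e rt2 ^ 2) < 27"
    using amgm3(1)[of "e rt0 ^ 2" "e rt1 ^ 2" "e rt2 ^ 2"] by (simp add: power3_eq_cube)
  then have "(e rt0 * e rt1 * e rt2) ^ 2 < 1 ^ 2" by (simp add: power_mult_distrib)
  then have small: "\<bar>e rt0 * e rt1 * e rt2\<bar> < 1"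
    using power2_less_imp_less[of "\<bar>e rt0 * e rt1 * e rt2\<bar>" 1] by simp
  define q where "q = Cub q0 q1 q2"
  have ev: "ev r (x - q * y) = e r * ev r y" if r: "is_root r" for r
  proof -
    have "ev r x * n = ev r t * ev r y"
    proof -
      have "t * y = x * of_int (nrm y)"
        by (simp add: t_def mult.assoc mult.commute[of "adj y"] mult_adj)
      then have "ev r (t * y) = ev r (x * of_int (nrm y))" by simp
      then show ?thesis using r by (simp add: ev_mult n_def)
    qed
    moreover have "ev r t = n * (e r + ev r q)"
      using n by (simp add: ev_def e_def q_def da_def db_def dc_def a_def b_def c_def field_simps)
    ultimately have "ev r x = (e r + ev r q) * ev r y" using n by (simp add: mult_ac)
    then show ?thesis using r by (simp add: ev_diff ev_mult algebra_simps)
  qed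
  have "real_of_int (nrm (x - q * y)) = (e rt0 * e rt1 * e rt2) * n"
    unfolding n_def ev_nrm[symmetric] by (simp add: ev)
  then have "real_of_int \<bar>nrm (x - q * y)\<bar> = \<bar>e rt0 * e rt1 * e rt2\<bar> * \<bar>n\<bar>"
    by (simp add: abs_mult)
  also have "\<dots> < 1 * \<bar>n\<bar>" using small n by (intro mult_strict_right_mono) auto
  finally have "\<bar>nrm (x - q * y)\<bar> < \<bar>nrm y\<bar>" by (simp add: n_def)
  then show thesis by (rule that)
qed

lemma bezout:
  obtains r s where "(r * x + s * y) dvd x" "(r * x + s * y) dvd (y :: cub)"
proof (cases "x = 0 \<and> y = 0")
  case True
  then show thesis using that by auto
next
  case False
  define P where "P = (\<lambda>n. \<exists>r s. r * x + s * y \<noteq> 0 \<and> n = nat \<bar>nrm (r * x + s * y)\<bar>)"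
  have "1 * x + 0 * y \<noteq> 0 \<or> 0 * x + 1 * y \<noteq> 0" using False by simp
  then have "\<exists>n. P n" unfolding P_def by blast
  then have "P (LEAST n. P n)" by (rule LeastI_ex)
  then obtain r s where rs: "r * x + s * y \<noteq> 0" "(LEAST n. P n) = nat \<bar>nrm (r * x + s * y)\<bar>"
    unfolding P_def by blast
  define g where "g = r * x + s * y"
  have min: "nat \<bar>nrm g\<bar> \<le> nat \<bar>nrm (r' * x + s' * y)\<bar>" if "r' * x + s' * y \<noteq> 0" for r' s'
    unfolding g_def rs(2)[symmetric] by (rule Least_le) (use that in \<open>auto simp: P_def\<close>)
  have dvd: "g dvd z" if z: "z = r' * x + s' * y" for z r' s'
  proof -
    obtain q where q: "\<bar>nrm (z - q * g)\<bar> < \<bar>nrm g\<bar>" using euclid rs(1) g_def by metis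
    have eq: "z - q * g = (r' - q * r) * x + (s' - q * s) * y"
      by (simp add: z g_def algebra_simps)
    have "z - q * g = 0"
    proof (rule ccontr)
      assume "z - q * g \<noteq> 0"
      then have "nat \<bar>nrm g\<bar> \<le> nat \<bar>nrm (z - q * g)\<bar>" using min unfolding eq by blast
      then show False using q by linarith
    qed
    then show ?thesis by simp
  qed
  have "g dvd x" "g dvd y" using dvd[of x 1 0] dvd[of y 0 1] by auto
  then show thesis using that unfolding g_def by blast
qed

lemma unit_iff: "x dvd 1 \<longleftrightarrow> \<bar>nrm x\<bar> = 1"
proof
  assume "x dvd 1"
  then obtain y where "1 = x * y" ..
  then have "nrm x * nrm y = 1" by (metis nrm_1 nrm_mult)
  then show "\<bar>nrm x\<bar> = 1" by (auto simp: zmult_eq_1_iff)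
next
  assume "\<bar>nrm x\<bar> = 1"
  then have "nrm x = 1 \<or> nrm x = -1" by linarith
  then show "x dvd 1" using nrm_dvd[of x] by auto
qed

lemma irreducible_imp_prime:
  assumes "irreducible (p :: cub)" shows "prime_elem p"
proof (rule prime_elemI)
  show "p \<noteq> 0" "\<not> p dvd 1" using assms by (auto simp: irreducible_def)
  fix x y assume xy: "p dvd x * y"
  show "p dvd x \<or> p dvd y"
  proof (cases "p dvd x")
    case False
    obtain r s where g: "(r * p + s * x) dvd p" "(r * p + s * x) dvd x" by (rule bezout)
    from g(1) obtain k where k: "p = (r * p + s * x) * k" ..
    have "\<not> k dvd 1"
    proof
      assume "k dvd 1"
      then obtain k' where "1 = k * k'" ..
      then have "r * p + s * x = p * k'" using k by (metis mult.assoc mult_1_right)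
      then have "p dvd r * p + s * x" by simp
      then show False using False g(2) dvd_trans by blast
    qed
    then have "(r * p + s * x) dvd 1" using assms k unfolding irreducible_def by blast
    then obtain l where l: "1 = (r * p + s * x) * l" ..
    have "p dvd r * l * y * p + s * l * (x * y)" by (rule dvd_add[OF dvd_triv_right dvd_mult[OF xy]])
    also have "r * l * y * p + s * l * (x * y) = (r * p + s * x) * l * y"
      by (simp add: algebra_simps)
    also have "\<dots> = y" unfolding l[symmetric] by simp
    finally show ?thesis by simp
  qed simp
qed

subsection \<open>Divisors of rational primes\<close>

lemma of_int_dvd_of_int_cub: "(of_int m :: cub) dvd of_int n \<longleftrightarrow> m dvd n"
  by (simp add: of_int_dvd_iff)

lemma int_multiple:
  assumes "g dvd of_int p" "\<not> g dvd (1 :: cub)" "prime p" "g dvd of_int n"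
  shows "p dvd n"
proof (rule ccontr)
  assume "\<not> p dvd n"
  then have "coprime p n" using assms(3) prime_imp_coprime by blast
  then obtain u v where "u * p + v * n = 1" using bezout_int[of p n] by auto
  then have "of_int u * of_int p + of_int v * of_int n = (1 :: cub)"
    by (metis of_int_1 of_int_add of_int_mult)
  moreover have "g dvd of_int u * of_int p + of_int v * of_int n"
    using assms by (intro dvd_add dvd_mult)
  ultimately show False using assms by simp
qed

definition fpoly :: "'a::comm_ring_1 \<Rightarrow> 'a" where
  "fpoly t = t ^ 3 + t ^ 2 - 2 * t - 1"

abbreviation "\<rho> \<equiv> Cub 0 1 0"

lemma cub_int_decomp: "x = of_int (c0 x) + of_int (c1 x) * \<rho> + of_int (c2 x) * \<rho> ^ 2"
  by (simp add: cub_eq_iff cub_sel_mult power2_eq_square)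

lemma is_root_rho: "is_root \<rho>"
  by (simp add: is_root_def cub_eq_iff cub_sel_mult power2_eq_square power3_eq_cube)

lemma fpoly_of_int: "fpoly (of_int t) = (of_int (fpoly t) :: cub)"
  by (simp add: fpoly_def)

lemma linear_divisor_root:
  assumes g: "g dvd of_int p" "\<not> g dvd 1" "prime p"
    and lin: "g dvd of_int B * \<rho> + of_int A" "\<not> p dvd B"
  obtains t :: int where "g dvd \<rho> - of_int t" "p dvd fpoly t"
proof -
  have "coprime p B" using g(3) lin(2) prime_imp_coprime by blast
  then obtain u v where uv: "u * p + v * B = 1" using bezout_int[of p B] by auto
  define t where "t = - v * A"
  have "of_int v * (of_int B * \<rho> + of_int A) + of_int u * of_int p * \<rho> = of_int (u * p + v * B) * \<rho> - of_int t"
    by (simp add: t_def algebra_simps)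
  then have "\<rho> - of_int t = of_int v * (of_int B * \<rho> + of_int A) + of_int u * of_int p * \<rho>"
    unfolding uv by simp
  moreover have "g dvd \<dots>"
    by (rule dvd_add[OF dvd_mult[OF lin(1)] dvd_mult2[OF dvd_mult[OF g(1)]]])
  ultimately have 1: "g dvd \<rho> - of_int t" by simp
  have "fpoly (of_int t) = (of_int t - \<rho>) * ((of_int t - (\<rho> ^ 2 - 2)) * (of_int t - ((\<rho> ^ 2 - 2) ^ 2 - 2)))"
    unfolding fpoly_def root_factor[OF is_root_rho] by (simp only: mult.assoc)
  moreover have "g dvd of_int t - \<rho>" using 1 by (metis dvd_minus_iff minus_diff_eq)
  ultimately have "g dvd of_int (fpoly t)"
    unfolding fpoly_of_int[symmetric] by simp
  then show thesis using that 1 int_multiple[OF g] by blast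
qed

text \<open>Polynomial division modulo \<open>p\<close> of the cubic by \<open>g\<close>, read as a
  polynomial in the generator: either a linear polynomial is divisible by \<open>g\<close>, or the
  cubic has a monic quadratic factor modulo \<open>p\<close>. Both cases give a root.\<close>

lemma divisor_of_prime_root:
  assumes g: "g dvd of_int p" "\<not> g dvd (1 :: cub)" "prime p" and np: "\<not> of_int p dvd g"
  obtains t :: int where "p dvd fpoly t"
proof (cases "p dvd c2 g")
  case c: True
  have g': "g = of_int (c0 g) + of_int (c1 g) * \<rho> + of_int (c2 g) * \<rho> ^ 2" by (rule cub_int_decomp)
  have "of_int (c1 g) * \<rho> + of_int (c0 g) = g - of_int (c2 g) * \<rho> ^ 2"
    by (subst (3) g') (simp add: algebra_simps)
  moreover have "g dvd of_int (c2 g)"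
    using c g(1) by (metis dvd_trans of_int_dvd_of_int_cub)
  ultimately have lin: "g dvd of_int (c1 g) * \<rho> + of_int (c0 g)" by simp
  show thesis
  proof (cases "p dvd c1 g")
    case True
    then have "g dvd of_int (c1 g)" using g(1) by (metis dvd_trans of_int_dvd_of_int_cub)
    then have "g dvd of_int (c0 g)" using lin by (metis dvd_add_right_iff dvd_mult2)
    then have "p dvd c0 g" using int_multiple[OF g] by blast
    then show thesis using np c True by (simp add: of_int_dvd_iff)
  next
    case False
    then show thesis using linear_divisor_root[OF g lin] that by blast
  qed
next
  case False
  then have "coprime p (c2 g)" using g(3) prime_imp_coprime by blast
  then obtain u v where uv: "u * p + v * c2 g = 1" using bezout_int[of p "c2 g"] by auto
  define A B where "A = v * c0 g" and "B = v * c1 g"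
  have vc: "v * c2 g = 1 - u * p" using uv by linarith
  have "Cub A B 1 = of_int v * g + of_int p * (of_int u * \<rho> ^ 2)"
    using vc by (simp add: cub_eq_iff cub_sel_mult A_def B_def power2_eq_square algebra_simps)
  then have h: "g dvd Cub A B 1" using g(1) by (metis dvd_add dvd_mult dvd_mult2 dvd_refl)
  \<comment> \<open>\<open>- (L x + M)\<close> is the remainder of the cubic on division by
    \<open>x^2 + B x + A\<close>; the quotient is \<open>x - (B - 1)\<close>.\<close>
  define L where "L = 2 + A - B^2 + B"
  define M where "M = 1 - A * B + A"
  have "of_int L * \<rho> + of_int M = \<rho> * Cub A B 1 - of_int (B - 1) * Cub A B 1"
    by (simp add: cub_eq_iff cub_sel_mult L_def M_def power2_eq_square algebra_simps
        del: of_int_diff of_int_mult of_int_add)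
  then have lin: "g dvd of_int L * \<rho> + of_int M" using h by (metis dvd_diff dvd_mult)
  show thesis
  proof (cases "p dvd L")
    case True
    then have "g dvd of_int L" using g(1) by (metis dvd_trans of_int_dvd_of_int_cub)
    then have "g dvd of_int M" using lin by (metis dvd_add_right_iff dvd_mult2)
    then have "p dvd M" using int_multiple[OF g] by blast
    moreover have "fpoly (B - 1) = - M - (B - 1) * L + 0"
      by (simp add: fpoly_def L_def M_def power2_eq_square power3_eq_cube algebra_simps)
    ultimately show thesis using that[of "B - 1"] True by simp
  next
    case False
    then show thesis using linear_divisor_root[OF g lin] that by blast
  qed
qed

text \<open>Otherwise the gcd of \<open>x\<close> and \<open>p\<close> is a unit by
  \<open>divisor_of_prime_root\<close>, so \<open>x\<close> has a multiple congruent to 1 modulo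
  \<open>p\<close>, whose norm is congruent to 1 as well.\<close>

lemma prime_dvd_nrm_inert:
  assumes "prime p" "p dvd nrm x" and noroot: "\<And>t::int. \<not> p dvd fpoly t"
  shows "of_int p dvd x"
proof (rule ccontr)
  assume np: "\<not> of_int p dvd x"
  obtain r s where g: "(r * x + s * of_int p) dvd x" "(r * x + s * of_int p) dvd of_int p"
    by (rule bezout)
  have "(r * x + s * of_int p) dvd 1"
  proof (rule ccontr)
    assume nu: "\<not> (r * x + s * of_int p) dvd 1"
    have "\<not> of_int p dvd (r * x + s * of_int p)" using np g(1) dvd_trans by blast
    then show False using divisor_of_prime_root[OF g(2) nu assms(1)] noroot by blast
  qed
  then obtain l where l: "1 = (r * x + s * of_int p) * l" ..
  have "p dvd nrm (r * x * l)" using assms(2) by (simp add: nrm_mult)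
  moreover have "r * x * l = 1 - of_int p * (s * l)"
    using l by (simp add: algebra_simps)
  ultimately have "p dvd nrm (1 - of_int p * (s * l))" by simp
  moreover have "nrm (1 - of_int p * z) - 1 = p * (- trc z + p * sym2 z - p ^ 2 * nrm z)" for z
    unfolding nrm_def Let_def trc_def sym2_def cub_sel cub_sel_mult cub_sel_of_int
    by (simp add: algebra_simps power2_eq_square power3_eq_cube)
  then have "p dvd nrm (1 - of_int p * z) - 1" for z by simp
  ultimately have "p dvd 1" by (metis dvd_diff_right_iff)
  then show False using assms(1) not_prime_unit by blast
qed

lemma dvd_fpoly_mod:
  assumes "(p::int) > 0"
  shows "p dvd fpoly t \<longleftrightarrow> p dvd fpoly (t mod p)"
proof -
  have "[fpoly t = fpoly (t mod p)] (mod p)"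
    unfolding fpoly_def by (intro cong_diff cong_add cong_mult cong_pow cong_refl) (simp_all add: cong_def)
  then show ?thesis by (simp add: cong_def mod_eq_0_iff_dvd[symmetric])
qed

lemma no_root_small:
  "\<not> (2::int) dvd fpoly t" "\<not> (3::int) dvd fpoly t" "\<not> (5::int) dvd fpoly t" "\<not> (11::int) dvd fpoly t"
proof -
  have *: "\<not> p dvd fpoly t" if "\<forall>s\<in>set [0..p - 1]. \<not> p dvd fpoly s" "p > 0" for p :: int
    using that dvd_fpoly_mod[of p t] by (auto simp: pos_mod_bound)
  show "\<not> (2::int) dvd fpoly t" "\<not> (3::int) dvd fpoly t" "\<not> (5::int) dvd fpoly t" "\<not> (11::int) dvd fpoly t"
    by (rule *; simp add: fpoly_def upto_rec1)+
qed

section \<open>The totally ramified prime above 7\<close>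

definition dlt :: cub where "dlt = Cub 1 1 1"

text \<open>Modulo 7 the cubic is (x - 2)^3, so the generator is congruent to 2 modulo
  \<open>dlt\<close>. The three conjugates have the same residue, whence
  \<open>nrm_mod_7\<close>.\<close>

definition res7 :: "cub \<Rightarrow> int" where
  "res7 x = c0 x + 2 * c1 x + 4 * c2 x"

lemma nrm_dlt: "nrm dlt = 7" by (simp add: nrm_def dlt_def Let_def)

lemma tpos_dlt: "tpos dlt"
  by (simp add: tpos_iff dlt_def trc_def sym2_def nrm_def Let_def)

lemma nrm_mod_7: "7 dvd nrm x - res7 x ^ 3"
proof -
  have "nrm x - res7 x ^ 3 = 7 * (let a = c0 x; b = c1 x; c = c2 x in
    0 - b^3 - 9*c^3 - a^2*b - a^2*c - 2*a*b^2 - 6*a*c^2 - 7*b^2*c - 14*b*c^2 - 7*a*b*c)"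
    by (simp add: nrm_def res7_def Let_def algebra_simps power2_eq_square power3_eq_cube)
  then show ?thesis by simp
qed

lemma res7_simps:
  "res7 (x + y) = res7 x + res7 y" "res7 (x - y) = res7 x - res7 y" "res7 (- x) = - res7 x"
  "res7 0 = 0" "res7 1 = 1" "res7 (of_int n) = n" "res7 (numeral k) = numeral k"
  by (simp_all add: res7_def)

lemma res7_mult: "[res7 (x * y) = res7 x * res7 y] (mod 7)"
proof -
  have "res7 x * res7 y - res7 (x * y) =
    7 * (c1 x * c2 y + c2 x * c1 y + c2 x * c2 y)"
    by (simp add: res7_def cub_sel_mult algebra_simps)
  then have "7 dvd res7 x * res7 y - res7 (x * y)" by simp
  then show ?thesis by (simp add: cong_iff_dvd_diff dvd_diff_commute)
qed

lemma dlt_dvd_iff: "dlt dvd x \<longleftrightarrow> 7 dvd res7 x"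
proof
  assume "dlt dvd x"
  then obtain y where "x = dlt * y" ..
  then have "[res7 x = 7 * res7 y] (mod 7)" using res7_mult[of dlt y] by (simp add: res7_def dlt_def)
  then show "7 dvd res7 x" by (simp add: cong_def mod_eq_0_iff_dvd[symmetric])
next
  assume "7 dvd res7 x"
  then obtain k where k: "res7 x = 7 * k" ..
  have "dlt * adj dlt = of_int 7" by (simp add: mult_adj nrm_dlt)
  then have "dlt dvd of_int (res7 x)"
    unfolding k of_int_mult by (metis dvd_mult2 dvd_triv_left)
  moreover have "\<rho> - 2 = dlt * Cub (-3) 1 1"
    by (simp add: cub_eq_iff cub_sel_mult dlt_def)
  then have "dlt dvd (\<rho> - 2) * (of_int (c1 x) + of_int (c2 x) * (\<rho> + 2))"
    by (metis dvd_mult2 dvd_triv_left)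
  moreover have "x = of_int (res7 x) + (\<rho> - 2) * (of_int (c1 x) + of_int (c2 x) * (\<rho> + 2))"
    by (simp add: cub_eq_iff cub_sel_mult res7_def)
  ultimately show "dlt dvd x" by (metis dvd_add)
qed

lemma dlt_dvd_iff_nrm: "dlt dvd x \<longleftrightarrow> 7 dvd nrm x"
proof -
  have "7 dvd nrm x \<longleftrightarrow> 7 dvd res7 x ^ 3"
    using nrm_mod_7[of x] by (metis dvd_diff_right_iff dvd_diff_left_iff)
  also have "\<dots> \<longleftrightarrow> 7 dvd res7 x"
    using prime_dvd_power_iff[of "7::int" 3 "res7 x"] by simp
  finally show ?thesis by (simp add: dlt_dvd_iff)
qed

lemma two_dvd_iff_nrm: "2 dvd x \<longleftrightarrow> 2 dvd nrm x"
  using even_nrm_imp[of x] of_int_dvd_iff[of 2 x] by (auto elim!: dvdE simp: nrm_mult nrm_numeral)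

text \<open>The primes 2, 3, 5 and 11 are inert and contribute only cubes, of which 8 alone is below
  13; 7 ramifies.\<close>

lemma small_norm_cases:
  assumes "0 < nrm m" "nrm m < 13"
  shows "nrm m = 1 \<or> 2 dvd m \<or> dlt dvd m"
proof (rule ccontr)
  assume "\<not> ?thesis"
  then have n: "nrm m \<noteq> 1" "\<not> 2 dvd nrm m" "\<not> 7 dvd nrm m"
    by (auto simp: two_dvd_iff_nrm dlt_dvd_iff_nrm)
  have inert: "p ^ 3 dvd nrm m" if h: "p dvd nrm m" "prime p" "\<And>t::int. \<not> p dvd fpoly t" for p
  proof -
    obtain y where "m = of_int p * y" using prime_dvd_nrm_inert[OF h(2,1,3)] by (auto elim: dvdE)
    then show ?thesis by (simp add: nrm_mult nrm_of_int)
  qed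
  have no: "\<not> p dvd nrm m" if "p \<in> {3, 5, 11}" for p
  proof
    assume p: "p dvd nrm m"
    have "prime p" using that by auto
    then have "p ^ 3 dvd nrm m"
      using that no_root_small by (intro inert p) auto
    then have "p ^ 3 \<le> nrm m" using assms zdvd_imp_le by blast
    moreover have "27 \<le> p ^ 3" using that by auto
    ultimately show False using assms by simp
  qed
  have "nrm m \<in> set [1..12]" using assms by simp
  then have "nrm m \<in> {1,2,3,4,5,6,7,8,9,10,11,12}" by (simp add: upto_rec1)
  then show False using n no[of 3] no[of 5] no[of 11] by auto
qed

subsection \<open>Totally positive units\<close>

lemma ev_conj_unit:
  "ev rt0 (Cub (-2) 0 1) = rt1" "ev rt1 (Cub (-2) 0 1) = rt2" "ev rt2 (Cub (-2) 0 1) = rt0"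
  "ev rt0 (Cub 1 (-1) (-1)) = rt2" "ev rt1 (Cub 1 (-1) (-1)) = rt0" "ev rt2 (Cub 1 (-1) (-1)) = rt1"
  "ev rt0 \<rho> = rt0" "ev rt1 \<rho> = rt1" "ev rt2 \<rho> = rt2"
proof -
  show "ev rt0 (Cub (-2) 0 1) = rt1" "ev rt1 (Cub (-2) 0 1) = rt2" "ev rt2 (Cub (-2) 0 1) = rt0"
    using rt_cycle by (simp_all add: ev_def rt1_def rt2_def)
  have *: "ev r (Cub 1 (-1) (-1)) = (r ^ 2 - 2) ^ 2 - 2" if "is_root r" for r :: real
    using root_conj_conj[OF that] by (simp add: ev_def)
  show "ev rt0 (Cub 1 (-1) (-1)) = rt2" "ev rt1 (Cub 1 (-1) (-1)) = rt0" "ev rt2 (Cub 1 (-1) (-1)) = rt1"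
    using rt_cycle by (simp_all add: * flip: rt1_def rt2_def)
  show "ev rt0 \<rho> = rt0" "ev rt1 \<rho> = rt1" "ev rt2 \<rho> = rt2" by (simp_all add: ev_def)
qed

text \<open>The trace of \<open>x ^ 2\<close> is \<open>16 - 2 * sym2 x\<close>, hence at most 14.
  The diagonalised trace form leaves five candidates, none of norm 1.\<close>

lemma trc_four:
  assumes "tpos x" "trc x = 4" shows "nrm x \<noteq> 1"
proof
  assume n: "nrm x = 1"
  define a b c where "a = c0 x" and "b = c1 x" and "c = c2 x"
  have T: "trc (x ^ 2) = trc x ^ 2 - 2 * sym2 x"
    by (simp add: trc_def sym2_def Let_def power2_eq_square cub_sel_mult algebra_simps)
  have "sym2 x > 0" using assms by (simp add: tpos_iff)
  then have "trc (x ^ 2) \<le> 14" using T assms by simp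
  then have le14: "real_of_int (trc (x ^ 2)) \<le> 14" by linarith
  have tr: "3 * a - b + 5 * c = 4" using assms(2) by (simp add: trc_def a_def b_def c_def)
  then have eq: "real_of_int a - real_of_int b / 3 + 5 * real_of_int c / 3 = 4 / 3" by linarith
  have le: "16/3 + 14/3 * (real_of_int b - real_of_int c / 2) ^ 2 + 7/2 * real_of_int c ^ 2 \<le> 14"
  proof -
    have "3 * (real_of_int a - real_of_int b / 3 + 5 * real_of_int c / 3) ^ 2 = 16/3"
      by (simp only: eq) (simp add: power_divide)
    then show ?thesis using le14[unfolded trc_square of_int_mult of_int_power of_int_numeral, folded a_def b_def c_def] by linarith
  qed
  have sq: "0 \<le> 14/3 * (real_of_int b - real_of_int c / 2) ^ 2" "0 \<le> 7/2 * real_of_int c ^ 2" by simp_all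
  have "real_of_int c ^ 2 < 4" using le sq by linarith
  then have "\<bar>real_of_int c\<bar> < 2" using power2_less_imp_less[of "\<bar>real_of_int c\<bar>" 2] by simp
  then have c: "c \<in> {-1, 0, 1}" by auto
  have "(real_of_int b - real_of_int c / 2) ^ 2 < 4" using le sq by linarith
  then have "\<bar>real_of_int b - real_of_int c / 2\<bar> < 2"
    using power2_less_imp_less[of "\<bar>real_of_int b - real_of_int c / 2\<bar>" 2] by simp
  then have b: "b \<in> {-2, -1, 0, 1, 2}" using c by auto
  have N: "a^3 + b^3 + c^3 - a^2*b + 5*a^2*c - 2*a*b^2 + 6*a*c^2 - b^2*c - 2*b*c^2 - a*b*c = 1"
    using n by (simp add: nrm_def Let_def a_def b_def c_def)
  from b c tr consider "b = -1" "c = 0" "a = 1" | "b = 2" "c = 0" "a = 2" | "b = -2" "c = 1" "a = -1"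
    | "b = 1" "c = 1" "a = 0" | "b = 0" "c = -1" "a = 3" by auto
  then show False
    using N by cases (simp_all)
qed

text \<open>With every coordinate at least k = 0.105 S, the product is smallest when two coordinates
  equal k. For S >= 5 it would be at least 0.105^2 * 0.79 * 125 > 1.\<close>

lemma unit_coords_bound:
  fixes e0 e1 e2 :: real
  assumes pos: "e0 > 0" "e1 > 0" "e2 > 0" and prod: "e0 * e1 * e2 = 1"
    and k: "105/1000 * (e0 + e1 + e2) \<le> e0" "105/1000 * (e0 + e1 + e2) \<le> e1" "105/1000 * (e0 + e1 + e2) \<le> e2"
  shows "e0 + e1 + e2 < 5"
proof (rule ccontr)
  define S where "S = e0 + e1 + e2"
  define k where "k = 105/1000 * S"
  assume "\<not> e0 + e1 + e2 < 5"
  then have S: "5 \<le> S" by (simp add: S_def)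
  have k': "k \<le> e0" "k \<le> e1" "k \<le> e2" "0 < k" using assms(5-7) S by (auto simp: k_def S_def)
  have "0 \<le> (e0 - k) * (e1 - k)" using k' by simp
  then have "k * (S - e2 - k) \<le> e0 * e1" by (simp add: S_def algebra_simps)
  then have "k * (S - e2 - k) * e2 \<le> 1" using prod pos by (metis mult_right_mono less_imp_le)
  moreover have "0 \<le> (e2 - k) * (S - 2 * k - e2)" using k' by (simp add: S_def)
  then have "k * (S - 2 * k) \<le> (S - e2 - k) * e2" by (simp add: algebra_simps)
  then have "k * (k * (S - 2 * k)) \<le> k * ((S - e2 - k) * e2)" using k' by (intro mult_left_mono) auto
  moreover have "k * (k * (S - 2 * k)) = (105/1000)^2 * (790/1000) * S ^ 3"
    by (simp add: k_def power2_eq_square power3_eq_cube algebra_simps)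
  moreover have "5 ^ 3 \<le> S ^ 3" using S by (intro power_mono) auto
  ultimately show False by (simp add: mult.assoc power2_eq_square)
qed

text \<open>Descent on the trace by squares of units. When none of the six multipliers lowers it,
  the conjugates of \<open>x\<close> are balanced enough for \<open>unit_coords_bound\<close>, the
  trace is below 5, and \<open>x = 1\<close>.\<close>

lemma tpos_unit_square:
  assumes "tpos x" "nrm x = 1"
  shows "\<exists>v. v dvd 1 \<and> x = v ^ 2"
  using assms
proof (induction "nat (trc x)" arbitrary: x rule: less_induct)
  case less
  have pos: "trc x > 0" using less.prems by (simp add: tpos_iff)
  have red: ?case if v: "v * v' = 1" and le: "trc (v ^ 2 * x) < trc x" for v v'
  proof -
    have "v \<noteq> 0" using v by auto
    have "nrm v * nrm v' = 1" using v by (metis nrm_1 nrm_mult)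
    then have "nrm v ^ 2 = 1" by (auto simp: zmult_eq_1_iff)
    then have *: "tpos (v ^ 2 * x)" "nrm (v ^ 2 * x) = 1"
      using less.prems \<open>v \<noteq> 0\<close> by (simp_all add: tpos_mult tpos_square nrm_mult nrm_power)
    then obtain w where w: "w dvd 1" "v ^ 2 * x = w ^ 2"
      using less.hyps[of "v ^ 2 * x"] le pos by auto
    have "x = (v * v') ^ 2 * x" using v by simp
    also have "\<dots> = (v' * w) ^ 2" using w(2) by (simp add: power_mult_distrib mult_ac)
    finally have "x = (v' * w) ^ 2" .
    moreover have "v' dvd 1" using v by (metis dvd_triv_right)
    then have "v' * w dvd 1 * 1" using w(1) by (rule mult_dvd_mono)
    then have "v' * w dvd 1" by simp
    ultimately show ?case by blast
  qed
  \<comment> \<open>The three conjugates of the generator. Their product is 1, so a product of two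
    is the inverse of the third.\<close>
  define u0 u1 u2 where "u0 = \<rho>" and "u1 = Cub (-2) 0 1" and "u2 = Cub 1 (-1) (-1)"
  have u: "u0 * (u1 * u2) = 1" "u1 * (u2 * u0) = 1" "u2 * (u0 * u1) = 1"
    "(u1 * u2) * u0 = 1" "(u2 * u0) * u1 = 1" "(u0 * u1) * u2 = 1"
    by (simp_all add: u0_def u1_def u2_def cub_eq_iff cub_sel_mult)
  show ?case
  proof (cases "trc (u0 ^ 2 * x) < trc x \<or> trc (u1 ^ 2 * x) < trc x \<or> trc (u2 ^ 2 * x) < trc x \<or>
      trc ((u1 * u2) ^ 2 * x) < trc x \<or> trc ((u2 * u0) ^ 2 * x) < trc x \<or> trc ((u0 * u1) ^ 2 * x) < trc x")
    case True
    then show ?thesis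
      using red[OF u(1)] red[OF u(2)] red[OF u(3)] red[OF u(4)] red[OF u(5)] red[OF u(6)] by argo
  next
    case False
    define e0 e1 e2 where "e0 = ev rt0 x" and "e1 = ev rt1 x" and "e2 = ev rt2 x"
    have e: "e0 > 0" "e1 > 0" "e2 > 0" using less.prems by (auto simp: tpos_def e0_def e1_def e2_def)
    have prod: "e0 * e1 * e2 = 1" using less.prems ev_nrm[of x] by (simp add: e0_def e1_def e2_def)
    have sum: "e0 + e1 + e2 = trc x" using ev_trc[of x] by (simp add: e0_def e1_def e2_def)
    have tr: "trc (v ^ 2 * x) = ev rt0 v ^ 2 * e0 + ev rt1 v ^ 2 * e1 + ev rt2 v ^ 2 * e2" for v
      unfolding ev_trc[symmetric] by (simp add: ev_mult ev_power e0_def e1_def e2_def)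
    have ge: "e0 + e1 + e2 \<le> ev rt0 v ^ 2 * e0 + ev rt1 v ^ 2 * e1 + ev rt2 v ^ 2 * e2"
      if "\<not> trc (v ^ 2 * x) < trc x" for v
      using that unfolding sum tr[symmetric] by simp
    have sqb: "rt0 ^ 2 \<le> 15551/10000" "rt1 ^ 2 \<le> 1983/10000" "rt2 ^ 2 \<le> 32476/10000"
    proof -
      have "rt0 ^ 2 \<le> (12470/10000) ^ 2" "(- rt1) ^ 2 \<le> (4453/10000) ^ 2" "(- rt2) ^ 2 \<le> (18021/10000) ^ 2"
        using rt_bounds by (intro power_mono; simp)+
      then show "rt0 ^ 2 \<le> 15551/10000" "rt1 ^ 2 \<le> 1983/10000" "rt2 ^ 2 \<le> 32476/10000"
        by (simp_all add: power_divide)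
    qed
    have mono: "p \<le> p' \<Longrightarrow> q \<le> q' \<Longrightarrow> r \<le> r' \<Longrightarrow> p * e0 + q * e1 + r * e2 \<le> p' * e0 + q' * e1 + r' * e2"
      for p q r p' q' r'
      using e by (intro add_mono mult_right_mono) auto
    define A B C where "A = (15551/10000 :: real)" and "B = (1983/10000 :: real)" and "C = (32476/10000 :: real)"
    have pr: "rt0 ^ 2 * rt1 ^ 2 \<le> A * B" "rt1 ^ 2 * rt2 ^ 2 \<le> B * C" "rt2 ^ 2 * rt0 ^ 2 \<le> C * A"
      using sqb unfolding A_def B_def C_def by (intro mult_mono; simp)+
    have ev_prod: "ev r (v * w) ^ 2 = ev r v ^ 2 * ev r w ^ 2" if "is_root r" for r :: real and v w
      using that by (simp add: ev_mult power_mult_distrib)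
    have lin: "e0 + e1 + e2 \<le> A * e0 + B * e1 + C * e2" "e0 + e1 + e2 \<le> B * e0 + C * e1 + A * e2"
      "e0 + e1 + e2 \<le> C * e0 + A * e1 + B * e2"
      "e0 + e1 + e2 \<le> (B * C) * e0 + (C * A) * e1 + (A * B) * e2"
      "e0 + e1 + e2 \<le> (C * A) * e0 + (A * B) * e1 + (B * C) * e2"
      "e0 + e1 + e2 \<le> (A * B) * e0 + (B * C) * e1 + (C * A) * e2"
    proof -
      have g: "e0 + e1 + e2 \<le> rt0 ^ 2 * e0 + rt1 ^ 2 * e1 + rt2 ^ 2 * e2"
        "e0 + e1 + e2 \<le> rt1 ^ 2 * e0 + rt2 ^ 2 * e1 + rt0 ^ 2 * e2"
        "e0 + e1 + e2 \<le> rt2 ^ 2 * e0 + rt0 ^ 2 * e1 + rt1 ^ 2 * e2"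
        "e0 + e1 + e2 \<le> (rt1 ^ 2 * rt2 ^ 2) * e0 + (rt2 ^ 2 * rt0 ^ 2) * e1 + (rt0 ^ 2 * rt1 ^ 2) * e2"
        "e0 + e1 + e2 \<le> (rt2 ^ 2 * rt0 ^ 2) * e0 + (rt0 ^ 2 * rt1 ^ 2) * e1 + (rt1 ^ 2 * rt2 ^ 2) * e2"
        "e0 + e1 + e2 \<le> (rt0 ^ 2 * rt1 ^ 2) * e0 + (rt1 ^ 2 * rt2 ^ 2) * e1 + (rt2 ^ 2 * rt0 ^ 2) * e2"
        using ge[of u0] ge[of u1] ge[of u2] ge[of "u1 * u2"] ge[of "u2 * u0"] ge[of "u0 * u1"] False
        by (simp_all add: ev_prod u0_def u1_def u2_def ev_conj_unit)
      show "e0 + e1 + e2 \<le> A * e0 + B * e1 + C * e2" "e0 + e1 + e2 \<le> B * e0 + C * e1 + A * e2"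
        "e0 + e1 + e2 \<le> C * e0 + A * e1 + B * e2"
        "e0 + e1 + e2 \<le> (B * C) * e0 + (C * A) * e1 + (A * B) * e2"
        "e0 + e1 + e2 \<le> (C * A) * e0 + (A * B) * e1 + (B * C) * e2"
        "e0 + e1 + e2 \<le> (A * B) * e0 + (B * C) * e1 + (C * A) * e2"
        by (rule order_trans, rule g, rule mono; (fact pr | use sqb in \<open>simp add: A_def B_def C_def\<close>))+
    qed
    note lin' = lin[unfolded A_def B_def C_def]
    \<comment> \<open>A positive combination of the two inequalities in which the other two
      coordinates have equal coefficients gives the constant 0.107.\<close>
    have "105/1000 * (e0 + e1 + e2) \<le> e0" using lin'(3,5) e by (simp add: field_simps)
    moreover have "105/1000 * (e0 + e1 + e2) \<le> e1" using lin'(2,4) e by (simp add: field_simps)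
    moreover have "105/1000 * (e0 + e1 + e2) \<le> e2" using lin'(1,6) e by (simp add: field_simps)
    ultimately have "e0 + e1 + e2 < 5" using unit_coords_bound e prod by blast
    then have "trc x < 5" using sum by simp
    then have "trc x = 3 \<or> trc x = 4" using tpos_trc_ge_3[OF less.prems(1)] by linarith
    then have "trc x = 3" using trc_four less.prems by blast
    then have "x = 1" using tpos_trc_3 less.prems by blast
    then show ?thesis by (intro exI[of _ 1]) simp
  qed
qed

section \<open>Blichfeldt's bound for the minimum of a lattice\<close>

definition rvec :: "('n \<Rightarrow> int) \<Rightarrow> real ^ 'n" where
  "rvec z = (\<chi> i. real_of_int (z i))"

text \<open>For m points, the squared distances summed over ordered pairs are 2 m times the sum of
  the squared norms minus twice the squared norm of the vector sum; the subtracted term is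
  dropped.\<close>

lemma scattered_points_bound:
  fixes y :: "'i \<Rightarrow> 'a::real_inner"
  assumes S: "finite S" and far: "\<And>u v. u \<in> S \<Longrightarrow> v \<in> S \<Longrightarrow> u \<noteq> v \<Longrightarrow> 2 * R \<le> norm (y u - y v) ^ 2"
  shows "real (card S * (card S - 1)) * R \<le> real (card S) * (\<Sum>u\<in>S. norm (y u) ^ 2)"
proof -
  let ?m = "real (card S)"
  have "(\<Sum>u\<in>S. \<Sum>v\<in>S. norm (y u - y v) ^ 2) =
    (\<Sum>u\<in>S. \<Sum>v\<in>S. norm (y u) ^ 2 + norm (y v) ^ 2 - 2 * (y u \<bullet> y v))"
    by (simp add: dot_square_norm[symmetric] inner_diff inner_commute algebra_simps)
  also have "\<dots> = 2 * ?m * (\<Sum>u\<in>S. norm (y u) ^ 2) - 2 * ((\<Sum>u\<in>S. y u) \<bullet> (\<Sum>u\<in>S. y u))"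
    by (simp add: sum.distrib sum_subtractf sum_distrib_left inner_sum_left inner_sum_right algebra_simps)
       (simp add: sum_distrib_left[symmetric] sum_distrib_right[symmetric] inner_commute)
  finally have eq: "(\<Sum>u\<in>S. \<Sum>v\<in>S. norm (y u - y v) ^ 2) \<le> 2 * ?m * (\<Sum>u\<in>S. norm (y u) ^ 2)"
    by simp
  have "(\<Sum>u\<in>S. real (card S - 1) * (2 * R)) \<le> (\<Sum>u\<in>S. \<Sum>v\<in>S. norm (y u - y v) ^ 2)"
  proof (rule sum_mono)
    fix u assume u: "u \<in> S"
    have "real (card S - 1) * (2 * R) = (\<Sum>v\<in>S - {u}. 2 * R)"
      using u S by simp
    also have "\<dots> \<le> (\<Sum>v\<in>S - {u}. norm (y u - y v) ^ 2)"
      using far u by (intro sum_mono) auto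
    also have "\<dots> \<le> (\<Sum>v\<in>S. norm (y u - y v) ^ 2)"
      using S by (intro sum_mono2) auto
    finally show "real (card S - 1) * (2 * R) \<le> (\<Sum>v\<in>S. norm (y u - y v) ^ 2)" .
  qed
  then have "2 * (real (card S * (card S - 1)) * R) \<le> (\<Sum>u\<in>S. \<Sum>v\<in>S. norm (y u - y v) ^ 2)"
    by (simp add: mult_ac)
  with eq show ?thesis by linarith
qed

lemma card_multiples_above:
  assumes "0 \<le> (s::real)" "M > 0"
  shows "real (card {j \<in> {1..<M}. s \<le> real j / real M}) \<le> max 0 (real M * (1 - s))"
proof (cases "s < 1")
  case True
  define c where "c = nat \<lceil>s * real M\<rceil>"
  have "{j \<in> {1..<M}. s \<le> real j / real M} \<subseteq> {c..<M}"
  proof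
    fix j assume "j \<in> {j \<in> {1..<M}. s \<le> real j / real M}"
    then have "j < M" "s * real M \<le> real j" using assms by (auto simp: pos_le_divide_eq)
    then show "j \<in> {c..<M}" by (simp add: c_def nat_le_iff ceiling_le_iff)
  qed
  then have "card {j \<in> {1..<M}. s \<le> real j / real M} \<le> M - c"
    using card_mono[of "{c..<M}"] by simp
  moreover have "s * real M \<le> 1 * real M"
    using True by (intro mult_right_mono) auto
  then have "c \<le> M"
    by (simp add: c_def nat_le_iff ceiling_le_iff)
  moreover have "s * real M \<le> real c"
    unfolding c_def by linarith
  ultimately have "real (card {j \<in> {1..<M}. s \<le> real j / real M}) \<le> real M - s * real M"
    by linarith
  then show ?thesis by (simp add: right_diff_distrib mult.commute)
next
  case False
  have "{j \<in> {1..<M}. s \<le> real j / real M} = {}"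
  proof (rule ccontr)
    assume "{j \<in> {1..<M}. s \<le> real j / real M} \<noteq> {}"
    then obtain j where "j < M" "s \<le> real j / real M" by auto
    moreover from this have "real j / real M < 1" by simp
    ultimately show False using False by linarith
  qed
  then have "card {j \<in> {1..<M}. s \<le> real j / real M} = 0" by (simp only: card.empty)
  then show ?thesis by linarith
qed

lemma measure_ellipsoid:
  fixes A :: "real ^ 'n::{finite,wellorder} ^ 'n::{finite,wellorder}"
  assumes "det A \<noteq> 0" "r \<ge> 0"
  shows "{t. norm (A *v t) \<le> r} \<in> lmeasurable"
    and "measure lebesgue {t. norm (A *v t) \<le> r} = unit_ball_vol (real CARD('n)) * r ^ CARD('n) / \<bar>det A\<bar>"
    and "bounded {t. norm (A *v t) \<le> r}"
proof -
  let ?E = "{t. norm (A *v t) \<le> r}"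
  have "invertible A" using assms by (simp add: invertible_det_nz)
  then obtain B where AB: "A ** B = mat 1" "B ** A = mat 1"
    unfolding invertible_def by blast
  have E: "?E = (\<lambda>y. B *v y) ` cball 0 r"
  proof (intro set_eqI iffI)
    fix t assume "t \<in> ?E"
    then have "A *v t \<in> cball 0 r" by simp
    moreover have "t = B *v (A *v t)" by (simp add: matrix_vector_mul_assoc AB)
    ultimately show "t \<in> (\<lambda>y. B *v y) ` cball 0 r" by blast
  next
    fix t assume "t \<in> (\<lambda>y. B *v y) ` cball 0 r"
    then show "t \<in> ?E" by (auto simp: matrix_vector_mul_assoc AB)
  qed
  have lin: "linear (\<lambda>y. B *v y)" by simp
  show "?E \<in> lmeasurable"
    unfolding E using lin by (intro measurable_linear_image) auto
  show "bounded ?E"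
    unfolding E using lin by (intro bounded_linear_image) (auto simp: linear_conv_bounded_linear)
  have "det A * det B = 1" using AB(1) det_mul[of A B] by (simp add: det_I)
  then have dB: "\<bar>det B\<bar> = 1 / \<bar>det A\<bar>" using assms by (simp add: field_simps abs_mult[symmetric])
  have "measure lebesgue ?E = \<bar>det (matrix (\<lambda>y. B *v y))\<bar> * measure lebesgue (cball (0::(real,'n) vec) r)"
    unfolding E using lin by (intro measure_linear_image) auto
  also have "measure lebesgue (cball (0::(real,'n) vec) r) = unit_ball_vol (real CARD('n)) * r ^ CARD('n)"
    using content_cball[of r "0::(real,'n) vec"] assms by simp
  finally show "measure lebesgue ?E = unit_ball_vol (real CARD('n)) * r ^ CARD('n) / \<bar>det A\<bar>"
    by (simp add: dB)
qed

lemma unit_cell_cover: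
  fixes t :: "real ^ 'n"
  assumes "norm t \<le> real L"
  shows "\<exists>z \<in> (UNIV \<rightarrow>\<^sub>E {- int L..int L}). t - rvec z \<in> cbox 0 1"
proof (intro bexI)
  show "t - rvec (\<lambda>i. \<lfloor>t $ i\<rfloor>) \<in> cbox 0 1"
    by (auto simp: mem_box_cart rvec_def) linarith+
  have "\<bar>t $ i\<bar> \<le> real L" for i
    using assms component_le_norm_cart[of t i] by linarith
  then have "- real L \<le> t $ i" "t $ i \<le> real L" for i
    by (smt (verit))+
  then have "\<lfloor>t $ i\<rfloor> \<in> {- int L..int L}" for i
    by (simp add: le_floor_iff) (metis floor_mono floor_of_nat)
  then show "(\<lambda>i. \<lfloor>t $ i\<rfloor>) \<in> (UNIV \<rightarrow>\<^sub>E {- int L..int L})" by auto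
qed

text \<open>Averaging over the unit cell: its integer translates cover the sets, so the counting
  function integrates over the cell to at least the sum of the measures. A bound \<open>k\<close>
  everywhere would make the integral at most \<open>k\<close>.\<close>

lemma exists_heavy_translate:
  fixes E :: "nat \<Rightarrow> (real ^ 'n) set"
  assumes J: "finite J"
    and meas: "\<And>j. j \<in> J \<Longrightarrow> E j \<in> lmeasurable"
    and bd: "\<And>j. j \<in> J \<Longrightarrow> bounded (E j)"
    and big: "k < (\<Sum>j\<in>J. measure lebesgue (E j))"
  obtains t :: "real ^ 'n" and Z where "finite Z" "k < (\<Sum>z\<in>Z. real (card {j \<in> J. t + rvec z \<in> E j}))"
proof -
  have "bounded (\<Union>j\<in>J. E j)" using J bd by auto
  then obtain b where b: "\<And>j t. j \<in> J \<Longrightarrow> t \<in> E j \<Longrightarrow> norm t \<le> b"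
    unfolding bounded_iff by blast
  define L where "L = nat \<lceil>b\<rceil>"
  have L: "\<And>j t. j \<in> J \<Longrightarrow> t \<in> E j \<Longrightarrow> norm t \<le> real L"
    using b unfolding L_def by (meson dual_order.trans real_nat_ceiling_ge)
  define Z where "Z = ((UNIV::'n set) \<rightarrow>\<^sub>E {- int L..int L})"
  have Z: "finite Z" unfolding Z_def by (intro finite_PiE) auto
  define C :: "(real ^ 'n) set" where "C = cbox 0 1"
  have C: "C \<in> lmeasurable" by (simp add: C_def)
  define T where "T = (\<lambda>z j. {t \<in> C. t + rvec z \<in> E j})"
  have T: "T z j = (+) (- rvec z) ` (E j \<inter> (+) (rvec z) ` C)" for z j
    unfolding T_def by (auto simp: image_iff algebra_simps) 
  have Tm: "T z j \<in> lmeasurable" if "j \<in> J" for z j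
    unfolding T using meas[OF that] C by (intro measurable_translation fmeasurable.Int)
  have "measure lebesgue (E j) \<le> (\<Sum>z\<in>Z. measure lebesgue (T z j))" if j: "j \<in> J" for j
  proof -
    have "E j = (\<Union>z\<in>Z. E j \<inter> (+) (rvec z) ` C)"
    proof -
      have "\<exists>z\<in>Z. t \<in> (+) (rvec z) ` C" if t: "t \<in> E j" for t
      proof -
        obtain z where "z \<in> Z" "t - rvec z \<in> C"
          using unit_cell_cover[OF L[OF j t]] unfolding Z_def C_def by blast
        then show ?thesis by (auto simp: image_iff intro!: bexI[of _ z] bexI[of _ "t - rvec z"])
      qed
      then show ?thesis by auto
    qed
    also have "measure lebesgue \<dots> \<le> (\<Sum>z\<in>Z. measure lebesgue (E j \<inter> (+) (rvec z) ` C))"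
      using Z meas[OF j] C
      by (intro measure_UNION_le fmeasurableD fmeasurable.Int measurable_translation)
    also have "\<dots> = (\<Sum>z\<in>Z. measure lebesgue (T z j))"
      unfolding T measure_translation ..
    finally show ?thesis .
  qed
  then have "(\<Sum>j\<in>J. measure lebesgue (E j)) \<le> (\<Sum>j\<in>J. \<Sum>z\<in>Z. measure lebesgue (T z j))"
    by (rule sum_mono)
  with big have k: "k < (\<Sum>j\<in>J. \<Sum>z\<in>Z. measure lebesgue (T z j))" by linarith
  have "\<exists>t. k < (\<Sum>z\<in>Z. real (card {j \<in> J. t + rvec z \<in> E j}))"
  proof (rule ccontr)
    assume "\<nexists>t. k < (\<Sum>z\<in>Z. real (card {j \<in> J. t + rvec z \<in> E j}))"
    then have le: "(\<Sum>z\<in>Z. real (card {j \<in> J. t + rvec z \<in> E j})) \<le> k" for t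
      by (meson linorder_not_less)
    have int: "integrable lebesgue (indicat_real (T z j))" if "j \<in> J" for z j
      using Tm[OF that] by (simp add: lmeasurable_iff_integrable)
    have intC: "integrable lebesgue (indicat_real C)"
      using C by (simp add: lmeasurable_iff_integrable)
    have "(\<Sum>j\<in>J. \<Sum>z\<in>Z. measure lebesgue (T z j)) =
      (\<Sum>j\<in>J. \<Sum>z\<in>Z. integral\<^sup>L lebesgue (indicat_real (T z j)))"
      by (intro sum.cong refl) (simp add: Tm fmeasurableD)
    also have "\<dots> = integral\<^sup>L lebesgue (\<lambda>t. \<Sum>j\<in>J. \<Sum>z\<in>Z. indicat_real (T z j) t)"
      using int by (subst Bochner_Integration.integral_sum) (auto intro!: sum.cong Bochner_Integration.integral_sum[symmetric])
    also have "\<dots> \<le> integral\<^sup>L lebesgue (\<lambda>t. k * indicat_real C t)"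
    proof (rule integral_mono)
      fix t
      show "(\<Sum>j\<in>J. \<Sum>z\<in>Z. indicat_real (T z j) t) \<le> k * indicat_real C t"
      proof (cases "t \<in> C")
        case True
        have "(\<Sum>j\<in>J. \<Sum>z\<in>Z. indicat_real (T z j) t) = (\<Sum>z\<in>Z. \<Sum>j\<in>J. indicat_real (T z j) t)"
          by (rule sum.swap)
        also have "\<dots> = (\<Sum>z\<in>Z. real (card {j \<in> J. t + rvec z \<in> E j}))"
          using J True by (intro sum.cong refl) (simp add: T_def indicator_def sum.If_cases Int_def)
        finally show ?thesis using le True by simp
      qed (simp add: T_def)
    qed (use int intC in auto)
    also have "\<dots> = k * measure lebesgue C" using C by (simp add: fmeasurableD)
    also have "measure lebesgue C = 1"
      using content_cbox_cart[of "0::real^'n" 1] by (simp add: C_def interval_ne_empty_cart)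
    finally show False using k by simp
  qed
  then show thesis using that Z by blast
qed

lemma pigeonhole_sum:
  fixes f :: "'a \<Rightarrow> real"
  assumes "finite Z" "lab ` Z \<subseteq> X" "finite X" "real (card X) * c < (\<Sum>z\<in>Z. f z)"
  obtains x where "c < (\<Sum>z\<in>{z\<in>Z. lab z = x}. f z)"
proof -
  have "\<exists>x. c < (\<Sum>z\<in>{z\<in>Z. lab z = x}. f z)"
  proof (rule ccontr)
    assume "\<not> ?thesis"
    then have "(\<Sum>x\<in>X. \<Sum>z\<in>{z\<in>Z. lab z = x}. f z) \<le> (\<Sum>x\<in>X. c)"
      by (intro sum_mono) (simp add: not_less)
    also have "(\<Sum>x\<in>X. \<Sum>z\<in>{z\<in>Z. lab z = x}. f z) = (\<Sum>z\<in>Z. f z)"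
      using assms by (intro sum.group) auto
    finally show False using assms by simp
  qed
  then show thesis using that by blast
qed

text \<open>
  The weight \<open>card {j. \<dots>} / M\<close> is a step function below the function
  \<open>max 0 (1 - \<bar>A t\<bar>\<^sup>2 / R)\<close>. Points whose weights sum to more than \<open>1\<close> cannot have all
  their mutual distances at least \<open>sqrt (2 * R)\<close>; this improves the bound that Minkowski's
  theorem gives for a ball.
\<close>
theorem blichfeldt:
  fixes A :: "real ^ 'n::{finite,wellorder} ^ 'n::{finite,wellorder}" and lab :: "('n::{finite,wellorder} \<Rightarrow> int) \<Rightarrow> 'c"
  assumes A: "det A \<noteq> 0" and R: "R > 0" and M: "M > 0"
    and lab: "range lab \<subseteq> X" "finite X"
    and big: "real (card X) * \<bar>det A\<bar> * real M <
      unit_ball_vol (real CARD('n)) * (\<Sum>j\<in>{1..<M}. sqrt (R * real j / real M) ^ CARD('n))"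
  obtains u v where "u \<noteq> v" "lab u = lab v" "norm (A *v (rvec u - rvec v)) ^ 2 < 2 * R"
proof -
  define E where "E = (\<lambda>j. {t. norm (A *v t) \<le> sqrt (R * real j / real M)})"
  have total: "real (card X) * real M < (\<Sum>j\<in>{1..<M}. measure lebesgue (E j))"
  proof -
    have "(\<Sum>j\<in>{1..<M}. measure lebesgue (E j)) =
      unit_ball_vol (real CARD('n)) * (\<Sum>j\<in>{1..<M}. sqrt (R * real j / real M) ^ CARD('n)) / \<bar>det A\<bar>"
      unfolding E_def using A R M
      by (simp add: measure_ellipsoid sum_divide_distrib sum_distrib_left)
    moreover have "real (card X) * real M < unit_ball_vol (real CARD('n)) *
        (\<Sum>j\<in>{1..<M}. sqrt (R * real j / real M) ^ CARD('n)) / \<bar>det A\<bar>"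
      using big A by (subst pos_less_divide_eq) (auto simp: mult_ac)
    ultimately show ?thesis by linarith
  qed
  have E: "E j \<in> lmeasurable" "bounded (E j)" for j
    unfolding E_def using A R by (auto intro!: measure_ellipsoid)
  obtain t Z where Z: "finite Z"
    and "real (card X) * real M < (\<Sum>z\<in>Z. real (card {j \<in> {1..<M}. t + rvec z \<in> E j}))"
    by (rule exists_heavy_translate[OF finite_atLeastLessThan E total])
  \<comment> \<open>Labels play the part of cosets of a sublattice of index at most
    \<open>card X\<close>: equal labels express that the difference lies in it, and it can be given
    by congruences instead of a basis.\<close>
  then obtain c where c: "real M < (\<Sum>z\<in>{z\<in>Z. lab z = c}. real (card {j \<in> {1..<M}. t + rvec z \<in> E j}))"
    using pigeonhole_sum[of Z lab X] lab by blast
  define y where "y = (\<lambda>z. A *v (t + rvec z))"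
  define S where "S = {z \<in> Z. lab z = c \<and> norm (y z) ^ 2 < R}"
  have S: "finite S" using Z by (simp add: S_def)
  have weight: "real (card {j \<in> {1..<M}. t + rvec z \<in> E j}) \<le> max 0 (real M * (1 - norm (y z) ^ 2 / R))" for z
  proof -
    have "norm (y z) \<le> sqrt (R * real j / real M) \<longleftrightarrow> norm (y z) ^ 2 / R \<le> real j / real M" for j
    proof -
      have "norm (y z) \<le> sqrt (R * real j / real M) \<longleftrightarrow> norm (y z) ^ 2 \<le> R * real j / real M"
        by (subst real_sqrt_le_iff[symmetric]) simp
      also have "\<dots> \<longleftrightarrow> norm (y z) ^ 2 / R \<le> real j / real M"
        using R by (simp add: pos_divide_le_eq mult.commute)
      finally show ?thesis .
    qed
    then have "{j \<in> {1..<M}. t + rvec z \<in> E j} = {j \<in> {1..<M}. norm (y z) ^ 2 / R \<le> real j / real M}"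
      unfolding E_def y_def by simp
    then show ?thesis using card_multiples_above[of "norm (y z) ^ 2 / R" M] R M by simp
  qed
  have "real M < (\<Sum>z\<in>{z\<in>Z. lab z = c}. max 0 (real M * (1 - norm (y z) ^ 2 / R)))"
    using c by (rule less_le_trans) (rule sum_mono, rule weight)
  also have "\<dots> = (\<Sum>z\<in>S. real M * (1 - norm (y z) ^ 2 / R))"
  proof (rule sum.mono_neutral_cong_right)
    show "\<forall>z\<in>{z\<in>Z. lab z = c} - S. max 0 (real M * (1 - norm (y z) ^ 2 / R)) = 0"
      using R M by (auto simp: S_def mult_le_0_iff not_less intro!: max_absorb1)
    show "max 0 (real M * (1 - norm (y z) ^ 2 / R)) = real M * (1 - norm (y z) ^ 2 / R)" if "z \<in> S" for z
      using R that by (auto simp: S_def max_def)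
  qed (use Z in \<open>auto simp: S_def\<close>)
  also have "\<dots> = real M * (real (card S) - (\<Sum>z\<in>S. norm (y z) ^ 2) / R)"
    by (simp add: sum_distrib_left[symmetric] sum_subtractf sum_divide_distrib[symmetric])
  finally have "real M * 1 < real M * (real (card S) - (\<Sum>z\<in>S. norm (y z) ^ 2) / R)" by simp
  then have lt: "1 < real (card S) - (\<Sum>z\<in>S. norm (y z) ^ 2) / R"
    using M by (simp add: mult_less_cancel_left_pos del: mult_1_right)
  have "\<exists>u\<in>S. \<exists>v\<in>S. u \<noteq> v \<and> norm (y u - y v) ^ 2 < 2 * R"
  proof (rule ccontr)
    assume "\<not> ?thesis"
    then have le: "real (card S * (card S - 1)) * R \<le> real (card S) * (\<Sum>u\<in>S. norm (y u) ^ 2)"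
      by (intro scattered_points_bound[OF S]) (auto simp: not_less)
    have S1: "card S \<ge> 1"
      using lt R by (cases "card S") (auto simp: sum_nonneg S)
    then have "real (card S - 1) * R \<le> (\<Sum>u\<in>S. norm (y u) ^ 2)"
      using le by (simp add: mult.assoc)
    \<comment> \<open>By \<open>lt\<close> the squared norms sum to less than \<open>R\<close> times
      \<open>card S - 1\<close>.\<close>
    with lt S1 R show False by (simp add: field_simps of_nat_diff)
  qed
  then obtain u v where "u \<in> S" "v \<in> S" "u \<noteq> v" "norm (y u - y v) ^ 2 < 2 * R" by blast
  moreover have "y u - y v = A *v (rvec u - rvec v)"
    unfolding y_def by (simp add: matrix_vector_mult_diff_distrib matrix_vector_right_distrib)
  ultimately show thesis using that[of u v] by (simp add: S_def)
qed

section \<open>Short vectors in lattices of quadruples\<close>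

datatype blk = B0 | B1 | B2 | B3
datatype crd = C0 | C1 | C2
datatype idx = Idx (blk: blk) (crd: crd)

text \<open>Enumerates the twelve indices block by block, an order in which \<open>trc_mat\<close>
  is upper triangular.\<close>

fun key :: "idx \<Rightarrow> nat" where
  "key (Idx i k) = 3 * (case i of B0 \<Rightarrow> 0 | B1 \<Rightarrow> 1 | B2 \<Rightarrow> 2 | B3 \<Rightarrow> 3) +
     (case k of C0 \<Rightarrow> 0 | C1 \<Rightarrow> 1 | C2 \<Rightarrow> 2)"

lemma key_inject: "key p = key p' \<longleftrightarrow> p = p'"
proof -
  obtain i k i' k' where "p = Idx i k" "p' = Idx i' k'" by (cases p; cases p') 
  then show ?thesis by (cases i; cases i'; cases k; cases k'; simp)
qed

lemma UNIV_blk: "UNIV = {B0, B1, B2, B3}" and UNIV_crd: "UNIV = {C0, C1, C2}"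
proof -
  have "i \<in> {B0, B1, B2, B3}" for i by (cases i) auto
  then show "UNIV = {B0, B1, B2, B3}" by blast
  have "k \<in> {C0, C1, C2}" for k by (cases k) auto
  then show "UNIV = {C0, C1, C2}" by blast
qed

lemma UNIV_idx: "UNIV = (\<lambda>(i, k). Idx i k) ` (UNIV \<times> UNIV)"
proof -
  have "p \<in> (\<lambda>(i, k). Idx i k) ` (UNIV \<times> UNIV)" for p
    by (rule image_eqI[of _ _ "(blk p, crd p)"]) auto
  then show ?thesis by blast
qed

instance blk :: finite by standard (simp add: UNIV_blk)
instance crd :: finite by standard (simp add: UNIV_crd)
instance idx :: finite by standard (simp add: UNIV_idx)

instantiation idx :: wellorder
begin

definition "p \<le> p' \<longleftrightarrow> key p \<le> key p'"
definition "p < p' \<longleftrightarrow> key p < key p'"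

instance
proof
  fix P :: "idx \<Rightarrow> bool" and p
  assume step: "\<And>p. (\<And>p'. p' < p \<Longrightarrow> P p') \<Longrightarrow> P p"
  show "P p"
  proof (induction p rule: measure_induct_rule[of key])
    case (less p)
    show ?case by (rule step, rule less.IH) (simp only: less_idx_def)
  qed
qed (auto simp: less_eq_idx_def less_idx_def key_inject[symmetric])

end

lemma sum_idx: "(\<Sum>p\<in>UNIV. f p) = (\<Sum>i\<in>UNIV. \<Sum>k\<in>UNIV. f (Idx i k))"
  by (simp add: UNIV_idx sum.reindex inj_on_def case_prod_unfold sum.cartesian_product)

lemma prod_idx: "(\<Prod>p\<in>UNIV. f p) = (\<Prod>i\<in>UNIV. \<Prod>k\<in>UNIV. f (Idx i k))"
  by (simp add: UNIV_idx prod.reindex inj_on_def case_prod_unfold prod.cartesian_product)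

lemma CARD_idx: "CARD(idx) = 12"
  by (simp add: UNIV_idx card_image inj_on_def UNIV_blk UNIV_crd)

text \<open>The Cholesky factor of the quadratic form \<open>trc (x\<^sup>2)\<close>.\<close>
fun chol :: "crd \<Rightarrow> crd \<Rightarrow> real" where
  "chol C0 C0 = sqrt 3"
| "chol C0 C1 = - sqrt 3 / 3"
| "chol C0 C2 = 5 * sqrt 3 / 3"
| "chol C1 C1 = sqrt (14/3)"
| "chol C1 C2 = - sqrt (14/3) / 2"
| "chol C2 C2 = sqrt (7/2)"
| "chol _ _ = 0"

definition trc_mat :: "real ^ idx ^ idx" where
  "trc_mat = (\<chi> p p'. if blk p = blk p' then chol (crd p) (crd p') else 0)"

text \<open>Each block contributes 7, the square root of the discriminant 49 of the field.\<close>

lemma det_trc_mat: "det trc_mat = 7 ^ 4"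
proof -
  have "det trc_mat = (\<Prod>p\<in>UNIV. trc_mat $ p $ p)"
  proof (rule det_upperdiagonal)
    fix p p' :: idx assume "p' < p"
    moreover obtain i k i' k' where "p = Idx i k" "p' = Idx i' k'" by (cases p; cases p')
    ultimately show "trc_mat $ p $ p' = 0"
      by (cases i; cases i'; cases k; cases k'; simp add: trc_mat_def less_idx_def)
  qed
  also have "\<dots> = (\<Prod>i\<in>(UNIV::blk set). sqrt 3 * sqrt (14/3) * sqrt (7/2))"
    by (simp add: prod_idx trc_mat_def UNIV_crd mult.assoc)
  also have "\<dots> = 7 ^ 4"
    by (simp add: real_sqrt_mult[symmetric] UNIV_blk)
  finally show ?thesis .
qed

definition coord :: "(idx \<Rightarrow> int) \<Rightarrow> blk \<Rightarrow> cub" where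
  "coord z i = Cub (z (Idx i C0)) (z (Idx i C1)) (z (Idx i C2))"

lemma coord_inject: "(\<And>i. coord z i = coord z' i) \<Longrightarrow> z = z'"
proof
  fix p assume *: "\<And>i. coord z i = coord z' i"
  show "z p = z' p"
    using *[of "blk p"] by (cases p; cases "crd p") (auto simp: coord_def)
qed

lemma norm_trc_mat:
  "norm (trc_mat *v (rvec u - rvec v)) ^ 2 = (\<Sum>i\<in>UNIV. real_of_int (trc ((coord u i - coord v i) ^ 2)))"
proof -
  have "norm (trc_mat *v w) ^ 2 = (\<Sum>p\<in>UNIV. ((trc_mat *v w) $ p) ^ 2)" for w
    by (simp add: norm_vec_def L2_set_def sum_nonneg)
  moreover have "(trc_mat *v (rvec u - rvec v)) $ Idx i k =
    (\<Sum>l\<in>UNIV. chol k l * real_of_int (u (Idx i l) - v (Idx i l)))" for i k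
    by (simp add: matrix_vector_mult_def trc_mat_def rvec_def sum_idx if_distrib[of "\<lambda>x. x * _"]
        sum.swap[of _ "UNIV::crd set"] cong: if_cong)
  ultimately have "norm (trc_mat *v (rvec u - rvec v)) ^ 2 =
    (\<Sum>i\<in>UNIV. \<Sum>k\<in>UNIV. (\<Sum>l\<in>UNIV. chol k l * real_of_int (u (Idx i l) - v (Idx i l))) ^ 2)"
    by (simp add: sum_idx)
  also have "\<dots> = (\<Sum>i\<in>UNIV. real_of_int (trc ((coord u i - coord v i) ^ 2)))"
  proof (rule sum.cong[OF refl])
    fix i
    define a b c where "a = real_of_int (u (Idx i C0) - v (Idx i C0))"
      and "b = real_of_int (u (Idx i C1) - v (Idx i C1))" and "c = real_of_int (u (Idx i C2) - v (Idx i C2))"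
    have "(\<Sum>k\<in>UNIV. (\<Sum>l\<in>UNIV. chol k l * real_of_int (u (Idx i l) - v (Idx i l))) ^ 2) =
      (sqrt 3 * (a - b / 3 + 5 * c / 3)) ^ 2 + (sqrt (14/3) * (b - c / 2)) ^ 2 + (sqrt (7/2) * c) ^ 2"
    proof -
      have "(\<Sum>k\<in>UNIV. (\<Sum>l\<in>UNIV. chol k l * real_of_int (u (Idx i l) - v (Idx i l))) ^ 2) =
        (sqrt 3 * a + (- sqrt 3 / 3 * b + 5 * sqrt 3 / 3 * c)) ^ 2 +
        ((sqrt (14/3) * b + - sqrt (14/3) / 2 * c) ^ 2 + (sqrt (7/2) * c) ^ 2)"
        unfolding a_def b_def c_def UNIV_crd by simp
      then show ?thesis by (simp add: algebra_simps)
    qed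
    also have "\<dots> = 3 * (a - b / 3 + 5 * c / 3) ^ 2 + 14/3 * (b - c / 2) ^ 2 + 7/2 * c ^ 2"
      by (simp add: power_mult_distrib)
    also have "\<dots> = real_of_int (trc ((coord u i - coord v i) ^ 2))"
      by (simp add: trc_square coord_def a_def b_def c_def)
    finally show "(\<Sum>k\<in>UNIV. (\<Sum>l\<in>UNIV. chol k l * real_of_int (u (Idx i l) - v (Idx i l))) ^ 2) =
      real_of_int (trc ((coord u i - coord v i) ^ 2))" .
  qed
  finally show ?thesis .
qed

text \<open>If pi were at most 3.09, then 1/2 = sin (pi / 6) would be at most sin 0.515, whose
  Taylor polynomial gives about 0.492.\<close>

lemma pi_gt_309: "pi > 309/100"
proof (rule ccontr)
  let ?x = "515/1000 :: real"
  assume "\<not> pi > 309/100"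
  then have "sin (pi / 6) \<le> sin ?x"
    using pi_ge_two by (intro sin_monotone_2pi_le) auto
  moreover have "\<bar>sin ?x - (\<Sum>m<5. sin_coeff m * ?x ^ m)\<bar> \<le> inverse (fact 5) * \<bar>?x\<bar> ^ 5"
    by (rule Maclaurin_sin_bound)
  moreover have "(\<Sum>m<5. sin_coeff m * ?x ^ m) = ?x - ?x ^ 3 / 6"
  proof -
    have "{..<5::nat} = {0, 1, 2, 3, 4}" by auto
    moreover have "sin_coeff 0 = 0" "sin_coeff 1 = 1" "sin_coeff 2 = 0" "sin_coeff 3 = - 1 / 6" "sin_coeff 4 = 0"
      by (simp_all add: sin_coeff_def fact_numeral)
    ultimately show ?thesis by simp
  qed
  ultimately show False
    by (simp add: sin_30 fact_numeral power_divide) 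
qed

lemma unit_ball_vol_12: "unit_ball_vol 12 > 1208/1000"
proof -
  have "unit_ball_vol 12 = pi ^ 6 / fact 6"
    using unit_ball_vol_even[of 6] by simp
  moreover have "(309/100) ^ 6 / fact 6 \<le> pi ^ 6 / fact 6"
    using pi_gt_309 by (intro divide_right_mono power_mono) auto
  moreover have "1208/1000 < (309/100) ^ 6 / (fact 6 :: real)"
    by (simp add: fact_numeral power_divide)
  ultimately show ?thesis by linarith
qed

lemma sum_power6:
  "42 * real (\<Sum>j\<in>{1..<Suc n}. j ^ 6) =
    6 * real n ^ 7 + 21 * real n ^ 6 + 21 * real n ^ 5 - 7 * real n ^ 3 + real n"
proof (induction n)
  case (Suc n)
  have "42 * real (\<Sum>j\<in>{1..<Suc (Suc n)}. j ^ 6) =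
    42 * real (\<Sum>j\<in>{1..<Suc n}. j ^ 6) + 42 * (real n + 1) ^ 6"
    by (simp add: algebra_simps)
  then show ?case
    unfolding Suc.IH by (simp add: eval_nat_numeral algebra_simps)
qed simp

text \<open>The count \<open>512 * q ^ 2\<close> allows for three congruences modulo 2, with 8
  residues each, and two modulo an element of norm \<open>q\<close>. By AM-GM the trace bound keeps
  the norm of the sum of the four squares below 64 * 13 * \<open>q\<close>.\<close>

lemma short_quadruple:
  fixes lab :: "(blk \<Rightarrow> cub) \<Rightarrow> 'c"
  assumes X: "range lab \<subseteq> X" "finite X" "card X \<le> 512 * q ^ 2" and q: "q > 0"
  obtains x y where "x \<noteq> y" "lab x = lab y"
    "(\<Sum>i\<in>UNIV. real_of_int (trc ((x i - y i) ^ 2))) < 12 * root 3 (13 * real q)"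
proof -
  define R where "R = 6 * root 3 (13 * real q)"
  have R: "R > 0" using q by (simp add: R_def)
  have "root 3 (13 * real q) ^ 3 = 13 * real q"
    using q by (intro real_root_pow_pos2) auto
  then have "R ^ 3 = 216 * (13 * real q)"
    by (simp add: R_def power_mult_distrib)
  moreover have "R ^ 6 = (R ^ 3) ^ 2"
    by (simp only: power_mult[symmetric]) simp
  ultimately have R6: "R ^ 6 = 6 ^ 6 * (13 * real q) ^ 2"
    by (simp add: power_mult_distrib)
  have summand: "sqrt (R * real j / real 100) ^ CARD(idx) = R ^ 6 / 100 ^ 6 * real (j ^ 6)" for j
  proof -
    have "sqrt (R * real j / 100) ^ 12 = (sqrt (R * real j / 100) ^ 2) ^ 6"
      by (simp flip: power_mult)
    then show ?thesis using R by (simp add: CARD_idx power_mult_distrib power_divide)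
  qed
  have S: "(\<Sum>j\<in>{1..<100}. sqrt (R * real j / real 100) ^ CARD(idx)) =
      R ^ 6 / 100 ^ 6 * real (\<Sum>j\<in>{1..<100}. j ^ 6)"
    unfolding summand of_nat_sum sum_distrib_left ..
  have S6: "real (\<Sum>j\<in>{1..<100}. j ^ 6) = 13790714119050"
    using sum_power6[of 99] by simp
  have "real (card X) * \<bar>det trc_mat\<bar> * real 100 \<le> 512 * real q ^ 2 * 7 ^ 4 * 100"
  proof -
    have "real (card X) \<le> real (512 * q ^ 2)" using X(3) by (simp only: of_nat_le_iff)
    then show ?thesis by (simp add: det_trc_mat)
  qed
  \<comment> \<open>After cancelling \<open>q ^ 2\<close> the sides are about 1.229 * 10^8 and 1.314
    * 10^8; 100 levels are fine enough for this margin.\<close>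
  also have "\<dots> < 1208/1000 * (R ^ 6 / 100 ^ 6 * 13790714119050)"
    unfolding R6 using q by (simp add: field_simps)
  also have "\<dots> \<le> unit_ball_vol 12 * (R ^ 6 / 100 ^ 6 * 13790714119050)"
    using unit_ball_vol_12 R by (intro mult_right_mono) auto
  finally have big: "real (card X) * \<bar>det trc_mat\<bar> * real 100 <
      unit_ball_vol (real CARD(idx)) * (\<Sum>j\<in>{1..<100}. sqrt (R * real j / real 100) ^ CARD(idx))"
    unfolding S S6 by (simp add: CARD_idx)
  have lab': "range (\<lambda>z. lab (coord z)) \<subseteq> X" using X(1) by auto
  have det: "det trc_mat \<noteq> 0" by (simp add: det_trc_mat)
  obtain u v where uv: "u \<noteq> v" "lab (coord u) = lab (coord v)"
    "norm (trc_mat *v (rvec u - rvec v)) ^ 2 < 2 * R"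
    by (rule blichfeldt[OF det R _ lab' X(2) big]) simp_all
  show thesis
  proof (rule that)
    show "coord u \<noteq> coord v" using uv(1) coord_inject[of u v] by auto
    show "lab (coord u) = lab (coord v)" by (rule uv(2))
    show "(\<Sum>i\<in>UNIV. real_of_int (trc ((coord u i - coord v i) ^ 2))) < 12 * root 3 (13 * real q)"
      using uv(3) unfolding norm_trc_mat R_def by linarith
  qed
qed

section \<open>Hurwitz quaternions\<close>

text \<open>The coordinates refer to the basis \<open>1, i, j, \<omega>\<close> with \<open>\<omega> = (1 + i + j + k) / 2\<close>.\<close>
datatype 'a hur = Hur (h0: 'a) (h1: 'a) (h2: 'a) (h3: 'a)

lemma hur_eq_iff: "x = y \<longleftrightarrow> h0 x = h0 y \<and> h1 x = h1 y \<and> h2 x = h2 y \<and> h3 x = h3 y"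
  by (cases x; cases y) auto

instantiation hur :: (comm_ring_1) ring_1
begin

definition "0 = Hur 0 0 0 0"
definition "1 = Hur 1 0 0 0"
definition "x + y = Hur (h0 x + h0 y) (h1 x + h1 y) (h2 x + h2 y) (h3 x + h3 y)"
definition "x - y = Hur (h0 x - h0 y) (h1 x - h1 y) (h2 x - h2 y) (h3 x - h3 y)"
definition "- x = Hur (- h0 x) (- h1 x) (- h2 x) (- h3 x)"
definition "x * y = Hur
  (h0 x * h0 y - h1 x * h1 y - h1 x * h2 y - h1 x * h3 y + h2 x * h1 y - h2 x * h2 y - h3 x * h2 y - h3 x * h3 y)
  (h0 x * h1 y + h1 x * h0 y - h1 x * h2 y + h2 x * h1 y + h2 x * h3 y + h3 x * h1 y - h3 x * h2 y)
  (h0 x * h2 y + h2 x * h0 y - h1 x * h2 y - h1 x * h3 y + h2 x * h1 y + h2 x * h3 y + h3 x * h1 y)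
  (h0 x * h3 y + h3 x * h0 y + 2 * (h1 x * h2 y) + h1 x * h3 y - 2 * (h2 x * h1 y) - h2 x * h3 y
    - h3 x * h1 y + h3 x * h2 y + h3 x * h3 y)"

instance
proof
  fix x y z :: "'a hur"
  show "x * y * z = x * (y * z)"
    unfolding times_hur_def hur.sel hur.inject
    by (intro conjI; simp only: ring_distribs mult.assoc mult.commute mult.left_commute; simp)
  show "(x + y) * z = x * z + y * z" "x * (y + z) = x * y + x * z"
    unfolding times_hur_def plus_hur_def hur.sel hur.inject by (intro conjI; simp add: algebra_simps)+
qed (simp_all add: zero_hur_def one_hur_def plus_hur_def minus_hur_def uminus_hur_def times_hur_def add_ac)

end

lemma hur_sel [simp]:
  "h0 0 = 0" "h1 0 = 0" "h2 0 = 0" "h3 0 = 0" "h0 1 = 1" "h1 1 = 0" "h2 1 = 0" "h3 1 = 0"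
  "h0 (x + y) = h0 x + h0 y" "h1 (x + y) = h1 x + h1 y" "h2 (x + y) = h2 x + h2 y" "h3 (x + y) = h3 x + h3 y"
  "h0 (x - y) = h0 x - h0 y" "h1 (x - y) = h1 x - h1 y" "h2 (x - y) = h2 x - h2 y" "h3 (x - y) = h3 x - h3 y"
  "h0 (- x) = - h0 x" "h1 (- x) = - h1 x" "h2 (- x) = - h2 x" "h3 (- x) = - h3 x"
  by (simp_all add: zero_hur_def one_hur_def plus_hur_def minus_hur_def uminus_hur_def)

definition cnj :: "'a::comm_ring_1 hur \<Rightarrow> 'a hur" where
  "cnj x = Hur (h0 x + h3 x) (- h1 x) (- h2 x) (- h3 x)"

definition nr :: "'a::comm_ring_1 hur \<Rightarrow> 'a" where
  "nr x = h0 x ^ 2 + h1 x ^ 2 + h2 x ^ 2 + h3 x ^ 2 + h3 x * (h0 x + h1 x + h2 x)"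

definition sc :: "'a::comm_ring_1 \<Rightarrow> 'a hur" where
  "sc c = Hur c 0 0 0"

lemma sc_sel [simp]: "h0 (sc c) = c" "h1 (sc c) = 0" "h2 (sc c) = 0" "h3 (sc c) = 0"
  by (simp_all add: sc_def)

lemma sc_mult: "sc (a * b) = sc a * sc b" and sc_0 [simp]: "sc 0 = 0" and sc_1 [simp]: "sc 1 = 1"
  by (simp_all add: hur_eq_iff times_hur_def)

lemma sc_mult_sel [simp]:
  "h0 (sc c * x) = c * h0 x" "h1 (sc c * x) = c * h1 x" "h2 (sc c * x) = c * h2 x" "h3 (sc c * x) = c * h3 x"
  by (simp_all add: times_hur_def)

lemma sc_commute: "x * sc c = sc c * x"
  by (simp add: hur_eq_iff times_hur_def mult.commute)

lemma sc_left_commute: "x * (sc c * y) = sc c * (x * y)"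
  by (metis mult.assoc sc_commute)

lemma mult_cnj: "x * cnj x = sc (nr x)" and cnj_mult_self: "cnj x * x = sc (nr x)"
  by (simp_all add: hur_eq_iff times_hur_def cnj_def nr_def power2_eq_square algebra_simps)

lemma cnj_mult: "cnj (x * y) = cnj y * cnj x"
  by (simp add: hur_eq_iff times_hur_def cnj_def algebra_simps)

lemma cnj_cnj [simp]: "cnj (cnj x) = x" and cnj_sc [simp]: "cnj (sc c) = sc c"
  and cnj_1 [simp]: "cnj 1 = 1"
  by (simp_all add: hur_eq_iff cnj_def)

lemma nr_sc [simp]: "nr (sc c) = c ^ 2" and nr_1 [simp]: "nr 1 = 1" and nr_0 [simp]: "nr 0 = 0"
  by (simp_all add: nr_def)

lemma nr_cnj [simp]: "nr (cnj x) = nr x"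
  by (simp add: nr_def cnj_def power2_eq_square algebra_simps)

lemma nr_mult: "nr (x * y) = nr x * nr y"
proof -
  have "sc (nr (x * y)) = x * (y * cnj y) * cnj x"
    by (simp only: mult_cnj[symmetric] cnj_mult mult.assoc)
  also have "\<dots> = sc (nr y) * (x * cnj x)"
    unfolding mult_cnj[of y] sc_commute[of x] mult.assoc ..
  also have "\<dots> = sc (nr x * nr y)"
    by (simp only: mult_cnj sc_mult[symmetric] mult.commute)
  finally show ?thesis by (metis sc_sel(1))
qed

lemma nr_tpos:
  assumes "x \<noteq> (0 :: cub hur)" shows "tpos (nr x)"
proof -
  have *: "ev r (nr x) > 0" if r: "is_root r" and inj: "\<And>y. ev r y = 0 \<Longrightarrow> y = 0" for r :: real
  proof -
    define a b c d where "a = ev r (h0 x)" and "b = ev r (h1 x)" and "c = ev r (h2 x)" and "d = ev r (h3 x)"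
    have "ev r (nr x) = a^2 + b^2 + c^2 + d^2 + d * (a + b + c)"
      using r by (simp add: nr_def ev_add ev_power ev_mult a_def b_def c_def d_def)
    also have "\<dots> = (a + d/2)^2 + (b + d/2)^2 + (c + d/2)^2 + (d/2)^2"
      by (simp add: power2_eq_square field_simps)
    finally have eq: "ev r (nr x) = \<dots>" .
    have "ev r (nr x) \<noteq> 0"
    proof
      assume "ev r (nr x) = 0"
      then have "(d/2)^2 = 0 \<and> (c + d/2)^2 = 0 \<and> (b + d/2)^2 = 0 \<and> (a + d/2)^2 = 0"
        unfolding eq by (smt (verit) zero_le_power2)
      then have "a = 0" "b = 0" "c = 0" "d = 0" by auto
      then have "x = 0" using inj by (simp add: hur_eq_iff a_def b_def c_def d_def)
      then show False using assms by simp
    qed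
    then show ?thesis using eq by (smt (verit) zero_le_power2)
  qed
  show ?thesis unfolding tpos_def by (intro conjI *) simp_all
qed

section \<open>Divisibility of quaternions by scalars\<close>

definition sdvd :: "'a::comm_ring_1 \<Rightarrow> 'a hur \<Rightarrow> bool" where
  "sdvd c x \<longleftrightarrow> (\<exists>y. x = sc c * y)"

lemma sdvd_iff: "sdvd c x \<longleftrightarrow> c dvd h0 x \<and> c dvd h1 x \<and> c dvd h2 x \<and> c dvd h3 x"
proof
  assume "c dvd h0 x \<and> c dvd h1 x \<and> c dvd h2 x \<and> c dvd h3 x"
  then obtain p q r s where "h0 x = c * p" "h1 x = c * q" "h2 x = c * r" "h3 x = c * s"
    by (auto elim!: dvdE)
  then have "x = sc c * Hur p q r s" by (simp add: hur_eq_iff)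
  then show "sdvd c x" unfolding sdvd_def by blast
qed (auto simp: sdvd_def)

lemma sdvd_add: "sdvd c x \<Longrightarrow> sdvd c y \<Longrightarrow> sdvd c (x + y)"
  and sdvd_diff: "sdvd c x \<Longrightarrow> sdvd c y \<Longrightarrow> sdvd c (x - y)"
  and sdvd_mult_left: "sdvd c y \<Longrightarrow> sdvd c (x * y)"
  and sdvd_mult_right: "sdvd c x \<Longrightarrow> sdvd c (x * y)"
  unfolding sdvd_def by (metis distrib_left, metis right_diff_distrib, metis sc_left_commute, metis mult.assoc)

lemma sdvd_cong: "sdvd c (x - y) \<Longrightarrow> sdvd c x \<longleftrightarrow> sdvd c y"
  by (metis add_diff_cancel_left' diff_add_cancel sdvd_add sdvd_diff)

lemma sdvd_mult_cong:
  assumes "sdvd c (x - x')" "sdvd c (y - y')"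
  shows "sdvd c (x * y - x' * y')"
proof -
  have "x * y - x' * y' = (x - x') * y + x' * (y - y')" by (simp add: algebra_simps)
  then show ?thesis using assms by (simp add: sdvd_add sdvd_mult_left sdvd_mult_right)
qed

lemma nr_sc_mult: "nr (sc c * x) = c ^ 2 * nr x"
  by (simp add: nr_mult)

lemma exact_division:
  fixes c :: "'a::idom"
  assumes "sdvd c x" "nr x = c * n" "c \<noteq> 0"
  obtains y where "x = sc c * y" "c * nr y = n"
proof -
  obtain y where y: "x = sc c * y" using assms(1) by (auto simp: sdvd_def)
  have "c * (c * nr y) = c * n" using assms(2) by (simp add: y nr_sc_mult power2_eq_square mult.assoc)
  then show thesis using that y assms(3) by simp
qed

text \<open>Modulo 2 the norm is s^2 + s d + d^2, the norm form from the field with 64 elements to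
  that with 8. It is anisotropic because the latter has no primitive cube root of unity.\<close>

lemma two_dvd_nr:
  assumes "2 dvd nr (x :: cub hur)"
  shows "2 dvd h0 x + h1 x + h2 x" "2 dvd h3 x"
proof -
  define s d where "s = h0 x + h1 x + h2 x" and "d = h3 x"
  have "s^2 + s * d + d^2 = nr x + 2 * (h0 x * h1 x + h1 x * h2 x + h0 x * h2 x)"
    by (simp add: nr_def s_def d_def power2_eq_square algebra_simps)
  then have "2 dvd s^2 + s * d + d^2" using assms by simp
  then have "of_int 2 dvd s * s + s * d + d * d" by (simp add: power2_eq_square)
  then have *: "even (c0 (s * s + s * d + d * d))" "even (c1 (s * s + s * d + d * d))" "even (c2 (s * s + s * d + d * d))"
    unfolding of_int_dvd_iff by auto
  have "even (c0 s) \<and> even (c1 s) \<and> even (c2 s) \<and> even (c0 d) \<and> even (c1 d) \<and> even (c2 d)"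
    using * unfolding cub_sel cub_sel_mult
    by (cases "even (c0 s)"; cases "even (c1 s)"; cases "even (c2 s)";
        cases "even (c0 d)"; cases "even (c1 d)"; cases "even (c2 d)"; simp)
  then have "of_int 2 dvd s" "of_int 2 dvd d" unfolding of_int_dvd_iff by auto
  then show "2 dvd h0 x + h1 x + h2 x" "2 dvd h3 x" by (simp_all add: s_def d_def)
qed

text \<open>By \<open>two_dvd_nr\<close> the quaternion lies in the prime ideal generated by 1 - i,
  so its product with 1 - i is divisible by 2, and the quotient has norm \<open>m\<close>.\<close>

lemma divide_by_two:
  assumes "nr x = 2 * (m :: cub)"
  obtains y where "nr y = m"
proof -
  have "2 dvd nr x" using assms by simp
  note even = two_dvd_nr[OF this]
  obtain s d where s: "h0 x + h1 x + h2 x = 2 * s" and d: "h3 x = 2 * d"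
    using even by (auto elim!: dvdE)
  have a: "h0 x = 2 * s - h1 x - h2 x" using s by (simp add: algebra_simps)
  define y where "y = Hur (s - h2 x) (h1 x - s - d) (- d) (2 * d + h2 x)"
  have "sc 2 * y = x * Hur 1 (- 1) 0 0"
    by (simp add: hur_eq_iff y_def times_hur_def a d algebra_simps)
  then have "nr (sc 2) * nr y = nr x * nr (Hur 1 (- 1) 0 0)"
    by (simp only: nr_mult[symmetric])
  then have "4 * nr y = 4 * m"
    unfolding assms by (simp add: nr_def[of "Hur _ _ _ _"])
  then have "nr y = m" by simp
  then show thesis by (rule that)
qed

section \<open>Reduction modulo \<open>dlt\<close>\<close>

definition lift :: "int hur \<Rightarrow> cub hur" where
  "lift p = Hur (of_int (h0 p)) (of_int (h1 p)) (of_int (h2 p)) (of_int (h3 p))"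

definition red :: "cub hur \<Rightarrow> int hur" where
  "red x = Hur (res7 (h0 x) mod 7) (res7 (h1 x) mod 7) (res7 (h2 x) mod 7) (res7 (h3 x) mod 7)"

lemma lift_mult: "lift (p * q) = lift p * lift q" and lift_diff: "lift (p - q) = lift p - lift q"
  by (simp_all add: hur_eq_iff lift_def times_hur_def)

lemma sdvd_lift: "sdvd dlt (lift p) \<longleftrightarrow> sdvd 7 p"
  by (simp add: sdvd_iff lift_def dlt_dvd_iff res7_simps)

lemma sdvd_red: "sdvd dlt (x - lift (red x))"
proof -
  have "dlt dvd y - of_int (res7 y mod 7)" for y
    by (simp add: dlt_dvd_iff res7_simps mod_eq_dvd_iff[symmetric])
  then show ?thesis by (simp add: sdvd_iff lift_def red_def)
qed

lemma sdvd_via_red: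
  assumes "sdvd dlt (z - lift q)"
  shows "sdvd dlt (x * z) \<longleftrightarrow> sdvd 7 (red x * q)"
  using sdvd_cong[OF sdvd_mult_cong[OF sdvd_red assms]] by (simp add: sdvd_lift[symmetric] lift_mult)

definition rng7 :: "int list" where
  "rng7 = [0, 1, 2, 3, 4, 5, 6]"

lemma mod_7_in_rng7: "a mod 7 \<in> set rng7"
proof -
  have "0 \<le> a mod 7" "a mod 7 < 7" by auto
  then have "a mod 7 \<in> {0, 1, 2, 3, 4, 5, 6}" by auto
  then show ?thesis by (simp add: rng7_def)
qed

definition nr7 :: "int \<Rightarrow> int \<Rightarrow> int \<Rightarrow> int \<Rightarrow> int" where
  "nr7 a b c d = (a * a + b * b + c * c + d * d + d * (a + b + c)) mod 7"

lemma sdvd_cnj_diff: "sdvd c (x - y) \<Longrightarrow> sdvd c (cnj x - cnj y)"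
proof -
  assume "sdvd c (x - y)"
  then have d: "c dvd h0 x - h0 y" "c dvd h1 x - h1 y" "c dvd h2 x - h2 y" "c dvd h3 x - h3 y"
    by (simp_all add: sdvd_iff)
  have "h0 x + h3 x - (h0 y + h3 y) = (h0 x - h0 y) + (h3 x - h3 y)" by simp
  then have "c dvd h0 x + h3 x - (h0 y + h3 y)" using dvd_add[OF d(1) d(4)] by (simp only:)
  moreover have "c dvd - (h1 x - h1 y)" "c dvd - (h2 x - h2 y)" "c dvd - (h3 x - h3 y)"
    using d(2-4) by (simp_all only: dvd_minus_iff)
  ultimately show ?thesis by (simp add: sdvd_iff cnj_def)
qed

lemma nr_cong: "sdvd c (x - y) \<Longrightarrow> c dvd nr x - nr y"
proof -
  assume "sdvd c (x - y)"
  then have "sdvd c (x * cnj x - y * cnj y)" by (intro sdvd_mult_cong sdvd_cnj_diff)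
  then show ?thesis unfolding mult_cnj sdvd_iff hur_sel sc_sel by blast
qed

lemma dvd_cong_diff: "c dvd a - b \<Longrightarrow> c dvd a \<longleftrightarrow> c dvd (b :: 'a :: comm_ring_1)"
  by (metis add_diff_cancel_left' diff_add_cancel dvd_add dvd_diff)

lemma nr_red: "nr (red x) mod 7 = 0 \<longleftrightarrow> dlt dvd nr x"
proof -
  have "dlt dvd nr x \<longleftrightarrow> dlt dvd nr (lift (red x))"
    by (rule dvd_cong_diff, rule nr_cong, rule sdvd_red)
  also have "nr (lift (red x)) = of_int (nr (red x))" by (simp add: nr_def lift_def)
  finally show ?thesis by (simp add: dlt_dvd_iff res7_simps mod_eq_0_iff_dvd)
qed

definition vanish7 :: "int \<Rightarrow> int \<Rightarrow> int \<Rightarrow> int \<Rightarrow> int \<times> int \<times> int \<times> int \<Rightarrow> bool" where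
  "vanish7 a b c d = (\<lambda>(e, f, g, h).
    (a * e - b * f - b * g - b * h + c * f - c * g - d * g - d * h) mod 7 = 0 \<and>
    (a * f + b * e - b * g + c * f + c * h + d * f - d * g) mod 7 = 0 \<and>
    (a * g + c * e - b * g - b * h + c * f + c * h + d * f) mod 7 = 0 \<and>
    (a * h + d * e + 2 * (b * g) + b * h - 2 * (c * f) - c * h - d * f + d * g + d * h) mod 7 = 0)"

lemma vanish7_iff: "vanish7 a b c d (e, f, g, h) \<longleftrightarrow> sdvd 7 (Hur a b c d * Hur e f g h)"
  by (simp add: vanish7_def sdvd_iff times_hur_def mod_eq_0_iff_dvd)

text \<open>Elements of norm \<open>dlt\<close>. As rank-one matrices modulo \<open>dlt\<close>
  their images are the eight lines of the plane, so each singular x satisfies x z = 0 modulo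
  \<open>dlt\<close> for one of them.\<close>

definition dlt_list :: "cub hur list" where
  "dlt_list = [Hur 0 0 \<rho> 1, Hur 0 0 1 \<rho>, Hur 0 \<rho> 0 1, Hur 0 1 0 \<rho>, Hur \<rho> 0 0 1, Hur 1 0 0 \<rho>,
     Hur (-1) \<rho> 0 1, Hur (- \<rho>) 1 0 \<rho>]"

definition dlt_red_list :: "(int \<times> int \<times> int \<times> int) list" where
  "dlt_red_list = [(0, 0, 2, 1), (0, 0, 1, 2), (0, 2, 0, 1), (0, 1, 0, 2), (2, 0, 0, 1), (1, 0, 0, 2),
     (-1, 2, 0, 1), (-2, 1, 0, 2)]"

lemma singular_mod_7:
  "list_all (\<lambda>a. list_all (\<lambda>b. list_all (\<lambda>c. list_all (\<lambda>d.
     nr7 a b c d \<noteq> 0 \<or> list_ex (vanish7 a b c d) dlt_red_list) rng7) rng7) rng7) rng7"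
  by code_simp

lemma divide_by_dlt:
  assumes "nr x = dlt * (m :: cub)"
  obtains y where "nr y = m"
proof -
  have "nr (red x) mod 7 = 0" using assms by (simp add: nr_red)
  then have "nr7 (h0 (red x)) (h1 (red x)) (h2 (red x)) (h3 (red x)) = 0"
    by (simp add: nr7_def nr_def power2_eq_square)
  moreover have "h0 (red x) \<in> set rng7" "h1 (red x) \<in> set rng7" "h2 (red x) \<in> set rng7" "h3 (red x) \<in> set rng7"
    using mod_7_in_rng7 by (simp_all add: red_def)
  ultimately have "list_ex (vanish7 (h0 (red x)) (h1 (red x)) (h2 (red x)) (h3 (red x))) dlt_red_list"
    using singular_mod_7 unfolding list_all_iff by blast
  then obtain e f g h where q: "(e, f, g, h) \<in> set dlt_red_list" and "sdvd 7 (red x * Hur e f g h)"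
    unfolding list_ex_iff by (auto simp: vanish7_iff)
  moreover have "\<exists>z. nr z = dlt \<and> sdvd dlt (z - lift (Hur e f g h))"
  proof -
    have "list_all2 (\<lambda>z (e, f, g, h). nr z = dlt \<and> sdvd dlt (z - lift (Hur e f g h))) dlt_list dlt_red_list"
      by (simp add: dlt_list_def dlt_red_list_def nr_def sdvd_iff lift_def dlt_dvd_iff res7_simps)
         (simp add: res7_def dlt_def cub_eq_iff cub_sel_mult power2_eq_square)
    then show ?thesis using q unfolding list_all2_conv_all_nth in_set_conv_nth by force
  qed
  ultimately obtain z where z: "nr z = dlt" "sdvd dlt (x * z)"
    using sdvd_via_red by blast
  have "nr (x * z) = dlt * (dlt * m)" using assms z(1) by (simp add: nr_mult mult_ac)
  then obtain y where "dlt * nr y = dlt * m"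
    using exact_division[OF z(2)] tpos_nz[OF tpos_dlt] by metis
  then have "nr y = m" using tpos_nz[OF tpos_dlt] by simp
  then show thesis by (rule that)
qed

section \<open>Universality of the norm form of the Hurwitz order\<close>

text \<open>The conjugates of the generator, 1, and the negatives of these realise all eight sign
  patterns.\<close>

lemma tpos_unit_multiple:
  assumes "x \<noteq> 0"
  obtains u where "u dvd 1" "tpos (u * x)"
proof -
  have nz: "ev rt0 x \<noteq> 0" "ev rt1 x \<noteq> 0" "ev rt2 x \<noteq> 0" using assms by auto
  have sgn: "rt0 > 0" "rt1 < 0" "rt2 < 0" using rt_bounds by linarith+
  have evu: "ev rt0 (\<rho> * x) = rt0 * ev rt0 x" "ev rt1 (\<rho> * x) = rt1 * ev rt1 x" "ev rt2 (\<rho> * x) = rt2 * ev rt2 x"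
    "ev rt0 (Cub (-2) 0 1 * x) = rt1 * ev rt0 x" "ev rt1 (Cub (-2) 0 1 * x) = rt2 * ev rt1 x"
    "ev rt2 (Cub (-2) 0 1 * x) = rt0 * ev rt2 x"
    "ev rt0 (Cub 1 (-1) (-1) * x) = rt2 * ev rt0 x" "ev rt1 (Cub 1 (-1) (-1) * x) = rt0 * ev rt1 x"
    "ev rt2 (Cub 1 (-1) (-1) * x) = rt1 * ev rt2 x"
    by (simp_all add: ev_mult ev_conj_unit)
  have units: "nrm \<rho> = 1" "nrm (Cub (-2) 0 1) = 1" "nrm (Cub 1 (-1) (-1)) = 1"
    by (simp_all add: nrm_def Let_def)
  let ?P = "\<lambda>u. u dvd 1 \<and> tpos (u * x)"
  have pos: "?P u" if "nrm u = 1" "ev rt0 (u * x) > 0" "ev rt1 (u * x) > 0" "ev rt2 (u * x) > 0" for u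
    using that by (simp add: unit_iff tpos_def)
  have neg: "?P (- u)" if "nrm u = 1" "ev rt0 (u * x) < 0" "ev rt1 (u * x) < 0" "ev rt2 (u * x) < 0" for u
    using that by (simp add: unit_iff nrm_minus tpos_def ev_minus)
  consider "ev rt0 x > 0" "ev rt1 x > 0" "ev rt2 x > 0" | "ev rt0 x > 0" "ev rt1 x > 0" "ev rt2 x < 0"
    | "ev rt0 x > 0" "ev rt1 x < 0" "ev rt2 x > 0" | "ev rt0 x > 0" "ev rt1 x < 0" "ev rt2 x < 0"
    | "ev rt0 x < 0" "ev rt1 x > 0" "ev rt2 x > 0" | "ev rt0 x < 0" "ev rt1 x > 0" "ev rt2 x < 0"
    | "ev rt0 x < 0" "ev rt1 x < 0" "ev rt2 x > 0" | "ev rt0 x < 0" "ev rt1 x < 0" "ev rt2 x < 0"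
    using nz by linarith
  then have "?P 1 \<or> ?P (- 1) \<or> ?P \<rho> \<or> ?P (- \<rho>) \<or> ?P (Cub (-2) 0 1) \<or> ?P (- Cub (-2) 0 1)
      \<or> ?P (Cub 1 (-1) (-1)) \<or> ?P (- Cub 1 (-1) (-1))"
  proof cases
    case 1
    then have "?P 1" by (intro pos) simp_all
    then show ?thesis by blast
  next
    case 2
    have "?P (- Cub (-2) 0 1)" by (intro neg) (use 2 sgn in \<open>simp_all add: units evu zero_less_mult_iff mult_less_0_iff\<close>)
    then show ?thesis by blast
  next
    case 3
    have "?P (- Cub 1 (-1) (-1))" by (intro neg) (use 3 sgn in \<open>simp_all add: units evu zero_less_mult_iff mult_less_0_iff\<close>)
    then show ?thesis by blast
  next
    case 4
    have "?P \<rho>" by (intro pos) (use 4 sgn in \<open>simp_all add: units evu zero_less_mult_iff mult_less_0_iff\<close>)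
    then show ?thesis by blast
  next
    case 5
    have "?P (- \<rho>)" by (intro neg) (use 5 sgn in \<open>simp_all add: units evu zero_less_mult_iff mult_less_0_iff\<close>)
    then show ?thesis by blast
  next
    case 6
    have "?P (Cub 1 (-1) (-1))" by (intro pos) (use 6 sgn in \<open>simp_all add: units evu zero_less_mult_iff mult_less_0_iff\<close>)
    then show ?thesis by blast
  next
    case 7
    have "?P (Cub (-2) 0 1)" by (intro pos) (use 7 sgn in \<open>simp_all add: units evu zero_less_mult_iff mult_less_0_iff\<close>)
    then show ?thesis by blast
  next
    case 8
    then have "?P (- 1)" by (intro neg) simp_all
    then show ?thesis by blast
  qed
  then show thesis using that by metis
qed

lemma nr_unit_multiple:
  assumes "nr x = m * v ^ 2" "v dvd 1"
  obtains y where "nr y = (m :: cub)"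
proof -
  obtain w where w: "1 = v * w" using assms(2) ..
  have "nr (sc w * x) = m * (v * w) ^ 2"
    by (simp add: nr_sc_mult assms(1) power_mult_distrib mult_ac)
  then show thesis using that w by simp
qed

lemma nr_reduce_small:
  assumes x: "nr x = \<alpha> * m" and \<alpha>: "tpos \<alpha>" and m: "tpos m" "nrm m < 13"
  obtains y where "nr y = \<alpha>"
proof -
  have unit: "\<exists>y. nr y = \<alpha>" if z: "nr z = \<alpha> * k" "tpos k" "nrm k = 1" for z k
  proof -
    obtain v where "v dvd 1" "k = v ^ 2" using tpos_unit_square z(2,3) by blast
    then show ?thesis using nr_unit_multiple[of z \<alpha> v] z(1) by blast
  qed
  have "nrm m = 1 \<or> 2 dvd m \<or> dlt dvd m"
    using small_norm_cases tpos_nrm_pos m by blast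
  then have "\<exists>y. nr y = \<alpha>"
  proof (elim disjE)
    assume "nrm m = 1"
    then show ?thesis using unit x m(1) by blast
  next
    assume "2 dvd m"
    then obtain k where k: "m = 2 * k" ..
    have "tpos (2 :: cub)" by (simp add: tpos_def)
    then have "tpos k" using m(1) tpos_cancel k by blast
    moreover have "nrm k = 1"
      using m(2) tpos_nrm_pos[OF \<open>tpos k\<close>] by (simp add: k nrm_mult nrm_numeral)
    moreover have "nr x = 2 * (\<alpha> * k)" using x k by (simp add: mult_ac)
    then obtain y where "nr y = \<alpha> * k" by (rule divide_by_two)
    ultimately show ?thesis using unit by blast
  next
    assume "dlt dvd m"
    then obtain k where k: "m = dlt * k" ..
    then have "tpos k" using m(1) tpos_cancel tpos_dlt by blast
    moreover have "nrm k = 1"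
      using m(2) tpos_nrm_pos[OF \<open>tpos k\<close>] by (simp add: k nrm_mult nrm_dlt)
    moreover have "nr x = dlt * (\<alpha> * k)" using x k by (simp add: mult_ac)
    then obtain y where "nr y = \<alpha> * k" by (rule divide_by_dlt)
    ultimately show ?thesis using unit by blast
  qed
  then show thesis using that by blast
qed

section \<open>Residues modulo a prime element\<close>

lemma prime_above_rational_prime:
  assumes "prime_elem (\<alpha> :: cub)" "n > 0" "\<alpha> dvd of_int (int n)"
  obtains p :: int where "prime p" "\<alpha> dvd of_int p"
proof -
  have "\<exists>p::int. prime p \<and> \<alpha> dvd of_int p" using assms(2,3)
  proof (induction n rule: less_induct)
    case (less n)
    show ?case
    proof (cases "n = 1")
      case True
      then show ?thesis using less.prems assms(1) by (simp add: prime_elem_def)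
    next
      case False
      obtain p where p: "prime p" "p dvd n" using prime_factor_nat[OF False] by blast
      then obtain k where k: "n = p * k" by blast
      have "\<alpha> dvd of_int (int p) * of_int (int k)" using less.prems k by simp
      then have "\<alpha> dvd of_int (int p) \<or> \<alpha> dvd of_int (int k)"
        using assms(1) prime_elem_dvd_multD by blast
      then show ?thesis
      proof
        assume "\<alpha> dvd of_int (int p)"
        then show ?thesis using p by (metis prime_int_nat_transfer nat_int of_nat_0_le_iff)
      next
        assume "\<alpha> dvd of_int (int k)"
        moreover have "k < n" "k > 0" using k less.prems(1) prime_gt_1_nat[OF p(1)] by auto
        ultimately show ?thesis using less.IH by blast
      qed
    qed
  qed
  then show thesis using that by blast
qed

text \<open>A prime divisor of f(t) divides t minus some conjugate of the generator. The generator
  is an integer polynomial in each conjugate, so it is congruent to an integer in every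
  case.\<close>

lemma prime_elem_dvd_linear:
  assumes "prime_elem \<alpha>" "\<alpha> dvd of_int (fpoly t)"
  obtains s where "\<alpha> dvd \<rho> - of_int s"
proof -
  let ?r1 = "\<rho> ^ 2 - 2" and ?r2 = "(\<rho> ^ 2 - 2) ^ 2 - 2"
  have "fpoly (of_int t) = (of_int t - \<rho>) * (of_int t - ?r1) * (of_int t - ?r2)"
    unfolding fpoly_def by (rule root_factor[OF is_root_rho])
  then have "\<alpha> dvd (of_int t - \<rho>) * (of_int t - ?r1) * (of_int t - ?r2)"
    using assms(2) by (simp add: fpoly_of_int)
  then have "\<alpha> dvd of_int t - \<rho> \<or> \<alpha> dvd of_int t - ?r1 \<or> \<alpha> dvd of_int t - ?r2"
    using assms(1) prime_elem_dvd_mult_iff by metis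
  then show thesis
  proof (elim disjE)
    assume "\<alpha> dvd of_int t - \<rho>"
    then have "\<alpha> dvd \<rho> - of_int t" by (metis dvd_minus_iff minus_diff_eq)
    then show thesis by (rule that)
  next
    assume h: "\<alpha> dvd of_int t - ?r1"
    have "\<rho> - of_int (1 - t - t ^ 2) = (of_int t - ?r1) * (1 + of_int t + ?r1)"
    proof -
      have "\<rho> = 1 - ?r1 - ?r1 ^ 2"
        by (simp add: cub_eq_iff cub_sel_mult power2_eq_square)
      then have "\<rho> - of_int (1 - t - t ^ 2) = (1 - ?r1 - ?r1 ^ 2) - (1 - of_int t - of_int t ^ 2)"
        by simp
      also have "\<dots> = (of_int t - ?r1) * (1 + of_int t + ?r1)"
        by (simp add: power2_eq_square algebra_simps)
      finally show ?thesis .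
    qed
    then have "\<alpha> dvd \<rho> - of_int (1 - t - t ^ 2)" using h by (metis dvd_mult2)
    then show thesis by (rule that)
  next
    assume h: "\<alpha> dvd of_int t - ?r2"
    have "\<rho> - of_int (t ^ 2 - 2) = (of_int t - ?r2) * (- of_int t - ?r2)"
    proof -
      have "\<rho> = ?r2 ^ 2 - 2"
        by (simp add: cub_eq_iff cub_sel_mult power2_eq_square)
      then have "\<rho> - of_int (t ^ 2 - 2) = (?r2 ^ 2 - 2) - (of_int t ^ 2 - 2)" by simp
      also have "\<dots> = (of_int t - ?r2) * (- of_int t - ?r2)"
        by (simp add: power2_eq_square algebra_simps)
      finally show ?thesis .
    qed
    then have "\<alpha> dvd \<rho> - of_int (t ^ 2 - 2)" using h by (metis dvd_mult2)
    then show thesis by (rule that)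
  qed
qed

text \<open>
  The second case is that of an inert rational prime, where \<open>\<alpha>\<close> is \<open>p\<close> times a unit.
\<close>
lemma residue_system:
  assumes irr: "irreducible \<alpha>" and pos: "tpos \<alpha>"
  obtains p :: int and res :: "cub \<Rightarrow> int \<times> int \<times> int" and X where
    "prime p" "\<alpha> dvd of_int p" "finite X" "range res \<subseteq> X" "card X \<le> nat (nrm \<alpha>)"
    "\<And>x y. res x = res y \<Longrightarrow> \<alpha> dvd x - y"
proof -
  have prime: "prime_elem \<alpha>" by (rule irreducible_imp_prime[OF irr])
  have n: "nrm \<alpha> > 0" by (rule tpos_nrm_pos[OF pos])
  have "\<alpha> dvd of_int (int (nat (nrm \<alpha>)))" using n nrm_dvd[of \<alpha>] by simp
  then obtain p :: int where p: "prime p" "\<alpha> dvd of_int p"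
    using prime_above_rational_prime[OF prime] n by (metis zero_less_nat_eq)
  have nu: "\<not> \<alpha> dvd 1" using irr by (simp add: irreducible_def)
  obtain k where k: "of_int p = \<alpha> * k" using p(2) ..
  have pk: "p ^ 3 = nrm \<alpha> * nrm k" using arg_cong[OF k, of nrm] by (simp add: nrm_mult nrm_of_int)
  have p0: "p > 0" using p(1) prime_gt_0_int by blast
  have mod: "a mod p \<in> {0..<p}" for a using p0 by simp
  show thesis
  proof (cases "of_int p dvd \<alpha>")
    case False
    obtain t where "p dvd fpoly t" using divisor_of_prime_root[OF p(2) nu p(1) False] .
    then have "\<alpha> dvd of_int (fpoly t)" using p(2) by (metis dvd_trans of_int_dvd_of_int_cub)
    then obtain s where s: "\<alpha> dvd \<rho> - of_int s" using prime_elem_dvd_linear[OF prime] by blast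
    define h where "h = (\<lambda>x. c0 x + c1 x * s + c2 x * s ^ 2)"
    define res where "res = (\<lambda>x. (h x mod p, 0::int, 0::int))"
    have h: "\<alpha> dvd x - of_int (h x)" for x
    proof -
      have "x - of_int (h x) = (of_int (c0 x) + of_int (c1 x) * \<rho> + of_int (c2 x) * \<rho> ^ 2) - of_int (h x)"
        using cub_int_decomp[of x] by simp
      also have "\<dots> = (\<rho> - of_int s) * (of_int (c1 x) + of_int (c2 x) * (\<rho> + of_int s))"
        by (simp add: h_def power2_eq_square algebra_simps)
      finally show ?thesis using s by (metis dvd_mult2)
    qed
    have "nrm \<alpha> dvd p ^ 3" using pk by simp
    then have "\<exists>i\<le>3. nrm \<alpha> = p ^ i"
      using p(1) n divides_primepow[of p "nrm \<alpha>" 3] by auto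
    then obtain i where i: "nrm \<alpha> = p ^ i" by blast
    have "i \<noteq> 0" using nu i unit_iff by (metis abs_one power_0)
    then have "p \<le> nrm \<alpha>" using i p0 by (simp add: self_le_power)
    show thesis
    proof (rule that[OF p, of "{0..<p} \<times> {0} \<times> {0}" res])
      show "range res \<subseteq> {0..<p} \<times> {0} \<times> {0}" using mod by (auto simp: res_def)
      show "card ({0..<p} \<times> {0::int} \<times> {0::int}) \<le> nat (nrm \<alpha>)"
        using \<open>p \<le> nrm \<alpha>\<close> p0 by (simp add: card_cartesian_product)
      fix x y assume "res x = res y"
      then have "p dvd h x - h y" by (simp add: res_def mod_eq_dvd_iff)
      then have "\<alpha> dvd of_int (h x - h y)" using p(2) by (metis dvd_trans of_int_dvd_of_int_cub)
      then have "\<alpha> dvd (x - of_int (h x)) - (y - of_int (h y)) + of_int (h x - h y)"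
        by (rule dvd_add[OF dvd_diff[OF h h]])
      then show "\<alpha> dvd x - y" by simp
    qed simp
  next
    case True
    then obtain l where l: "\<alpha> = of_int p * l" ..
    have "nrm \<alpha> = p ^ 3 * nrm l" using l by (simp add: nrm_mult nrm_of_int)
    then have "nrm l > 0" using n p0 by (simp add: zero_less_mult_iff)
    then have "p ^ 3 \<le> nrm \<alpha>" using \<open>nrm \<alpha> = p ^ 3 * nrm l\<close> p0 by simp
    define res where "res = (\<lambda>x. (c0 x mod p, c1 x mod p, c2 x mod p))"
    show thesis
    proof (rule that[OF p, of "{0..<p} \<times> {0..<p} \<times> {0..<p}" res])
      show "range res \<subseteq> {0..<p} \<times> {0..<p} \<times> {0..<p}" using mod by (auto simp: res_def)
      have "card ({0..<p} \<times> {0..<p} \<times> {0..<p}) = nat p ^ 3"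
        by (simp add: card_cartesian_product power3_eq_cube)
      also have "\<dots> = nat (p ^ 3)" using p0 by (simp add: nat_power_eq)
      finally show "card ({0..<p} \<times> {0..<p} \<times> {0..<p}) \<le> nat (nrm \<alpha>)"
        using \<open>p ^ 3 \<le> nrm \<alpha>\<close> by simp
      fix x y assume "res x = res y"
      then have "of_int p dvd x - y" by (simp add: res_def of_int_dvd_iff mod_eq_dvd_iff)
      then show "\<alpha> dvd x - y" using p(2) dvd_trans by blast
    qed simp
  qed
qed

lemma two_squares_plus_one:
  assumes "prime (p::int)"
  obtains a b where "p dvd a ^ 2 + b ^ 2 + 1"
proof (cases "p = 2")
  case True
  then show thesis using that[of 1 0] by simp
next
  case False
  have p0: "p > 2" using assms False prime_ge_2_int[of p] by simp
  have odd: "odd p" using assms p0 prime_odd_int by blast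
  define h where "h = p div 2"
  have h: "p = 2 * h + 1" using odd by (auto simp: h_def)
  define S where "S = (\<lambda>a. a ^ 2 mod p) ` {0..h}"
  define T where "T = (\<lambda>b. (- 1 - b ^ 2) mod p) ` {0..h}"
  have inj: "x = y" if "p dvd x ^ 2 - y ^ 2" "x \<in> {0..h}" "y \<in> {0..h}" for x y
  proof -
    have "p dvd (x - y) * (x + y)" using that(1) by (simp add: power2_eq_square algebra_simps)
    then have "p dvd x - y \<or> p dvd x + y" using assms prime_dvd_mult_iff by blast
    then show ?thesis
    proof
      assume "p dvd x - y"
      then show ?thesis using that(2,3) h zdvd_not_zless[of "x - y" p] zdvd_not_zless[of "y - x" p]
        by (cases "x < y"; cases "y < x") (auto simp: dvd_diff_commute)
    next
      assume "p dvd x + y"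
      then show ?thesis using that(2,3) h zdvd_not_zless[of "x + y" p] by (cases "x + y = 0") auto
    qed
  qed
  have "inj_on (\<lambda>a. a ^ 2 mod p) {0..h}" by (auto intro!: inj_onI inj simp: mod_eq_dvd_iff)
  then have S: "card S = nat (h + 1)" unfolding S_def by (simp add: card_image)
  have "inj_on (\<lambda>b. (- 1 - b ^ 2) mod p) {0..h}"
  proof (rule inj_onI)
    fix x y assume xy: "x \<in> {0..h}" "y \<in> {0..h}" "(- 1 - x ^ 2) mod p = (- 1 - y ^ 2) mod p"
    then have "p dvd y ^ 2 - x ^ 2" by (simp add: mod_eq_dvd_iff)
    then show "x = y" using inj xy by metis
  qed
  then have T: "card T = nat (h + 1)" unfolding T_def by (simp add: card_image)
  have sub: "S \<union> T \<subseteq> {0..<p}" using p0 by (auto simp: S_def T_def)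
  have fin: "finite S" "finite T" by (simp_all add: S_def T_def)
  have "S \<inter> T \<noteq> {}"
  proof
    assume "S \<inter> T = {}"
    then have "card (S \<union> T) = nat (h + 1) + nat (h + 1)" using fin S T by (simp add: card_Un_disjoint)
    moreover have "card (S \<union> T) \<le> nat p" using card_mono[OF _ sub] by simp
    ultimately show False using h p0 by simp
  qed
  then obtain a b where "a ^ 2 mod p = (- 1 - b ^ 2) mod p" by (auto simp: S_def T_def)
  then have "p dvd a ^ 2 - (- 1 - b ^ 2)" by (simp only: mod_eq_dvd_iff)
  then show thesis by (intro that[of a b]) (simp add: algebra_simps)
qed

definition par :: "cub \<Rightarrow> int \<times> int \<times> int" where
  "par x = (c0 x mod 2, c1 x mod 2, c2 x mod 2)"

lemma par_range: "range par \<subseteq> {0..<2} \<times> {0..<2} \<times> {0..<2}"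
  by (auto simp: par_def)

lemma par_eq: "par x = par y \<Longrightarrow> 2 dvd x - y"
  using of_int_dvd_iff[of 2 "x - y"] by (simp add: par_def mod_eq_dvd_iff)

lemma irreducible_represented:
  assumes irr: "irreducible \<alpha>" and pos: "tpos \<alpha>" and odd: "\<not> 2 dvd \<alpha>"
  shows "\<exists>x. nr x = \<alpha>"
proof -
  have prime: "prime_elem \<alpha>" by (rule irreducible_imp_prime[OF irr])
  have n: "nrm \<alpha> > 0" by (rule tpos_nrm_pos[OF pos])
  have nu: "\<not> \<alpha> dvd 1" using irr by (simp add: irreducible_def)
  \<comment> \<open>This allows the factor 4 in \<open>4 * nr h = S\<close> to be cancelled modulo
    the prime.\<close>
  have n2: "\<not> \<alpha> dvd 2"
  proof
    assume "\<alpha> dvd 2"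
    then obtain k where "2 = \<alpha> * k" ..
    then have "nrm \<alpha> * nrm k = 2 ^ 3" using nrm_mult[of \<alpha> k] nrm_numeral[of "num.Bit0 num.One"] by simp
    then have "nrm \<alpha> dvd 2 ^ 3" by (metis dvd_triv_left)
    then obtain i where "nrm \<alpha> = 2 ^ i" using n divides_primepow[of "2::int" "nrm \<alpha>" 3] by auto
    moreover from this have "i \<noteq> 0" using nu unit_iff by (metis abs_one power_0)
    ultimately have "2 dvd nrm \<alpha>" by simp
    then show False using odd two_dvd_iff_nrm by blast
  qed
  obtain p :: int and res :: "cub \<Rightarrow> int \<times> int \<times> int" and X where p: "prime p" "\<alpha> dvd of_int p" and X: "finite X" "range res \<subseteq> X" "card X \<le> nat (nrm \<alpha>)"
    and res: "\<And>x y. res x = res y \<Longrightarrow> \<alpha> dvd x - y"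
    by (rule residue_system[OF irr pos], rule that; assumption)
  obtain a b where ab: "p dvd a ^ 2 + b ^ 2 + 1" using two_squares_plus_one[OF p(1)] .
  define A B :: cub where "A = of_int a" and "B = of_int b"
  have "\<alpha> dvd of_int (a ^ 2 + b ^ 2 + 1)" using ab p(2) by (metis dvd_trans of_int_dvd_of_int_cub)
  then have AB: "\<alpha> dvd A ^ 2 + B ^ 2 + 1" by (simp add: A_def B_def)
  define q where "q = nat (nrm \<alpha>)"
  \<comment> \<open>The first two entries impose w2 = A w0 + B w1 and w3 = B w0 - A w1 modulo the
    prime, so the sum of the four squares is a multiple of A^2 + B^2 + 1, hence 0. The parities make
    the coordinates congruent modulo 2, so that half the quadruple is a Hurwitz quaternion.\<close>
  define lab where "lab = (\<lambda>x. (res (x B2 - A * x B0 - B * x B1), res (x B3 - B * x B0 + A * x B1),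
    par (x B1 - x B0), par (x B2 - x B0), par (x B3 - x B0)))"
  define Q where "Q = ({0..<2} \<times> {0..<2} \<times> {0..<2} :: (int \<times> int \<times> int) set)"
  define Y where "Y = X \<times> X \<times> Q \<times> Q \<times> Q"
  have Q: "par x \<in> Q" for x using par_range unfolding Q_def by blast
  have R: "res x \<in> X" for x using X(2) by blast
  have Y: "range lab \<subseteq> Y" "finite Y"
    using X(1) unfolding lab_def Y_def by (simp_all add: image_subset_iff Q R) (simp add: Q_def)
  have "card Y = card X * card X * 512"
    by (simp add: Y_def Q_def card_cartesian_product)
  also have "\<dots> \<le> q * q * 512" using X(3) unfolding q_def by (intro mult_le_mono) auto
  finally have card: "card Y \<le> 512 * q ^ 2" by (simp add: power2_eq_square)
  have q0: "q > 0" using n by (simp add: q_def)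
  obtain x y where xy: "x \<noteq> y" "lab x = lab y"
    "(\<Sum>i\<in>UNIV. real_of_int (trc ((x i - y i) ^ 2))) < 12 * root 3 (13 * real q)"
    by (rule short_quadruple[OF Y card q0])
  define w where "w = (\<lambda>i. x i - y i)"
  have w2: "2 dvd w B1 - w B0" "2 dvd w B2 - w B0" "2 dvd w B3 - w B0"
  proof -
    have "2 dvd (x B1 - x B0) - (y B1 - y B0)" "2 dvd (x B2 - x B0) - (y B2 - y B0)"
      "2 dvd (x B3 - x B0) - (y B3 - y B0)"
      using xy(2) unfolding lab_def prod.inject by (blast intro: par_eq)+
    then show "2 dvd w B1 - w B0" "2 dvd w B2 - w B0" "2 dvd w B3 - w B0"
      unfolding w_def by (simp_all add: algebra_simps)
  qed
  have w\<alpha>: "\<alpha> dvd w B2 - A * w B0 - B * w B1" "\<alpha> dvd w B3 - B * w B0 + A * w B1"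
  proof -
    have "\<alpha> dvd (x B2 - A * x B0 - B * x B1) - (y B2 - A * y B0 - B * y B1)"
      "\<alpha> dvd (x B3 - B * x B0 + A * x B1) - (y B3 - B * y B0 + A * y B1)"
      using xy(2) unfolding lab_def prod.inject by (blast intro: res)+
    then show "\<alpha> dvd w B2 - A * w B0 - B * w B1" "\<alpha> dvd w B3 - B * w B0 + A * w B1"
      unfolding w_def by (simp_all add: algebra_simps)
  qed
  define S where "S = w B0 ^ 2 + w B1 ^ 2 + w B2 ^ 2 + w B3 ^ 2"
  have "\<alpha> dvd S"
  proof -
    obtain k l where k: "w B2 - A * w B0 - B * w B1 = \<alpha> * k" and l: "w B3 - B * w B0 + A * w B1 = \<alpha> * l"
      using w\<alpha> by (auto elim!: dvdE)
    have w23: "w B2 = A * w B0 + B * w B1 + \<alpha> * k" "w B3 = B * w B0 - A * w B1 + \<alpha> * l"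
      using k l by (simp_all add: algebra_simps)
    have "S = (w B0 ^ 2 + w B1 ^ 2) * (A ^ 2 + B ^ 2 + 1) +
        \<alpha> * (2 * (A * w B0 + B * w B1) * k + \<alpha> * k ^ 2 + 2 * (B * w B0 - A * w B1) * l + \<alpha> * l ^ 2)"
      unfolding S_def w23 by (simp add: power2_eq_square algebra_simps)
    then show ?thesis using AB by (metis dvd_add dvd_mult dvd_triv_left)
  qed
  obtain d1 d2 d3 where d: "w B1 - w B0 = 2 * d1" "w B2 - w B0 = 2 * d2" "w B3 - w B0 = 2 * d3"
    using w2 by (auto elim!: dvdE)
  have ws: "w B1 = w B0 + 2 * d1" "w B2 = w B0 + 2 * d2" "w B3 = w B0 + 2 * d3"
    using d by (simp_all add: algebra_simps)
  \<comment> \<open>The quadruple halved, in the basis 1, i, j, omega.\<close>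
  define h where "h = Hur (- d3) (d1 - d3) (d2 - d3) (w B0 + 2 * d3)"
  have h4: "4 * nr h = S"
    unfolding S_def ws h_def nr_def by (simp add: power2_eq_square algebra_simps)
  have "\<alpha> dvd 2 * (2 * nr h)" using \<open>\<alpha> dvd S\<close> h4 by simp
  then have "\<alpha> dvd nr h" using prime n2 prime_elem_dvd_mult_iff by metis
  then obtain m where m: "nr h = \<alpha> * m" ..
  have "h \<noteq> 0"
  proof
    assume "h = 0"
    then have "w B0 = 0" "w B1 = 0" "w B2 = 0" "w B3 = 0" by (auto simp: h_def hur_eq_iff ws)
    then have "w i = 0" for i by (cases i) auto
    then have "x = y" by (intro ext) (simp add: w_def)
    then show False using xy(1) by simp
  qed
  then have posh: "tpos (nr h)" by (rule nr_tpos)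
  then have posm: "tpos m" using m pos tpos_cancel by metis
  have "nrm m < 13"
  proof -
    have S_pos: "tpos S" unfolding h4[symmetric] using posh by (intro tpos_mult) (simp_all add: tpos_def)
    have trS: "real_of_int (trc S) < 12 * root 3 (13 * real q)"
      using xy(3) by (simp add: UNIV_blk S_def w_def trc_add)
    have "real_of_int (trc S) ^ 3 < (12 * root 3 (13 * real q)) ^ 3"
      using trS tpos_trc_ge_3[OF S_pos] by (intro power_strict_mono) auto
    also have "\<dots> = 1728 * (13 * real q)"
      using q0 by (simp add: power_mult_distrib real_root_pow_pos2)
    also have "\<dots> = real_of_int (1728 * 13 * nrm \<alpha>)"
      using n by (simp add: q_def)
    finally have "trc S ^ 3 < 1728 * 13 * nrm \<alpha>"
      by (simp only: of_int_power[symmetric] of_int_less_iff)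
    moreover have "27 * nrm S \<le> trc S ^ 3" by (rule tpos_nrm_le_trc[OF S_pos])
    moreover have "nrm S = 64 * (nrm \<alpha> * nrm m)"
      unfolding h4[symmetric] m by (simp add: nrm_mult nrm_numeral)
    \<comment> \<open>Here 27 * 64 = 1728 = 12^3 cancels, which explains the factor 12 in
      \<open>short_quadruple\<close>.\<close>
    ultimately have "nrm \<alpha> * nrm m < nrm \<alpha> * 13" by linarith
    then show ?thesis using n by simp
  qed
  then show ?thesis using nr_reduce_small[OF m pos posm] by blast
qed

text \<open>Induction on the norm: \<open>nr\<close> is multiplicative, and a unit of suitable
  signature makes both factors of a reducible element totally positive.\<close>

theorem hurwitz_universal:
  assumes "tpos \<alpha>" shows "\<exists>x. nr x = \<alpha>"
  using assms
proof (induction "nat (nrm \<alpha>)" arbitrary: \<alpha> rule: less_induct)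
  case less
  have n: "nrm \<alpha> > 0" by (rule tpos_nrm_pos[OF less.prems])
  consider "nrm \<alpha> = 1" | "2 dvd \<alpha>" | "irreducible \<alpha>" "\<not> 2 dvd \<alpha>" | "nrm \<alpha> \<noteq> 1" "\<not> irreducible \<alpha>"
    by argo
  then show ?case
  proof cases
    case 1
    then obtain v where "\<alpha> = v ^ 2" using tpos_unit_square less.prems by blast
    then show ?thesis by (intro exI[of _ "sc v"]) simp
  next
    case 2
    then obtain \<beta> where b: "\<alpha> = 2 * \<beta>" ..
    have "tpos (2 :: cub)" by (simp add: tpos_def)
    then have pb: "tpos \<beta>" using less.prems b tpos_cancel by blast
    moreover have "nat (nrm \<beta>) < nat (nrm \<alpha>)"
      using tpos_nrm_pos[OF pb] by (simp add: b nrm_mult nrm_numeral)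
    ultimately obtain x where "nr x = \<beta>" using less.hyps by blast
    then have "nr (Hur 1 1 0 0 * x) = \<alpha>" by (simp add: nr_mult b) (simp add: nr_def)
    then show ?thesis by blast
  next
    case 3
    then show ?thesis using irreducible_represented less.prems by blast
  next
    case 4
    have "\<alpha> \<noteq> 0" "\<not> \<alpha> dvd 1" using n 4(1) by (auto simp: unit_iff)
    then obtain \<beta> \<gamma> where bc: "\<alpha> = \<beta> * \<gamma>" "\<not> \<beta> dvd 1" "\<not> \<gamma> dvd 1"
      using 4(2) unfolding irreducible_def by blast
    have "\<beta> \<noteq> 0" using bc(1) \<open>\<alpha> \<noteq> 0\<close> by auto
    then obtain u where u: "u dvd 1" "tpos (u * \<beta>)" by (rule tpos_unit_multiple)
    obtain v where v: "1 = u * v" using u(1) ..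
    have eq: "\<alpha> = (u * \<beta>) * (v * \<gamma>)"
    proof -
      have "(u * \<beta>) * (v * \<gamma>) = (u * v) * (\<beta> * \<gamma>)" by (simp add: mult_ac)
      then show ?thesis using bc(1) v by simp
    qed
    then have pv: "tpos (v * \<gamma>)" using less.prems u(2) tpos_cancel by metis
    have "v dvd 1" using v by (metis dvd_triv_right)
    then have nu: "\<bar>nrm u\<bar> = 1" "\<bar>nrm v\<bar> = 1" using u(1) by (simp_all add: unit_iff)
    have "\<bar>nrm (u * \<beta>)\<bar> \<noteq> 1" "\<bar>nrm (v * \<gamma>)\<bar> \<noteq> 1"
      using bc(2,3) unfolding unit_iff nrm_mult abs_mult nu by simp_all
    then have gt: "nrm (u * \<beta>) > 1" "nrm (v * \<gamma>) > 1"
      using tpos_nrm_pos[OF u(2)] tpos_nrm_pos[OF pv] by linarith+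
    have "nrm \<alpha> = nrm (u * \<beta>) * nrm (v * \<gamma>)" by (subst eq) (rule nrm_mult)
    then have "nrm (u * \<beta>) < nrm \<alpha>" "nrm (v * \<gamma>) < nrm \<alpha>" using gt by simp_all
    then have "nat (nrm (u * \<beta>)) < nat (nrm \<alpha>)" "nat (nrm (v * \<gamma>)) < nat (nrm \<alpha>)"
      using n by simp_all
    then obtain x y where "nr x = u * \<beta>" "nr y = v * \<gamma>"
      using less.hyps[OF _ u(2)] less.hyps[OF _ pv] by blast
    then have "nr (x * y) = \<alpha>" by (simp only: nr_mult eq[symmetric])
    then show ?thesis by blast
  qed
qed

section \<open>Residue classes modulo the prime above 2\<close>

text \<open>
  Modulo the two-sided prime ideal above \<open>2\<close> the quaternion \<open>x\<close> becomes \<open>tw x + h3 x * \<omega>\<close> in the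
  field with \<open>64\<close> elements, and \<open>trivial x\<close> says that this class lies in the subgroup generated by
  the field with \<open>8\<close> elements and \<open>\<omega>\<close>, which has index \<open>3\<close>.
\<close>
definition tw :: "cub hur \<Rightarrow> cub" where
  "tw x = h0 x + h1 x + h2 x"

text \<open>The lines through 1, omega and 1 + omega = omega^2 over the field with 8 elements,
  including 0.\<close>

definition triv :: "cub \<Rightarrow> cub \<Rightarrow> bool" where
  "triv s d \<longleftrightarrow> 2 dvd d \<or> 2 dvd s \<or> 2 dvd s + d"

definition trivial :: "cub hur \<Rightarrow> bool" where
  "trivial x \<longleftrightarrow> triv (tw x) (h3 x)"

text \<open>Congruence modulo the prime above 2, where i and j are congruent to 1.\<close>

definition eqP :: "cub hur \<Rightarrow> cub hur \<Rightarrow> bool" where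
  "eqP x y \<longleftrightarrow> 2 dvd tw x - tw y \<and> 2 dvd h3 x - h3 y"

lemma two_dvd_cub: "2 dvd x \<longleftrightarrow> even (c0 x) \<and> even (c1 x) \<and> even (c2 x)"
  using of_int_dvd_iff[of 2 x] by simp

lemma eqP_parity:
  "eqP x y \<longleftrightarrow> (even (c0 (tw x)) = even (c0 (tw y)) \<and> even (c1 (tw x)) = even (c1 (tw y)) \<and>
    even (c2 (tw x)) = even (c2 (tw y))) \<and> (even (c0 (h3 x)) = even (c0 (h3 y)) \<and>
    even (c1 (h3 x)) = even (c1 (h3 y)) \<and> even (c2 (h3 x)) = even (c2 (h3 y)))"
  by (simp add: eqP_def two_dvd_cub)

lemma eqP_trans: "eqP x y \<Longrightarrow> eqP y z \<Longrightarrow> eqP x z"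
  by (simp add: eqP_parity)

lemma triv_parity:
  "triv s d \<longleftrightarrow> (even (c0 d) \<and> even (c1 d) \<and> even (c2 d)) \<or> (even (c0 s) \<and> even (c1 s) \<and> even (c2 s)) \<or>
    (even (c0 s) = even (c0 d) \<and> even (c1 s) = even (c1 d) \<and> even (c2 s) = even (c2 d))"
  by (simp add: triv_def two_dvd_cub)

lemma trivial_cong: "eqP x y \<Longrightarrow> trivial x \<longleftrightarrow> trivial y"
  by (simp add: eqP_parity trivial_def triv_parity)

text \<open>Here and in \<open>h3_mult\<close>, up to even terms, this is the multiplication of s +
  d omega with omega^2 = omega - 1.\<close>

lemma tw_mult: "tw (x * y) = tw x * tw y - h3 x * h3 y +
    2 * (h2 x * h1 y - h1 x * h1 y - 2 * h1 x * h2 y - h1 x * h3 y - h2 x * h2 y + h2 x * h3 y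
      + h3 x * h1 y - h3 x * h2 y)"
  by (simp add: tw_def times_hur_def algebra_simps)

lemma h3_mult: "h3 (x * y) = tw x * h3 y + h3 x * tw y + h3 x * h3 y +
    2 * (h1 x * h2 y - h2 x * h1 y - h2 x * h3 y - h3 x * h1 y)"
  by (simp add: tw_def times_hur_def algebra_simps)

lemma eqP_iff: "eqP x y \<longleftrightarrow> (\<exists>a b. tw x = tw y + 2 * a \<and> h3 x = h3 y + 2 * b)"
  unfolding eqP_def dvd_def by (metis add_diff_cancel_left' add.commute diff_add_cancel)

lemma eqP_mult_normal:
  "eqP z (x * y)" if "tw z = tw x * tw y - h3 x * h3 y + 2 * a"
    "h3 z = tw x * h3 y + h3 x * tw y + h3 x * h3 y + 2 * b"
proof -
  have "tw z - tw (x * y) = 2 * (a - (h2 x * h1 y - h1 x * h1 y - 2 * h1 x * h2 y - h1 x * h3 y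
      - h2 x * h2 y + h2 x * h3 y + h3 x * h1 y - h3 x * h2 y))"
    unfolding that(1) tw_mult by (simp add: algebra_simps)
  moreover have "h3 z - h3 (x * y) = 2 * (b - (h1 x * h2 y - h2 x * h1 y - h2 x * h3 y - h3 x * h1 y))"
    unfolding that(2) h3_mult by (simp add: algebra_simps)
  ultimately show ?thesis unfolding eqP_def by (metis dvd_triv_left)
qed

text \<open>The residue ring is a field, so factors may be reordered whenever only the class
  matters.\<close>

lemma eqP_commute: "eqP (x * y) (y * x)"
proof (rule eqP_mult_normal)
  show "tw (x * y) = tw y * tw x - h3 y * h3 x +
    2 * (h2 x * h1 y - h1 x * h1 y - 2 * h1 x * h2 y - h1 x * h3 y - h2 x * h2 y + h2 x * h3 y
      + h3 x * h1 y - h3 x * h2 y)"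
    by (simp only: tw_mult mult.commute)
  show "h3 (x * y) = tw y * h3 x + h3 y * tw x + h3 y * h3 x +
    2 * (h1 x * h2 y - h2 x * h1 y - h2 x * h3 y - h3 x * h1 y)"
    by (simp only: h3_mult mult.commute add.commute)
qed

lemma eqP_mult_left: "eqP y y' \<Longrightarrow> eqP (x * y) (x * y')"
proof -
  assume "eqP y y'"
  then obtain a b where y: "tw y = tw y' + 2 * a" "h3 y = h3 y' + 2 * b" unfolding eqP_iff by blast
  show ?thesis
    by (rule eqP_mult_normal[of _ _ _ "tw x * a - h3 x * b + (h2 x * h1 y - h1 x * h1 y - 2 * h1 x * h2 y
        - h1 x * h3 y - h2 x * h2 y + h2 x * h3 y + h3 x * h1 y - h3 x * h2 y)"
        "tw x * b + h3 x * a + h3 x * b + (h1 x * h2 y - h2 x * h1 y - h2 x * h3 y - h3 x * h1 y)"])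
      (simp_all only: tw_mult h3_mult y(1), simp_all add: y(2) algebra_simps)
qed

lemma eqP_mult_right: "eqP x x' \<Longrightarrow> eqP (x * y) (x' * y)"
  by (meson eqP_commute eqP_mult_left eqP_trans)

lemma triv_add_even: "triv (s + 2 * a) (d + 2 * b) \<longleftrightarrow> triv s d"
  by (simp add: triv_parity cub_sel_mult)

lemma trivial_mult_iff:
  "trivial (x * y) \<longleftrightarrow> triv (tw x * tw y - h3 x * h3 y) (tw x * h3 y + h3 x * tw y + h3 x * h3 y)"
  unfolding trivial_def tw_mult h3_mult by (rule triv_add_even)

text \<open>With \<open>a\<close>, \<open>b\<close> not both even, a + b omega reduces to a power of
  omega, which permutes the three lines in \<open>triv\<close>.\<close>

lemma triv_scale:
  assumes "\<not> (even a \<and> even b)"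
  shows "triv (of_int a * s - of_int b * d) (of_int a * d + of_int b * s + of_int b * d) \<longleftrightarrow> triv s d"
  using assms unfolding triv_parity cub_sel cub_sel_mult cub_sel_of_int
  by (cases "even (c0 s)"; cases "even (c1 s)"; cases "even (c2 s)";
      cases "even (c0 d)"; cases "even (c1 d)"; cases "even (c2 d)"; simp; blast)

lemma trivial_unit_mult:
  assumes "\<not> (even (h0 u + h1 u + h2 u) \<and> even (h3 u))"
  shows "trivial (lift u * x) \<longleftrightarrow> trivial x"
proof -
  have "tw (lift u) = of_int (h0 u + h1 u + h2 u)" "h3 (lift u) = of_int (h3 u)"
    by (simp_all add: tw_def lift_def)
  then show ?thesis using triv_scale[OF assms] unfolding trivial_mult_iff unfolding trivial_def by (simp only:)
qed

lemma trivial_sc_mult: "\<not> 2 dvd c \<Longrightarrow> trivial (sc c * x) \<longleftrightarrow> trivial x"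
proof -
  assume c: "\<not> 2 dvd c"
  have *: "2 dvd c * y \<longleftrightarrow> 2 dvd y" for y
    using c unfolding two_dvd_iff_nrm nrm_mult by (simp add: prime_dvd_mult_iff)
  have "tw (sc c * x) = c * tw x" by (simp add: tw_def algebra_simps)
  then show ?thesis unfolding trivial_def triv_def
    by (simp add: * distrib_left[symmetric])
qed

lemma trivial_cnj: "trivial (cnj x) \<longleftrightarrow> trivial x"
proof -
  have "tw (cnj x) = tw x + h3 x - 2 * (h1 x + h2 x)" "h3 (cnj x) = - h3 x"
    by (simp_all add: tw_def cnj_def algebra_simps)
  then show ?thesis
    unfolding trivial_def triv_parity cub_sel by (simp add: cub_sel_mult[of 2]) blast
qed

text \<open>The element 1 + rho omega has norm 1 + rho + rho^2. Since \<open>z0 * zb\<close> is the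
  scalar \<open>dlt\<close>, the classes of \<open>z0\<close> and \<open>zb\<close> are inverse to
  each other; they are the two nontrivial ones.\<close>

definition z0 :: "cub hur" where "z0 = Hur 1 0 0 \<rho>"
definition zb :: "cub hur" where "zb = cnj z0"

lemma nr_z0: "nr z0 = dlt" and nr_zb: "nr zb = dlt"
  by (simp_all add: zb_def) (simp_all add: z0_def nr_def dlt_def cub_eq_iff cub_sel_mult power2_eq_square)

lemma zz_coords:
  "tw z0 = 1" "h3 z0 = \<rho>" "tw zb = 1 + \<rho>" "h3 zb = - \<rho>"
  "tw (zb * zb) = Cub 1 2 0" "h3 (zb * zb) = Cub 0 (-2) (-1)"
  "tw (z0 * z0) = Cub 1 0 (-1)" "h3 (z0 * z0) = Cub 0 2 1"
  by (simp_all add: z0_def zb_def cnj_def tw_def times_hur_def cub_eq_iff cub_sel_mult)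

lemma odd_nr:
  assumes "\<not> 2 dvd nr x" shows "\<not> (2 dvd tw x \<and> 2 dvd h3 x)"
proof
  assume h: "2 dvd tw x \<and> 2 dvd h3 x"
  have "nr x = tw x * tw x + tw x * h3 x + h3 x * h3 x - 2 * (h0 x * h1 x + h1 x * h2 x + h0 x * h2 x)"
    by (simp add: nr_def tw_def power2_eq_square algebra_simps)
  moreover have "2 dvd \<dots>"
    using h by (intro dvd_diff dvd_add) (auto intro: dvd_mult dvd_mult2)
  ultimately show False using assms by simp
qed

text \<open>This and the next three lemmas are facts about a group of order 3, verified on the
  parities of six integers. Odd norm ensures that \<open>x\<close> is nonzero in the residue
  field.\<close>

lemma class_shift_trivial:
  assumes "\<not> 2 dvd nr x" "trivial x" shows "\<not> trivial (zb * zb * x)"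
  using odd_nr[OF assms(1)] assms(2)
  unfolding trivial_mult_iff unfolding zz_coords trivial_def triv_parity two_dvd_cub cub_sel cub_sel_mult cub.sel
  by (cases "even (c0 (tw x))"; cases "even (c1 (tw x))"; cases "even (c2 (tw x))";
      cases "even (c0 (h3 x))"; cases "even (c1 (h3 x))"; cases "even (c2 (h3 x))"; simp)

lemma class_shift_nontrivial:
  assumes "\<not> trivial x" shows "trivial (zb * zb * x) \<or> trivial (z0 * z0 * x)"
  using assms
  unfolding trivial_mult_iff unfolding zz_coords trivial_def triv_parity two_dvd_cub cub_sel cub_sel_mult cub.sel
  by (cases "even (c0 (tw x))"; cases "even (c1 (tw x))"; cases "even (c2 (tw x))";
      cases "even (c0 (h3 x))"; cases "even (c1 (h3 x))"; cases "even (c2 (h3 x))"; simp)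

lemma class_dlt_nontrivial:
  assumes "\<not> trivial x" shows "trivial (z0 * x) \<or> trivial (zb * x)"
  using assms
  unfolding trivial_mult_iff unfolding zz_coords trivial_def triv_parity two_dvd_cub cub_sel cub_sel_mult cub.sel
  by (cases "even (c0 (tw x))"; cases "even (c1 (tw x))"; cases "even (c2 (tw x))";
      cases "even (c0 (h3 x))"; cases "even (c1 (h3 x))"; cases "even (c2 (h3 x))"; simp)

lemma class_square_nontrivial:
  assumes "\<not> trivial x" shows "\<not> trivial (x * x)"
  using assms
  unfolding trivial_mult_iff unfolding trivial_def triv_parity two_dvd_cub cub_sel cub_sel_mult cub.sel
  by (cases "even (c0 (tw x))"; cases "even (c1 (tw x))"; cases "even (c2 (tw x))";
      cases "even (c0 (h3 x))"; cases "even (c1 (h3 x))"; cases "even (c2 (h3 x))"; simp)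

text \<open>A power of omega moves a trivial class into the field with 8 elements without changing
  the norm. Then \<open>h3\<close> is even, and the coordinates with respect to 1, i, j, k lie in
  the cubic ring.\<close>

lemma trivial_four_squares:
  assumes "trivial x"
  shows "\<exists>a b c d. nr x = a ^ 2 + b ^ 2 + c ^ 2 + d ^ 2"
proof -
  have even: "\<exists>a b c d. nr y = a ^ 2 + b ^ 2 + c ^ 2 + d ^ 2" if h: "2 dvd h3 y" for y :: "cub hur"
  proof -
    obtain d where d: "h3 y = 2 * d" using h ..
    have "nr y = (h0 y + d) ^ 2 + (h1 y + d) ^ 2 + (h2 y + d) ^ 2 + d ^ 2"
      by (simp add: nr_def d power2_eq_square algebra_simps)
    then show ?thesis by blast
  qed
  let ?w = "Hur 0 0 0 1 :: cub hur"
  have w: "nr ?w = 1" "tw ?w = 0" "h3 ?w = 1" "nr (cnj ?w) = 1" "tw (cnj ?w) = 1" "h3 (cnj ?w) = - 1"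
    by (simp_all add: nr_def tw_def cnj_def)
  consider "2 dvd h3 x" | "2 dvd tw x" | "2 dvd tw x + h3 x"
    using assms by (auto simp: trivial_def triv_def)
  then show ?thesis
  proof cases
    case 1
    then show ?thesis by (rule even)
  next
    case 2
    have "h3 (cnj ?w * x) = - tw x + 2 * (h1 (cnj ?w) * h2 x - h2 (cnj ?w) * h1 x - h2 (cnj ?w) * h3 x - h3 (cnj ?w) * h1 x)"
      unfolding h3_mult w by simp
    then have "2 dvd h3 (cnj ?w * x)" using 2 by simp
    then show ?thesis using even[of "cnj ?w * x"] by (simp add: nr_mult w)
  next
    case 3
    have "h3 (?w * x) = (tw x + h3 x) + 2 * (h1 ?w * h2 x - h2 ?w * h1 x - h2 ?w * h3 x - h3 ?w * h1 x)"
      unfolding h3_mult w by simp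
    then have "2 dvd h3 (?w * x)" using 3 by simp
    then show ?thesis using even[of "?w * x"] by (simp add: nr_mult w)
  qed
qed

section \<open>Moving between classes without changing the norm\<close>

definition ulist :: "int hur list" where
  "ulist = [Hur 1 0 0 0, Hur 1 1 1 (-1), Hur 1 1 1 (-2), Hur 0 1 1 (-1)]"

text \<open>The Hurwitz units up to sign.\<close>
definition units12 :: "(int \<times> int \<times> int \<times> int) list" where
  "units12 = [(1, 1, 1, -2), (1, 1, 1, -1), (1, 0, 1, -1), (0, 1, 1, -1), (1, 1, 0, -1), (0, -1, 0, 1),
     (0, 0, 1, 0), (0, 0, 1, -1), (1, 0, 0, 0), (1, 0, 0, -1), (0, 0, 0, 1), (0, 1, 0, 0)]"

text \<open>
  Modulo the prime above \<open>7\<close> the element \<open>zb\<close> has rank one as a \<open>2 \<times> 2\<close> matrix, so that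
  \<open>zb * e * p * f * zb\<close> is a linear form in \<open>p\<close> times a fixed quaternion. An entry consists of
  \<open>e\<close>, \<open>f\<close> and the coefficients of this form, normalised to take the value \<open>1\<close> at \<open>1\<close>.
\<close>
definition switch_table :: "(int hur \<times> int hur \<times> int \<times> int \<times> int) list" where
  "switch_table = [(Hur 1 0 0 0, Hur 1 0 0 0, 4, 4, 3),
     (Hur 1 0 0 0, Hur 1 1 1 (-1), 5, 6, 3),
     (Hur 1 0 0 0, Hur 1 1 1 (-2), 6, 1, 3),
     (Hur 1 0 0 0, Hur 0 1 1 (-1), 1, 5, 3),
     (Hur 1 1 1 (-1), Hur 1 0 0 0, 6, 5, 3),
     (Hur 1 1 1 (-1), Hur 1 1 1 (-1), 1, 1, 6),
     (Hur 1 1 1 (-1), Hur 1 1 1 (-2), 2, 6, 4),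
     (Hur 1 1 1 (-1), Hur 0 1 1 (-1), 3, 4, 2),
     (Hur 1 1 1 (-2), Hur 1 0 0 0, 1, 6, 3),
     (Hur 1 1 1 (-2), Hur 1 1 1 (-1), 6, 2, 4),
     (Hur 1 1 1 (-2), Hur 1 1 1 (-2), 3, 3, 2),
     (Hur 1 1 1 (-2), Hur 0 1 1 (-1), 2, 1, 6),
     (Hur 0 1 1 (-1), Hur 1 0 0 0, 5, 1, 3),
     (Hur 0 1 1 (-1), Hur 1 1 1 (-1), 4, 3, 2),
     (Hur 0 1 1 (-1), Hur 1 1 1 (-2), 1, 2, 6),
     (Hur 0 1 1 (-1), Hur 0 1 1 (-1), 6, 6, 4)]"

text \<open>The reduction of \<open>zb\<close>, with 2 in place of the generator.\<close>

definition zb7 :: "int hur" where "zb7 = Hur 3 0 0 (-2)"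

definition zero7 :: "int hur \<Rightarrow> bool" where
  "zero7 p \<longleftrightarrow> h0 p mod 7 = 0 \<and> h1 p mod 7 = 0 \<and> h2 p mod 7 = 0 \<and> h3 p mod 7 = 0"

lemma zero7_iff: "zero7 p \<longleftrightarrow> sdvd 7 p"
  by (simp add: zero7_def sdvd_iff mod_eq_0_iff_dvd)

lemma switch_table_rank_one:
  "list_all (\<lambda>(e, f, f1, f2, f3).
     zero7 (zb7 * e * Hur 0 1 0 0 * f * zb7 - sc f1 * (zb7 * e * f * zb7)) \<and>
     zero7 (zb7 * e * Hur 0 0 1 0 * f * zb7 - sc f2 * (zb7 * e * f * zb7)) \<and>
     zero7 (zb7 * e * Hur 0 0 0 1 * f * zb7 - sc f3 * (zb7 * e * f * zb7))) switch_table"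
  by code_simp

lemma switch_mod_7:
  "list_all (\<lambda>a. list_all (\<lambda>b. list_all (\<lambda>c. list_all (\<lambda>d.
     nr7 a b c d = 0 \<or> list_ex (\<lambda>(e, f, f1, f2, f3). (a + f1 * b + f2 * c + f3 * d) mod 7 = 0) switch_table \<or>
     list_ex (\<lambda>(u0, u1, u2, u3). list_ex (\<lambda>k. (a - k * u0) mod 7 = 0 \<and> (b - k * u1) mod 7 = 0 \<and>
       (c - k * u2) mod 7 = 0 \<and> (d - k * u3) mod 7 = 0) rng7) units12) rng7) rng7) rng7) rng7"
  by code_simp

text \<open>The condition is trace^2 = 4 norm. A Hurwitz unit has trace 0, 1 or 2 up to sign, where
  trace^2 - 4 is -4, -3 or 0; so modulo 7 a scalar times a unit meets it only if the unit is 1 or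
  -1. Nonscalar residues meeting it are thus never stuck.\<close>

lemma unipotent_mod_7:
  "list_all (\<lambda>a. list_all (\<lambda>b. list_all (\<lambda>c. list_all (\<lambda>d.
     ((2 * a + d) * (2 * a + d) - 4 * nr7 a b c d) mod 7 \<noteq> 0 \<or> nr7 a b c d = 0 \<or> b = 0 \<and> c = 0 \<and> d = 0 \<or>
     list_ex (\<lambda>(e, f, f1, f2, f3). (a + f1 * b + f2 * c + f3 * d) mod 7 = 0) switch_table)
     rng7) rng7) rng7) rng7"
  by code_simp

lemma code_checks_apply:
  assumes "list_all (\<lambda>a. list_all (\<lambda>b. list_all (\<lambda>c. list_all (\<lambda>d. P a b c d) rng7) rng7) rng7) rng7"
  shows "P (h0 (red x)) (h1 (red x)) (h2 (red x)) (h3 (red x))"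
proof -
  have "h0 (red x) \<in> set rng7" "h1 (red x) \<in> set rng7" "h2 (red x) \<in> set rng7" "h3 (red x) \<in> set rng7"
    using mod_7_in_rng7 by (simp_all add: red_def)
  then show ?thesis using assms unfolding list_all_iff by blast
qed

lemma nr7_red: "nr7 (h0 (red x)) (h1 (red x)) (h2 (red x)) (h3 (red x)) = 0 \<longleftrightarrow> dlt dvd nr x"
  unfolding nr_red[symmetric] by (simp add: nr7_def nr_def power2_eq_square)

lemma sdvd_zb: "sdvd dlt (zb - lift zb7)"
  by (simp add: sdvd_iff zb_def z0_def cnj_def lift_def zb7_def dlt_dvd_iff res7_def)

text \<open>The product is linear in \<open>x\<close>, and modulo 7 its values on the basis are the
  tabulated multiples of \<open>M\<close>, so one linear condition makes it vanish.\<close>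

lemma sdvd_switch:
  assumes "(e, f, f1, f2, f3) \<in> set switch_table"
    and "(h0 (red x) + f1 * h1 (red x) + f2 * h2 (red x) + f3 * h3 (red x)) mod 7 = 0"
  shows "sdvd dlt (zb * lift e * x * lift f * zb)"
proof -
  define p where "p = red x"
  define M where "M = zb7 * e * f * zb7"
  define I J W :: "int hur" where "I = Hur 0 1 0 0" and "J = Hur 0 0 1 0" and "W = Hur 0 0 0 1"
  have t: "sdvd 7 (zb7 * e * I * f * zb7 - sc f1 * M)" "sdvd 7 (zb7 * e * J * f * zb7 - sc f2 * M)"
    "sdvd 7 (zb7 * e * W * f * zb7 - sc f3 * M)"
    using switch_table_rank_one assms(1) unfolding list_all_iff zero7_iff M_def I_def J_def W_def by fast+
  have "p = sc (h0 p) * 1 + sc (h1 p) * I + sc (h2 p) * J + sc (h3 p) * W"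
    by (simp add: hur_eq_iff I_def J_def W_def)
  then have "zb7 * e * p * f * zb7 = zb7 * e * (sc (h0 p) * 1 + sc (h1 p) * I + sc (h2 p) * J + sc (h3 p) * W) * f * zb7"
    by simp
  also have "\<dots> = sc (h0 p) * M + sc (h1 p) * (zb7 * e * I * f * zb7) +
      sc (h2 p) * (zb7 * e * J * f * zb7) + sc (h3 p) * (zb7 * e * W * f * zb7)"
    by (simp only: M_def distrib_left distrib_right sc_left_commute mult.assoc mult_1_left)
  also have "\<dots> = sc (h0 p + f1 * h1 p + f2 * h2 p + f3 * h3 p) * M +
      (sc (h1 p) * (zb7 * e * I * f * zb7 - sc f1 * M) + sc (h2 p) * (zb7 * e * J * f * zb7 - sc f2 * M) +
       sc (h3 p) * (zb7 * e * W * f * zb7 - sc f3 * M))"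
    by (simp add: hur_eq_iff algebra_simps)
  finally have eq: "zb7 * e * p * f * zb7 = sc (h0 p + f1 * h1 p + f2 * h2 p + f3 * h3 p) * M +
      (sc (h1 p) * (zb7 * e * I * f * zb7 - sc f1 * M) + sc (h2 p) * (zb7 * e * J * f * zb7 - sc f2 * M) +
       sc (h3 p) * (zb7 * e * W * f * zb7 - sc f3 * M))" .
  have "7 dvd h0 p + f1 * h1 p + f2 * h2 p + f3 * h3 p"
    using assms(2) unfolding p_def by (simp only: mod_eq_0_iff_dvd)
  then have "sdvd 7 (sc (h0 p + f1 * h1 p + f2 * h2 p + f3 * h3 p) * M)"
    by (simp add: sdvd_iff)
  then have 7: "sdvd 7 (zb7 * e * p * f * zb7)"
    unfolding eq
    by (rule sdvd_add[OF _ sdvd_add[OF sdvd_add[OF sdvd_mult_left[OF t(1)] sdvd_mult_left[OF t(2)]] sdvd_mult_left[OF t(3)]]])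
  have refl: "sdvd dlt (y - y)" for y by (simp add: sdvd_iff)
  have "sdvd dlt (zb * lift e * x * lift f * zb - lift zb7 * lift e * lift p * lift f * lift zb7)"
    unfolding p_def by (intro sdvd_mult_cong sdvd_zb sdvd_red refl)
  then show ?thesis using 7 by (simp add: sdvd_cong lift_mult[symmetric] sdvd_lift)
qed

lemma switch_table_units:
  assumes "(e, f, f1, f2, f3) \<in> set switch_table"
  shows "nr (lift e) = 1" "nr (lift f) = 1"
    "trivial (lift e * x) \<longleftrightarrow> trivial x" "trivial (lift f * x) \<longleftrightarrow> trivial x"
proof -
  have "list_all (\<lambda>(e, f, f1, f2, f3). nr e = 1 \<and> nr f = 1 \<and>
      \<not> (even (h0 e + h1 e + h2 e) \<and> even (h3 e)) \<and> \<not> (even (h0 f + h1 f + h2 f) \<and> even (h3 f))) switch_table"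
    by (simp add: switch_table_def nr_def)
  then have *: "nr e = 1" "nr f = 1" "\<not> (even (h0 e + h1 e + h2 e) \<and> even (h3 e))"
    "\<not> (even (h0 f + h1 f + h2 f) \<and> even (h3 f))"
    using assms unfolding list_all_iff by fast+
  have "nr (lift u) = of_int (nr u)" for u by (simp add: nr_def lift_def)
  then show "nr (lift e) = 1" "nr (lift f) = 1" using *(1,2) by simp_all
  show "trivial (lift e * x) \<longleftrightarrow> trivial x" by (rule trivial_unit_mult[OF *(3)])
  show "trivial (lift f * x) \<longleftrightarrow> trivial x" by (rule trivial_unit_mult[OF *(4)])
qed

lemma dlt_odd: "\<not> 2 dvd dlt" and dlt_nz: "dlt \<noteq> 0"
  using tpos_nz[OF tpos_dlt] by (simp_all add: two_dvd_iff_nrm nrm_dlt)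

text \<open>Take the product in \<open>sdvd_switch\<close> divided by \<open>dlt\<close>. Modulo the
  prime above 2 its factors commute, and neither the units nor the odd scalar \<open>dlt\<close>
  affect triviality.\<close>

lemma switch_step:
  assumes "(e, f, f1, f2, f3) \<in> set switch_table"
    and "(h0 (red x) + f1 * h1 (red x) + f2 * h2 (red x) + f3 * h3 (red x)) mod 7 = 0"
  shows "\<exists>y. nr y = nr x \<and> (trivial y \<longleftrightarrow> trivial (zb * zb * x))"
proof -
  note u = switch_table_units[OF assms(1)]
  obtain y where y: "zb * lift e * x * lift f * zb = sc dlt * y"
    using sdvd_switch[OF assms] by (auto simp: sdvd_def)
  have "dlt * dlt * nr x = dlt ^ 2 * nr y"
    using arg_cong[OF y, of nr] by (simp add: nr_mult nr_zb u mult_ac)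
  then have "nr y = nr x" using dlt_nz by (simp add: power2_eq_square)
  moreover have "trivial y \<longleftrightarrow> trivial (zb * zb * x)"
  proof -
    have "eqP ((zb * lift e * x * lift f) * zb) (zb * (zb * lift e * x * lift f))" by (rule eqP_commute)
    also have "zb * (zb * lift e * x * lift f) = (zb * zb * lift e * x) * lift f" by (simp only: mult.assoc)
    finally have 1: "eqP (sc dlt * y) ((zb * zb * lift e * x) * lift f)" unfolding y .
    have 2: "eqP ((zb * zb * lift e * x) * lift f) (lift f * (zb * zb * lift e * x))" by (rule eqP_commute)
    have 3: "eqP (zb * zb * lift e * x) (lift e * (zb * zb) * x)"
      by (intro eqP_mult_right eqP_commute)
    have "trivial y \<longleftrightarrow> trivial (sc dlt * y)" by (rule trivial_sc_mult[OF dlt_odd, symmetric])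
    also have "\<dots> \<longleftrightarrow> trivial (lift f * (zb * zb * lift e * x))"
      by (rule trivial_cong, rule eqP_trans[OF 1 2])
    also have "\<dots> \<longleftrightarrow> trivial (lift e * (zb * zb) * x)" unfolding u by (rule trivial_cong[OF 3])
    also have "\<dots> \<longleftrightarrow> trivial (zb * zb * x)" by (simp only: mult.assoc u)
    finally show ?thesis .
  qed
  ultimately show ?thesis by blast
qed

definition hunit :: "int \<times> int \<times> int \<times> int \<Rightarrow> cub hur" where
  "hunit = (\<lambda>(a, b, c, d). lift (Hur a b c d))"

lemma hunit_units12:
  assumes "u \<in> set units12"
  shows "nr (hunit u) = 1" "trivial (hunit u * x) \<longleftrightarrow> trivial x"
proof -
  have "list_all (\<lambda>(a, b, c, d). nr (Hur a b c d) = 1 \<and>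
      \<not> (even (h0 (Hur a b c d) + h1 (Hur a b c d) + h2 (Hur a b c d)) \<and> even (h3 (Hur a b c d)))) units12"
    by (simp add: units12_def nr_def)
  then obtain q where q: "hunit u = lift q" "nr q = 1" "\<not> (even (h0 q + h1 q + h2 q) \<and> even (h3 q))"
    using assms unfolding list_all_iff hunit_def by (cases u) fast
  have "nr (lift q) = of_int (nr q)" by (simp add: nr_def lift_def)
  then show "nr (hunit u) = 1" using q by simp
  show "trivial (hunit u * x) \<longleftrightarrow> trivial x" unfolding q(1) by (rule trivial_unit_mult[OF q(3)])
qed

lemma switch_or_stuck:
  assumes "\<not> dlt dvd nr x"
  shows "(\<exists>y. nr y = nr x \<and> (trivial y \<longleftrightarrow> trivial (zb * zb * x))) \<or>
    (\<exists>u\<in>set units12. \<exists>c. sdvd dlt (x - sc c * hunit u))"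
proof -
  define a b c d where "a = h0 (red x)" and "b = h1 (red x)" and "c = h2 (red x)" and "d = h3 (red x)"
  have "nr7 a b c d \<noteq> 0" using assms nr7_red unfolding a_def b_def c_def d_def by blast
  then consider "list_ex (\<lambda>(e, f, f1, f2, f3). (a + f1 * b + f2 * c + f3 * d) mod 7 = 0) switch_table"
    | "list_ex (\<lambda>(u0, u1, u2, u3). list_ex (\<lambda>k. (a - k * u0) mod 7 = 0 \<and> (b - k * u1) mod 7 = 0 \<and>
       (c - k * u2) mod 7 = 0 \<and> (d - k * u3) mod 7 = 0) rng7) units12"
    using code_checks_apply[OF switch_mod_7, of x] unfolding a_def b_def c_def d_def by argo
  then show ?thesis
  proof cases
    case 1
    then obtain e f f1 f2 f3 where "(e, f, f1, f2, f3) \<in> set switch_table" "(a + f1 * b + f2 * c + f3 * d) mod 7 = 0"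
      unfolding list_ex_iff by auto
    then have "\<exists>y. nr y = nr x \<and> (trivial y \<longleftrightarrow> trivial (zb * zb * x))"
      unfolding a_def b_def c_def d_def by (rule switch_step)
    then show ?thesis ..
  next
    case 2
    then obtain u0 u1 u2 u3 k where u: "(u0, u1, u2, u3) \<in> set units12"
      and k: "7 dvd a - k * u0" "7 dvd b - k * u1" "7 dvd c - k * u2" "7 dvd d - k * u3"
      unfolding list_ex_iff mod_eq_0_iff_dvd by auto
    have "sdvd 7 (red x - sc k * Hur u0 u1 u2 u3)"
      using k unfolding a_def b_def c_def d_def by (simp add: sdvd_iff)
    then have "sdvd dlt (lift (red x) - sc (of_int k) * hunit (u0, u1, u2, u3))"
      unfolding sdvd_lift[symmetric] lift_diff lift_mult by (simp add: hunit_def lift_def sc_def)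
    then have "sdvd dlt ((x - lift (red x)) + (lift (red x) - sc (of_int k) * hunit (u0, u1, u2, u3)))"
      by (rule sdvd_add[OF sdvd_red])
    then have "sdvd dlt (x - sc (of_int k) * hunit (u0, u1, u2, u3))" by simp
    then show ?thesis using u by blast
  qed
qed

lemma switch_unipotent:
  assumes "\<not> dlt dvd nr x" "dlt dvd (2 * h0 x + h3 x) ^ 2 - 4 * nr x"
    and "\<not> (dlt dvd h1 x \<and> dlt dvd h2 x \<and> dlt dvd h3 x)"
  shows "\<exists>y. nr y = nr x \<and> (trivial y \<longleftrightarrow> trivial (zb * zb * x))"
proof -
  define a b c d where "a = h0 (red x)" and "b = h1 (red x)" and "c = h2 (red x)" and "d = h3 (red x)"
  have n: "nr7 a b c d \<noteq> 0" using assms(1) nr7_red unfolding a_def b_def c_def d_def by blast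
  have "\<not> (b = 0 \<and> c = 0 \<and> d = 0)"
    using assms(3) unfolding b_def c_def d_def by (simp add: red_def dlt_dvd_iff mod_eq_0_iff_dvd)
  moreover have "((2 * a + d) * (2 * a + d) - 4 * nr7 a b c d) mod 7 = 0"
  proof -
    let ?q = "lift (red x)"
    have diff: "dlt dvd h0 x - h0 ?q" "dlt dvd h3 x - h3 ?q" using sdvd_red[of x] by (simp_all add: sdvd_iff)
    have "(2 * h0 x + h3 x) ^ 2 - (2 * h0 ?q + h3 ?q) ^ 2 =
      (2 * (h0 x - h0 ?q) + (h3 x - h3 ?q)) * ((2 * h0 x + h3 x) + (2 * h0 ?q + h3 ?q))"
      by (simp add: power2_eq_square algebra_simps)
    then have 1: "dlt dvd (2 * h0 x + h3 x) ^ 2 - (2 * h0 ?q + h3 ?q) ^ 2"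
      using diff by (metis dvd_add dvd_mult dvd_mult2)
    have 2: "dlt dvd 4 * (nr x - nr ?q)" by (intro dvd_mult nr_cong sdvd_red)
    have "(2 * h0 ?q + h3 ?q) ^ 2 - 4 * nr ?q = (2 * h0 x + h3 x) ^ 2 - 4 * nr x
      - ((2 * h0 x + h3 x) ^ 2 - (2 * h0 ?q + h3 ?q) ^ 2) + 4 * (nr x - nr ?q)"
      by (simp add: algebra_simps)
    then have "dlt dvd (2 * h0 ?q + h3 ?q) ^ 2 - 4 * nr ?q"
      using dvd_add[OF dvd_diff[OF assms(2) 1] 2] by (simp only:)
    moreover have "(2 * h0 ?q + h3 ?q) ^ 2 - 4 * nr ?q =
      of_int ((2 * a + d) * (2 * a + d) - 4 * (a * a + b * b + c * c + d * d + d * (a + b + c)))"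
      by (simp add: lift_def nr_def a_def b_def c_def d_def power2_eq_square)
    ultimately have 7: "7 dvd (2 * a + d) * (2 * a + d) - 4 * (a * a + b * b + c * c + d * d + d * (a + b + c))"
      by (simp only: dlt_dvd_iff res7_simps)
    have "7 dvd u - 4 * (v mod 7)" if uv: "7 dvd u - 4 * v" for u v :: int
    proof -
      have "u - 4 * (v mod 7) = (u - 4 * v) + 7 * (4 * (v div 7))"
        using mult_div_mod_eq[of 7 v] by linarith
      then show ?thesis using uv by (metis dvd_add dvd_triv_left)
    qed
    from this[OF 7] show ?thesis unfolding nr7_def by (simp only: mod_eq_0_iff_dvd)
  qed
  ultimately have "list_ex (\<lambda>(e, f, f1, f2, f3). (a + f1 * b + f2 * c + f3 * d) mod 7 = 0) switch_table"
    using code_checks_apply[OF unipotent_mod_7, of x] n unfolding a_def b_def c_def d_def by argo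
  then obtain e f f1 f2 f3 where "(e, f, f1, f2, f3) \<in> set switch_table" "(a + f1 * b + f2 * c + f3 * d) mod 7 = 0"
    unfolding list_ex_iff by auto
  then show ?thesis unfolding a_def b_def c_def d_def by (rule switch_step)
qed

text \<open>Scalars contribute only scalars, so modulo \<open>dlt\<close> the coordinate
  \<open>h1\<close> of the conjugate is a linear form in \<open>h1\<close>, \<open>h2\<close>,
  \<open>h3\<close> of \<open>y\<close>. The three units give independent forms.\<close>

lemma nonscalar_conjugate:
  assumes "\<not> (dlt dvd h1 y \<and> dlt dvd h2 y \<and> dlt dvd h3 y)"
  obtains e where "e \<in> {Hur 1 0 0 0, Hur 1 1 1 (-1), Hur 1 1 1 (-2)}"
    "\<not> dlt dvd h1 ((z0 * lift e) * y * cnj (z0 * lift e))"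
proof -
  define p where "p = red y"
  define c7 :: "int hur \<Rightarrow> int hur" where "c7 = (\<lambda>e. (Hur 1 0 0 2 * e) * p * cnj (Hur 1 0 0 2 * e))"
  have cnj_lift: "lift (cnj q) = cnj (lift q)" for q by (simp add: lift_def cnj_def)
  have z0: "sdvd dlt (z0 - lift (Hur 1 0 0 2))"
    by (simp add: sdvd_iff z0_def lift_def dlt_dvd_iff res7_def)
  have refl: "sdvd dlt (q - q)" for q by (simp add: sdvd_iff)
  have iff: "dlt dvd h1 ((z0 * lift e) * y * cnj (z0 * lift e)) \<longleftrightarrow> 7 dvd h1 (c7 e)" for e
  proof -
    have "sdvd dlt ((z0 * lift e) * y * cnj (z0 * lift e) - lift (c7 e))"
      unfolding c7_def lift_mult cnj_lift p_def by (intro sdvd_mult_cong sdvd_cnj_diff z0 sdvd_red refl)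
    then have "dlt dvd h1 ((z0 * lift e) * y * cnj (z0 * lift e)) - of_int (h1 (c7 e))"
      unfolding sdvd_iff by (simp add: lift_def)
    then have "dlt dvd h1 ((z0 * lift e) * y * cnj (z0 * lift e)) \<longleftrightarrow> dlt dvd of_int (h1 (c7 e))"
      by (rule dvd_cong_diff)
    then show ?thesis by (simp add: dlt_dvd_iff res7_simps)
  qed
  have np: "\<not> (7 dvd h1 p \<and> 7 dvd h2 p \<and> 7 dvd h3 p)"
    using assms unfolding p_def by (simp add: red_def dlt_dvd_iff dvd_mod_iff)
  have "\<not> 7 dvd h1 (c7 (Hur 1 0 0 0)) \<or> \<not> 7 dvd h1 (c7 (Hur 1 1 1 (-1))) \<or> \<not> 7 dvd h1 (c7 (Hur 1 1 1 (-2)))"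
  proof (rule ccontr)
    assume h: "\<not> ?thesis"
    have "7 dvd h1 (c7 (Hur 1 0 0 0))" "7 dvd h1 (c7 (Hur 1 1 1 (-1)))" "7 dvd h1 (c7 (Hur 1 1 1 (-2)))"
      using h by blast+
    moreover have "h1 (c7 (Hur 1 0 0 0)) = 5 * h1 p - 8 * h2 p"
      "h1 (c7 (Hur 1 1 1 (-1))) = 5 * h2 p + 5 * h3 p - 3 * h1 p"
      "h1 (c7 (Hur 1 1 1 (-2))) = 8 * h2 p + 3 * h3 p - 5 * h1 p"
      unfolding c7_def by (simp_all add: times_hur_def cnj_def algebra_simps)
    ultimately have d: "7 dvd 5 * h1 p - 8 * h2 p" "7 dvd 5 * h2 p + 5 * h3 p - 3 * h1 p"
      "7 dvd 8 * h2 p + 3 * h3 p - 5 * h1 p" by simp_all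
    \<comment> \<open>The coefficients invert the 3 by 3 matrix of these forms modulo 7.\<close>
    have "h1 p = (5 * h1 p - 8 * h2 p) + (5 * h2 p + 5 * h3 p - 3 * h1 p) +
        3 * (8 * h2 p + 3 * h3 p - 5 * h1 p) + 7 * (2 * h1 p - 3 * h2 p - 2 * h3 p)"
      by (simp add: algebra_simps)
    moreover have "h2 p = 4 * (5 * h1 p - 8 * h2 p) + 5 * (5 * h2 p + 5 * h3 p - 3 * h1 p) +
        (8 * h2 p + 3 * h3 p - 5 * h1 p) + 7 * (- 4 * h3 p)"
      by (simp add: algebra_simps)
    moreover have "h3 p = 5 * (5 * h1 p - 8 * h2 p) + 5 * (8 * h2 p + 3 * h3 p - 5 * h1 p) + 7 * (- 2 * h3 p)"
      by (simp add: algebra_simps)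
    ultimately have "7 dvd h1 p \<and> 7 dvd h2 p \<and> 7 dvd h3 p"
      using d by (metis dvd_add dvd_mult dvd_triv_left)
    then show False using np by blast
  qed
  then show thesis using iff that by blast
qed

text \<open>As \<open>cnj w\<close> is \<open>dlt\<close> times the inverse of \<open>w\<close>, the
  first hypothesis says that x' = w x w^(-1).\<close>

lemma trace_conjugate:
  assumes "sc dlt * x' = w * x * cnj w" "nr w = dlt"
  shows "nr x' = nr x" "2 * h0 x' + h3 x' = 2 * h0 x + h3 x"
    "trivial (q * x') \<longleftrightarrow> trivial (q * x)"
proof -
  have "dlt ^ 2 * nr x' = dlt ^ 2 * nr x"
    using arg_cong[OF assms(1), of nr] by (simp add: nr_mult assms(2) power2_eq_square mult_ac)
  then show "nr x' = nr x" using dlt_nz by simp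
  have tr: "y + cnj y = sc (2 * h0 y + h3 y)" for y :: "cub hur"
    by (simp add: hur_eq_iff cnj_def)
  have "sc dlt * (x' + cnj x') = w * x * cnj w + cnj (w * x * cnj w)"
    unfolding assms(1)[symmetric] by (simp add: cnj_mult sc_commute distrib_left)
  also have "\<dots> = w * (x + cnj x) * cnj w"
    by (simp add: cnj_mult distrib_left distrib_right mult.assoc)
  also have "\<dots> = sc (2 * h0 x + h3 x) * (w * cnj w)"
    unfolding tr sc_commute[of w] by (simp only: mult.assoc)
  also have "\<dots> = sc dlt * sc (2 * h0 x + h3 x)"
    unfolding mult_cnj assms(2) by (rule sc_commute)
  finally have "sc (dlt * (2 * h0 x' + h3 x')) = sc (dlt * (2 * h0 x + h3 x))"
    unfolding tr sc_mult .
  then have "dlt * (2 * h0 x' + h3 x') = dlt * (2 * h0 x + h3 x)" by (metis sc_sel(1))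
  then show "2 * h0 x' + h3 x' = 2 * h0 x + h3 x" using dlt_nz by simp
  have 1: "eqP ((q * w * x) * cnj w) (cnj w * (q * w * x))" by (rule eqP_commute)
  have 2: "eqP ((cnj w * q) * w * x) (w * (cnj w * q) * x)" by (intro eqP_mult_right eqP_commute)
  have "trivial (q * x') \<longleftrightarrow> trivial (sc dlt * (q * x'))"
    by (rule trivial_sc_mult[OF dlt_odd, symmetric])
  also have "sc dlt * (q * x') = (q * w * x) * cnj w"
    unfolding sc_left_commute[symmetric] assms(1) by (simp only: mult.assoc)
  also have "trivial \<dots> \<longleftrightarrow> trivial ((cnj w * q) * w * x)"
    using trivial_cong[OF 1] by (simp only: mult.assoc)
  also have "\<dots> \<longleftrightarrow> trivial (w * (cnj w * q) * x)" by (rule trivial_cong[OF 2])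
  also have "w * (cnj w * q) * x = sc dlt * (q * x)"
    unfolding assms(2)[symmetric] mult_cnj[symmetric] by (simp only: mult.assoc)
  also have "trivial \<dots> \<longleftrightarrow> trivial (q * x)" by (rule trivial_sc_mult[OF dlt_odd])
  finally show "trivial (q * x') \<longleftrightarrow> trivial (q * x)" .
qed

lemma dlt_pow_nz: "dlt ^ k \<noteq> 0"
  using dlt_nz by simp

text \<open>For x = c + dlt^(k+1) y with y nonscalar modulo \<open>dlt\<close>, w x w^(-1) = c +
  dlt^k (w y \<open>cnj w\<close>). The choice of \<open>w\<close> keeps the bracket nonscalar, so
  exactly one power of \<open>dlt\<close> is lost.\<close>

lemma conjugation_step:
  assumes "dlt ^ Suc k dvd h1 x" "dlt ^ Suc k dvd h2 x" "dlt ^ Suc k dvd h3 x"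
    and "\<not> (dlt ^ Suc (Suc k) dvd h1 x \<and> dlt ^ Suc (Suc k) dvd h2 x \<and> dlt ^ Suc (Suc k) dvd h3 x)"
  obtains x' where "nr x' = nr x" "2 * h0 x' + h3 x' = 2 * h0 x + h3 x"
    "trivial (zb * zb * x') \<longleftrightarrow> trivial (zb * zb * x)"
    "dlt ^ k dvd h1 x'" "dlt ^ k dvd h2 x'" "dlt ^ k dvd h3 x'"
    "\<not> (dlt ^ Suc k dvd h1 x' \<and> dlt ^ Suc k dvd h2 x' \<and> dlt ^ Suc k dvd h3 x')"
proof -
  obtain y1 y2 y3 where y: "h1 x = dlt ^ Suc k * y1" "h2 x = dlt ^ Suc k * y2" "h3 x = dlt ^ Suc k * y3"
    using assms(1-3) by (auto elim!: dvdE)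
  define y where "y = Hur 0 y1 y2 y3"
  have x: "x = sc (h0 x) + sc (dlt ^ Suc k) * y" using y by (simp add: hur_eq_iff y_def)
  have "\<not> (dlt dvd h1 y \<and> dlt dvd h2 y \<and> dlt dvd h3 y)"
  proof
    assume "dlt dvd h1 y \<and> dlt dvd h2 y \<and> dlt dvd h3 y"
    then have "dlt ^ Suc k * dlt dvd dlt ^ Suc k * y1" "dlt ^ Suc k * dlt dvd dlt ^ Suc k * y2"
      "dlt ^ Suc k * dlt dvd dlt ^ Suc k * y3"
      unfolding y_def hur.sel by (blast intro: mult_dvd_mono[OF dvd_refl])+
    then show False using assms(4) unfolding y power_Suc2[symmetric] by blast
  qed
  then obtain e where e: "e \<in> {Hur 1 0 0 0, Hur 1 1 1 (-1), Hur 1 1 1 (-2)}"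
    "\<not> dlt dvd h1 ((z0 * lift e) * y * cnj (z0 * lift e))"
    by (rule nonscalar_conjugate)
  define w where "w = z0 * lift e"
  have "nr (lift e) = 1" using e(1) by (auto simp: nr_def lift_def)
  then have nw: "nr w = dlt" by (simp add: w_def nr_mult nr_z0)
  define n where "n = w * y * cnj w"
  define x' where "x' = sc (h0 x) + sc (dlt ^ k) * n"
  have "w * x * cnj w = w * sc (h0 x) * cnj w + w * (sc (dlt ^ Suc k) * y) * cnj w"
    by (subst x) (simp only: distrib_left distrib_right)
  also have "w * sc (h0 x) * cnj w = sc (h0 x) * (w * cnj w)"
    unfolding sc_commute[of w] by (simp only: mult.assoc)
  also have "w * (sc (dlt ^ Suc k) * y) * cnj w = sc (dlt ^ Suc k) * n"
    unfolding sc_left_commute n_def by (simp only: mult.assoc)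
  also have "sc (h0 x) * (w * cnj w) + sc (dlt ^ Suc k) * n = sc dlt * x'"
    unfolding mult_cnj nw x'_def by (simp add: hur_eq_iff algebra_simps)
  finally have conj: "sc dlt * x' = w * x * cnj w" ..
  have h: "h1 x' = dlt ^ k * h1 n" "h2 x' = dlt ^ k * h2 n" "h3 x' = dlt ^ k * h3 n"
    by (simp_all add: x'_def)
  have "\<not> dlt dvd h1 n" using e(2) by (simp add: n_def w_def)
  then have nd: "\<not> dlt ^ Suc k dvd h1 x'"
    unfolding h power_Suc2 dvd_mult_cancel_left using dlt_pow_nz by blast
  show thesis
    by (rule that[OF trace_conjugate(1)[OF conj nw] trace_conjugate(2)[OF conj nw] trace_conjugate(3)[OF conj nw]])
      (simp_all only: h dvd_triv_left, use nd h in auto)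
qed

text \<open>
  Write \<open>x = c + dlt\<^sup>k * y\<close> with \<open>y\<close> not a scalar modulo \<open>dlt\<close>. Conjugation by a suitable
  \<open>w\<close> of norm \<open>dlt\<close> lowers \<open>k\<close>, and for \<open>k = 1\<close> it leads to an element that is unipotent up to
  a scalar, hence not stuck.
\<close>
lemma switch_scalar:
  assumes "\<not> dlt dvd nr x" "dlt ^ Suc k dvd h1 x" "dlt ^ Suc k dvd h2 x" "dlt ^ Suc k dvd h3 x"
    and "\<not> (dlt ^ Suc (Suc k) dvd h1 x \<and> dlt ^ Suc (Suc k) dvd h2 x \<and> dlt ^ Suc (Suc k) dvd h3 x)"
  shows "\<exists>y. nr y = nr x \<and> (trivial y \<longleftrightarrow> trivial (zb * zb * x))"
  using assms
proof (induction k arbitrary: x)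
  case (0 x)
  obtain x' where x': "nr x' = nr x" "2 * h0 x' + h3 x' = 2 * h0 x + h3 x"
    "trivial (zb * zb * x') \<longleftrightarrow> trivial (zb * zb * x)"
    "\<not> (dlt ^ Suc 0 dvd h1 x' \<and> dlt ^ Suc 0 dvd h2 x' \<and> dlt ^ Suc 0 dvd h3 x')"
    using conjugation_step[OF 0(2-5)] by metis
  \<comment> \<open>The discriminant is a quadratic form in \<open>h1\<close>, \<open>h2\<close>,
    \<open>h3\<close>, hence divisible by \<open>dlt\<close>, and conjugation preserves it.\<close>
  have "(2 * h0 x + h3 x) ^ 2 - 4 * nr x =
      h3 x * (- 3 * h3 x - 4 * h1 x - 4 * h2 x) - h1 x * (4 * h1 x) - h2 x * (4 * h2 x)"
    by (simp add: nr_def power2_eq_square algebra_simps)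
  moreover have d: "dlt dvd h1 x" "dlt dvd h2 x" "dlt dvd h3 x" using 0(2-4) by simp_all
  have "dlt dvd h3 x * (- 3 * h3 x - 4 * h1 x - 4 * h2 x) - h1 x * (4 * h1 x) - h2 x * (4 * h2 x)"
    by (rule dvd_diff[OF dvd_diff[OF dvd_mult2[OF d(3)] dvd_mult2[OF d(1)]] dvd_mult2[OF d(2)]])
  ultimately have "dlt dvd (2 * h0 x' + h3 x') ^ 2 - 4 * nr x'"
    unfolding x'(1,2) by (simp only:)
  then have "\<exists>y. nr y = nr x' \<and> (trivial y \<longleftrightarrow> trivial (zb * zb * x'))"
    using switch_unipotent[of x'] 0(1) x'(1,4) by simp
  then show ?case unfolding x'(1,3) .
next
  case (Suc k x)
  obtain x' where x': "nr x' = nr x" "trivial (zb * zb * x') \<longleftrightarrow> trivial (zb * zb * x)"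
    "dlt ^ Suc k dvd h1 x'" "dlt ^ Suc k dvd h2 x'" "dlt ^ Suc k dvd h3 x'"
    "\<not> (dlt ^ Suc (Suc k) dvd h1 x' \<and> dlt ^ Suc (Suc k) dvd h2 x' \<and> dlt ^ Suc (Suc k) dvd h3 x')"
    using conjugation_step[OF Suc.prems(2-5)] by metis
  have "\<not> dlt dvd nr x'" using Suc.prems(1) x'(1) by simp
  from Suc.IH[OF this x'(3-6)] show ?case unfolding x'(1,2) .
qed

lemma dlt_power_bound:
  assumes "dlt ^ k dvd v" "v \<noteq> 0" shows "k \<le> nat \<bar>nrm v\<bar>"
proof -
  obtain w where w: "v = dlt ^ k * w" using assms(1) ..
  have "nrm w \<noteq> 0" using assms(2) w by auto
  then have "1 \<le> \<bar>nrm w\<bar>" by linarith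
  have "int k < 7 ^ k"
  proof (induction k)
    case (Suc k)
    have "(0::int) < 7 ^ k" by simp
    then show ?case using Suc unfolding power_Suc by linarith
  qed simp
  also have "(7::int) ^ k \<le> 7 ^ k * \<bar>nrm w\<bar>" using \<open>1 \<le> \<bar>nrm w\<bar>\<close> by simp
  also have "\<dots> = \<bar>nrm v\<bar>" by (simp add: w nrm_mult nrm_power nrm_dlt abs_mult power_abs)
  finally show ?thesis by simp
qed

lemma trivial_mult_cnj_unit:
  assumes "u \<in> set units12" shows "trivial (x * cnj (hunit u)) \<longleftrightarrow> trivial x"
proof -
  have "trivial (x * cnj (hunit u)) \<longleftrightarrow> trivial (hunit u * cnj x)"
    using trivial_cnj[of "x * cnj (hunit u)"] by (simp add: cnj_mult)
  then show ?thesis using hunit_units12(2)[OF assms] trivial_cnj by simp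
qed

text \<open>A stuck \<open>x\<close> is a scalar times a unit modulo \<open>dlt\<close>; removing
  the unit on the right leaves a scalar modulo \<open>dlt\<close>. Unless this is an exact scalar,
  there is a highest power of \<open>dlt\<close> modulo which it is one, and
  \<open>switch_scalar\<close> applies.\<close>

lemma change_class:
  assumes "\<not> dlt dvd nr x"
  shows "(\<exists>c. \<exists>u\<in>set units12. x = sc c * hunit u) \<or>
    (\<exists>y. nr y = nr x \<and> (trivial y \<longleftrightarrow> trivial (zb * zb * x)))"
proof (rule disjCI)
  assume no: "\<nexists>y. nr y = nr x \<and> (trivial y \<longleftrightarrow> trivial (zb * zb * x))"
  then obtain u c where u: "u \<in> set units12" and c: "sdvd dlt (x - sc c * hunit u)"
    using switch_or_stuck[OF assms] by blast
  have nu: "nr (hunit u) = 1" by (rule hunit_units12(1)[OF u])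
  define x1 where "x1 = x * cnj (hunit u)"
  have "(x - sc c * hunit u) * cnj (hunit u) = x1 - sc c"
    unfolding x1_def left_diff_distrib mult.assoc mult_cnj nu by simp
  then have "sdvd dlt (x1 - sc c)" using sdvd_mult_right[OF c, of "cnj (hunit u)"] by simp
  then have d: "dlt dvd h1 x1" "dlt dvd h2 x1" "dlt dvd h3 x1" by (simp_all add: sdvd_iff)
  have nx: "nr x1 = nr x" by (simp add: x1_def nr_mult nu)
  have tx: "trivial (zb * zb * x1) \<longleftrightarrow> trivial (zb * zb * x)"
    unfolding x1_def mult.assoc[symmetric] by (rule trivial_mult_cnj_unit[OF u])
  have "h1 x1 = 0 \<and> h2 x1 = 0 \<and> h3 x1 = 0"
  proof (rule ccontr)
    assume nz: "\<not> ?thesis"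
    define P where "P = (\<lambda>k. dlt ^ k dvd h1 x1 \<and> dlt ^ k dvd h2 x1 \<and> dlt ^ k dvd h3 x1)"
    have bound: "k \<le> nat \<bar>nrm (h1 x1)\<bar> + nat \<bar>nrm (h2 x1)\<bar> + nat \<bar>nrm (h3 x1)\<bar>" if "P k" for k
    proof -
      have "k \<le> nat \<bar>nrm (h1 x1)\<bar> \<or> k \<le> nat \<bar>nrm (h2 x1)\<bar> \<or> k \<le> nat \<bar>nrm (h3 x1)\<bar>"
        using that nz dlt_power_bound unfolding P_def by blast
      then show ?thesis by linarith
    qed
    have "P 1" using d by (simp add: P_def)
    define k where "k = (GREATEST k. P k)"
    have "P k" unfolding k_def by (rule GreatestI_nat[of P, OF \<open>P 1\<close> bound])
    have "1 \<le> k" unfolding k_def by (rule Greatest_le_nat[of P, OF \<open>P 1\<close> bound])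
    have "\<not> P (Suc k)"
    proof
      assume "P (Suc k)"
      then have "Suc k \<le> k" unfolding k_def by (rule Greatest_le_nat[of P, OF _ bound])
      then show False by simp
    qed
    obtain l where l: "k = Suc l" using \<open>1 \<le> k\<close> by (cases k) auto
    have "\<not> dlt dvd nr x1" using assms nx by simp
    then have "\<exists>y. nr y = nr x1 \<and> (trivial y \<longleftrightarrow> trivial (zb * zb * x1))"
      using switch_scalar[of x1 l] \<open>P k\<close> \<open>\<not> P (Suc k)\<close> unfolding P_def l by blast
    then show False using no unfolding nx tx by blast
  qed
  then have x1: "x1 = sc (h0 x1)" by (simp add: hur_eq_iff)
  have "x1 * hunit u = x"
    unfolding x1_def mult.assoc cnj_mult_self nu by simp
  then have "x = sc (h0 x1) * hunit u" using x1 by metis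
  then show "\<exists>c. \<exists>u\<in>set units12. x = sc c * hunit u" using u by blast
qed

section \<open>Sums of four squares\<close>

lemma nr_hunit_multiple: "u \<in> set units12 \<Longrightarrow> nr (sc c * hunit u) = c ^ 2"
  by (simp add: nr_sc_mult hunit_units12)

lemma trivial_hunit_multiple:
  assumes "u \<in> set units12" shows "trivial (sc c * hunit u)"
proof -
  have "trivial (hunit u * sc c)"
    unfolding hunit_units12(2)[OF assms] by (simp add: trivial_def triv_def)
  then show ?thesis by (simp only: sc_commute)
qed

text \<open>Applying \<open>change_class\<close> to the conjugate replaces \<open>zb\<close> by
  \<open>z0\<close>, so both shifts are available and one cancels a nontrivial class. The
  exceptions, scalars times units, are trivial already.\<close>

lemma trivial_representation:
  assumes "tpos \<alpha>" "\<not> dlt dvd \<alpha>"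
  obtains x where "nr x = \<alpha>" "trivial x"
proof -
  obtain x where x: "nr x = \<alpha>" using hurwitz_universal[OF assms(1)] by blast
  have "\<exists>y. nr y = \<alpha> \<and> trivial y"
  proof (cases "trivial x")
    case False
    have ns: "\<not> (\<exists>c. \<exists>u\<in>set units12. x = sc c * hunit u)"
      "\<not> (\<exists>c. \<exists>u\<in>set units12. cnj x = sc c * hunit u)"
      using False trivial_hunit_multiple trivial_cnj[of x] by metis+
    obtain y where y: "nr y = \<alpha>" "trivial y \<longleftrightarrow> trivial (zb * zb * x)"
      using change_class[of x] ns(1) assms(2) x by auto
    obtain y' where y': "nr y' = \<alpha>" "trivial y' \<longleftrightarrow> trivial (zb * zb * cnj x)"
      using change_class[of "cnj x"] ns(2) assms(2) x by auto
    have "trivial (zb * zb * cnj x) \<longleftrightarrow> trivial (cnj (zb * zb * cnj x))" by (rule trivial_cnj[symmetric])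
    also have "cnj (zb * zb * cnj x) = x * (z0 * z0)" by (simp add: cnj_mult zb_def)
    also have "trivial \<dots> \<longleftrightarrow> trivial (z0 * z0 * x)" by (rule trivial_cong[OF eqP_commute])
    finally show ?thesis using y y' class_shift_nontrivial[OF False] by blast
  qed (use x in blast)
  then show thesis using that by blast
qed

lemma trivial_unit_scale: "v dvd 1 \<Longrightarrow> trivial (sc v * x) \<longleftrightarrow> trivial x"
proof (rule trivial_sc_mult)
  assume v: "v dvd 1"
  show "\<not> 2 dvd v"
  proof
    assume "2 dvd v"
    then have "2 dvd nrm v" by (simp add: two_dvd_iff_nrm)
    moreover have "nrm v = 1 \<or> nrm v = -1" using v unfolding unit_iff by linarith
    ultimately show False by auto
  qed
qed

text \<open>In the exceptional case of \<open>change_class\<close> the element is a square c^2.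
  Induction gives a nontrivial quaternion of norm c up to a unit, and its square is nontrivial
  too.\<close>

lemma nontrivial_representation:
  assumes "tpos \<alpha>" "\<not> dlt dvd \<alpha>" "\<not> 2 dvd \<alpha>" "nrm \<alpha> \<noteq> 1"
  shows "\<exists>x. nr x = \<alpha> \<and> \<not> trivial x"
  using assms
proof (induction "nat (nrm \<alpha>)" arbitrary: \<alpha> rule: less_induct)
  case less
  obtain x where x: "nr x = \<alpha>" using hurwitz_universal[OF less.prems(1)] by blast
  have "\<not> dlt dvd nr x" using less.prems(2) x by simp
  from change_class[OF this] show ?case
  proof
    assume "\<exists>y. nr y = nr x \<and> (trivial y \<longleftrightarrow> trivial (zb * zb * x))"
    then obtain y where "nr y = \<alpha>" "trivial y \<longleftrightarrow> trivial (zb * zb * x)" using x by blast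
    moreover have "\<not> 2 dvd nr x" using less.prems(3) x by simp
    then have "trivial x \<Longrightarrow> \<not> trivial (zb * zb * x)" by (rule class_shift_trivial)
    ultimately show ?thesis using x by (cases "trivial x") blast+
  next
    assume "\<exists>c. \<exists>u\<in>set units12. x = sc c * hunit u"
    then obtain c u where "u \<in> set units12" "x = sc c * hunit u" by blast
    then have \<alpha>: "\<alpha> = c ^ 2" using x nr_hunit_multiple[of u c] by simp
    have c: "c \<noteq> 0" "\<not> dlt dvd c" "\<not> 2 dvd c"
    proof -
      show "c \<noteq> 0" using tpos_nz[OF less.prems(1)] \<alpha> by auto
      show "\<not> dlt dvd c" using less.prems(2) dvd_mult2[of dlt c c] unfolding \<alpha> power2_eq_square by blast
      show "\<not> 2 dvd c" using less.prems(3) dvd_mult2[of 2 c c] unfolding \<alpha> power2_eq_square by blast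
    qed
    obtain v where v: "v dvd 1" "tpos (v * c)" by (rule tpos_unit_multiple[OF c(1)])
    obtain v' where v': "1 = v * v'" using v(1) ..
    have "v' dvd 1" using v' by (metis dvd_triv_right)
    have nv: "\<bar>nrm v\<bar> = 1" using v(1) unit_iff by blast
    have "nrm (v * c) = \<bar>nrm (v * c)\<bar>" using tpos_nrm_pos[OF v(2)] by simp
    also have "\<dots> = \<bar>nrm c\<bar>" unfolding nrm_mult abs_mult nv by simp
    finally have vc: "nrm (v * c) = \<bar>nrm c\<bar>" .
    have n\<alpha>: "nrm \<alpha> = \<bar>nrm c\<bar> * \<bar>nrm c\<bar>" unfolding \<alpha> nrm_power by (simp add: power2_eq_square)
    have c1: "\<bar>nrm c\<bar> > 1"
    proof -
      have "\<bar>nrm c\<bar> \<noteq> 1"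
      proof
        assume h: "\<bar>nrm c\<bar> = 1"
        have "nrm \<alpha> = 1" unfolding n\<alpha> h by simp
        then show False using less.prems(4) by simp
      qed
      moreover have "nrm c \<noteq> 0" using c(1) by simp
      ultimately show ?thesis by linarith
    qed
    have "1 * \<bar>nrm c\<bar> < \<bar>nrm c\<bar> * \<bar>nrm c\<bar>" using c1 by (intro mult_strict_right_mono) auto
    then have "nrm (v * c) < nrm \<alpha>" unfolding vc n\<alpha> mult_1_left .
    then have "nat (nrm (v * c)) < nat (nrm \<alpha>)" using vc c1 by simp
    moreover have "\<not> dlt dvd v * c" "\<not> 2 dvd v * c"
    proof -
      have "v' * (v * c) = (v * v') * c" by (simp add: mult_ac)
      then have eq: "v' * (v * c) = c" unfolding v'[symmetric] by simp
      show "\<not> dlt dvd v * c" using c(2) dvd_mult[of dlt "v * c" v'] unfolding eq by blast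
      show "\<not> 2 dvd v * c" using c(3) dvd_mult[of 2 "v * c" v'] unfolding eq by blast
    qed
    moreover have "nrm (v * c) \<noteq> 1" using vc c1 by simp
    ultimately have "\<exists>w. nr w = v * c \<and> \<not> trivial w" using v(2) by (intro less.hyps)
    then obtain w where w: "nr w = v * c" "\<not> trivial w" by blast
    have "nr (sc v' * (w * w)) = v' ^ 2 * ((v * c) * (v * c))" by (simp add: nr_sc_mult nr_mult w(1))
    also have "\<dots> = (v * v') ^ 2 * c ^ 2" by (simp add: power2_eq_square mult_ac)
    also have "\<dots> = \<alpha>" using v' \<alpha> by simp
    finally have "nr (sc v' * (w * w)) = \<alpha>" .
    moreover have "\<not> trivial (sc v' * (w * w))"
      unfolding trivial_unit_scale[OF \<open>v' dvd 1\<close>] by (rule class_square_nontrivial[OF w(2)])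
    ultimately show ?thesis by blast
  qed
qed

definition four_squares :: "cub \<Rightarrow> bool" where
  "four_squares \<alpha> \<longleftrightarrow> (\<exists>a b c d. \<alpha> = a ^ 2 + b ^ 2 + c ^ 2 + d ^ 2)"

lemma four_squares_scale: "four_squares \<alpha> \<Longrightarrow> four_squares (c ^ 2 * \<alpha>)"
proof -
  assume "four_squares \<alpha>"
  then obtain p q r s where "\<alpha> = p ^ 2 + q ^ 2 + r ^ 2 + s ^ 2" unfolding four_squares_def by blast
  then have "c ^ 2 * \<alpha> = (c * p) ^ 2 + (c * q) ^ 2 + (c * r) ^ 2 + (c * s) ^ 2"
    by (simp add: power_mult_distrib distrib_left)
  then show ?thesis unfolding four_squares_def by blast
qed

lemma norm_7_unit_multiple:
  assumes "tpos \<alpha>" "nrm \<alpha> = 7"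
  obtains v where "v dvd 1" "\<alpha> = v ^ 2 * dlt"
proof -
  obtain \<beta> where b: "\<alpha> = dlt * \<beta>" using assms(2) dlt_dvd_iff_nrm[of \<alpha>] by (auto elim: dvdE)
  have "tpos \<beta>" using assms(1) tpos_dlt tpos_cancel b by blast
  moreover have "nrm \<beta> = 1" using assms(2) by (simp add: b nrm_mult nrm_dlt)
  ultimately obtain v where "v dvd 1" "\<beta> = v ^ 2" using tpos_unit_square by blast
  then show thesis using that b by (simp add: mult.commute)
qed

text \<open>A factor \<open>dlt ^ 2\<close> is split off as a square, because
  \<open>nontrivial_representation\<close> concerns elements prime to \<open>dlt\<close>. If the
  cofactor has norm 7, an explicit representation of \<open>dlt ^ 3\<close> takes over.\<close>

theorem tpos_four_squares:
  assumes "tpos \<alpha>" "nrm \<alpha> \<noteq> 7" shows "four_squares \<alpha>"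
  using assms
proof (induction "nat (nrm \<alpha>)" arbitrary: \<alpha> rule: less_induct)
  case less
  have triv: "four_squares (nr x)" if "trivial x" for x
    unfolding four_squares_def by (rule trivial_four_squares[OF that])
  consider "2 dvd \<alpha>" | "\<not> dlt dvd \<alpha>" | "dlt dvd \<alpha>" "\<not> 2 dvd \<alpha>" by argo
  then show ?case
  proof cases
    case 1
    obtain x where x: "nr x = \<alpha>" using hurwitz_universal[OF less.prems(1)] by blast
    then have "2 dvd h3 x" using 1 two_dvd_nr(2) by blast
    then show ?thesis using triv[of x] x by (simp add: trivial_def triv_def)
  next
    case 2
    then show ?thesis using trivial_representation[OF less.prems(1)] triv by metis
  next
    case 3
    then obtain \<beta> where b: "\<alpha> = dlt * \<beta>" by (auto elim: dvdE)
    have pb: "tpos \<beta>" using less.prems(1) tpos_dlt tpos_cancel b by blast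
    show ?thesis
    proof (cases "dlt dvd \<beta>")
      case True
      then obtain \<gamma> where c: "\<beta> = dlt * \<gamma>" ..
      have pc: "tpos \<gamma>" using pb tpos_dlt tpos_cancel c by blast
      have \<alpha>: "\<alpha> = dlt ^ 2 * \<gamma>" by (simp add: b c power2_eq_square mult.assoc)
      show ?thesis
      proof (cases "nrm \<gamma> = 7")
        case True
        then obtain v where "\<gamma> = v ^ 2 * dlt" using norm_7_unit_multiple[OF pc] by metis
        then have "\<alpha> = v ^ 2 * dlt ^ 3" using \<alpha> by (simp add: power2_eq_square power3_eq_cube mult_ac)
        moreover have "four_squares (dlt ^ 3)"
          unfolding four_squares_def 
          by (intro exI[of _ "Cub (-1) (-2) 0"] exI[of _ "Cub (-1) (-3) (-1)"] exI[of _ "Cub 0 (-1) 0"] exI[of _ "Cub 0 (-1) 0"])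
            (simp add: dlt_def cub_eq_iff cub_sel_mult power2_eq_square power3_eq_cube)
        ultimately show ?thesis using four_squares_scale by simp
      next
        case False
        have "nrm \<alpha> = 49 * nrm \<gamma>" by (simp add: \<alpha> nrm_mult nrm_power nrm_dlt)
        then have "nat (nrm \<gamma>) < nat (nrm \<alpha>)" using tpos_nrm_pos[OF pc] by simp
        then have "four_squares \<gamma>" using less.hyps pc False by blast
        then show ?thesis unfolding \<alpha> by (rule four_squares_scale)
      qed
    next
      case False
      have "\<not> 2 dvd \<beta>" using 3(2) b by auto
      moreover have "nrm \<beta> \<noteq> 1" using less.prems(2) by (auto simp: b nrm_mult nrm_dlt)
      ultimately obtain x where x: "nr x = \<beta>" "\<not> trivial x"
        using nontrivial_representation[OF pb False] by blast
      have "nr (z0 * x) = \<alpha>" "nr (zb * x) = \<alpha>" by (simp_all add: nr_mult nr_z0 nr_zb x b)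
      then show ?thesis using class_dlt_nontrivial[OF x(2)] triv by metis
    qed
  qed
qed

section \<open>The number field\<close>

lemma is_root_rho_complex: "is_root Defs.rho"
proof -
  have z: "zeta7 ^ 7 = 1" "zeta7 \<noteq> 1"
  proof -
    have "zeta7 ^ 7 = exp (of_nat 7 * (2 * of_real pi * \<i> / 7))"
      unfolding zeta7_def by (rule exp_of_nat_mult[symmetric])
    also have "of_nat 7 * (2 * of_real pi * \<i> / 7) = 2 * of_real pi * \<i>" by simp
    finally show "zeta7 ^ 7 = 1" by (simp only: exp_two_pi_i)
    show "zeta7 \<noteq> 1"
    proof
      assume "zeta7 = 1"
      then obtain n :: int where "Im (2 * of_real pi * \<i> / 7) = of_int (2 * n) * pi"
        unfolding zeta7_def exp_eq_1 by blast
      then have "2 / 7 = of_int (2 * n) * (1 :: real)" by simp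
      then have "real_of_int (14 * n) = real_of_int 2" by simp
      then have "14 * n = 2" by (simp only: of_int_eq_iff)
      then have "(14::int) dvd 2" by (metis dvd_triv_left)
      then show False by simp
    qed
  qed
  define z where "z = zeta7"
  have z0: "z \<noteq> 0" using z(1) by (auto simp: z_def)
  have "z ^ 7 - 1 = (z - 1) * (1 + z + z^2 + z^3 + z^4 + z^5 + z^6)"
    by (simp add: algebra_simps eval_nat_numeral)
  then have sum: "1 + z + z^2 + z^3 + z^4 + z^5 + z^6 = 0" using z by (simp add: z_def)
  have inv: "z * inverse z = 1" using z0 by simp
  define w where "w = inverse z"
  have zw: "z * w = 1" using inv by (simp add: w_def)
  \<comment> \<open>z^3 f(z + 1/z) is the cyclotomic polynomial 1 + z + ... + z^6.\<close>
  have "z ^ 3 * ((z + w) ^ 3 + (z + w) ^ 2 - 2 * (z + w) - 1) =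
      z^6 + z^5 + z^4 * (3 * (z * w) - 2) + z^3 * (2 * (z * w) - 1) + z^2 * (3 * (z * w) ^ 2 - 2 * (z * w))
      + z * (z * w) ^ 2 + (z * w) ^ 3"
    by (simp add: algebra_simps eval_nat_numeral)
  also have "\<dots> = 0" unfolding zw using sum by (simp add: algebra_simps)
  finally have "(z + w) ^ 3 + (z + w) ^ 2 - 2 * (z + w) - 1 = 0" using z0 by simp
  moreover have "Defs.rho = z + w" by (simp add: rho_def z_def w_def)
  ultimately have "Defs.rho ^ 3 + Defs.rho ^ 2 - 2 * Defs.rho - 1 = 0" by (simp only:)
  then show ?thesis by (simp add: is_root_def algebra_simps)
qed

abbreviation \<phi> :: "cub \<Rightarrow> complex" where "\<phi> \<equiv> ev Defs.rho"

lemmas \<phi>_mult = ev_mult[OF is_root_rho_complex]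
lemmas \<phi>_power = ev_power[OF is_root_rho_complex]

lemma ev_mult_adj: "is_root r \<Longrightarrow> ev r x * ev r (adj x) = of_int (nrm x)"
  by (simp add: ev_mult[symmetric] mult_adj)

lemma ev_nonzero:
  fixes r :: "'a::field_char_0"
  shows "is_root r \<Longrightarrow> x \<noteq> 0 \<Longrightarrow> ev r x \<noteq> 0"
  using ev_mult_adj[of r x] by auto

lemma ev_inject:
  fixes r :: "'a::field_char_0"
  shows "is_root r \<Longrightarrow> ev r x = ev r y \<longleftrightarrow> x = y"
  using ev_nonzero[of r "x - y"] by (auto simp: ev_diff)

lemma \<phi>_inject: "\<phi> x = \<phi> y \<longleftrightarrow> x = y"
  by (rule ev_inject[OF is_root_rho_complex])

lemma ev_rho [simp]: "ev r (Cub 0 1 0) = r"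
  by (simp add: ev_def)

lemma O_eq: "\<O> = range \<phi>"
proof (intro equalityI subsetI)
  have "\<exists>x. poly (map_poly of_int p) Defs.rho = \<phi> x" for p :: "int poly"
  proof (induction p)
    case 0
    show ?case by (intro exI[of _ 0]) simp
  next
    case (pCons a p)
    then obtain x where "poly (map_poly of_int p) Defs.rho = \<phi> x" by blast
    then have "poly (map_poly of_int (pCons a p)) Defs.rho = \<phi> (of_int a + Cub 0 1 0 * x)"
      by (simp add: map_poly_pCons ev_add \<phi>_mult)
    then show ?case by blast
  qed
  then show "z \<in> range \<phi>" if "z \<in> \<O>" for z
    using that unfolding \<O>_def by fastforce
next
  fix z assume "z \<in> range \<phi>"
  then obtain x where x: "z = \<phi> x" by blast
  have "z = poly (map_poly of_int [:c0 x, c1 x, c2 x:]) Defs.rho"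
    by (simp add: x ev_def map_poly_pCons power2_eq_square algebra_simps)
  then show "z \<in> \<O>" unfolding \<O>_def by blast
qed

text \<open>Multiplication by \<open>adj y\<close> turns the denominator into the integer
  \<open>nrm y\<close>.\<close>

lemma K_eq: "K = {\<phi> x / of_int n | x n. n \<noteq> 0}"
proof (intro equalityI subsetI)
  have poly: "\<exists>x n. n \<noteq> 0 \<and> poly (map_poly of_rat p) Defs.rho = \<phi> x / of_int n" for p :: "rat poly"
  proof (induction p)
    case 0
    show ?case by (intro exI[of _ 0] exI[of _ 1]) simp
  next
    case (pCons a p)
    then obtain x n where x: "n \<noteq> 0" "poly (map_poly of_rat p) Defs.rho = \<phi> x / of_int n" by blast
    obtain u v where a: "a = of_int u / of_int v" "v > 0"
      by (metis quotient_of_denom_pos quotient_of_div surj_pair)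
    have "(of_rat a :: complex) = of_int u / of_int v" by (simp add: a(1) of_rat_divide)
    then have "poly (map_poly of_rat (pCons a p)) Defs.rho =
        \<phi> (of_int (u * n) + of_int v * (Cub 0 1 0 * x)) / of_int (v * n)"
      using x a(2) by (simp add: map_poly_pCons ev_add \<phi>_mult field_simps)
    moreover have "v * n \<noteq> 0" using x a by simp
    ultimately show ?case by blast
  qed
  fix z assume "z \<in> K"
  then obtain p q :: "rat poly" where z: "z = poly (map_poly of_rat p) Defs.rho / poly (map_poly of_rat q) Defs.rho"
    "poly (map_poly of_rat q) Defs.rho \<noteq> 0" unfolding K_def by blast
  obtain x n where x: "n \<noteq> 0" "poly (map_poly of_rat p) Defs.rho = \<phi> x / of_int n" using poly by blast
  obtain y m where y: "m \<noteq> 0" "poly (map_poly of_rat q) Defs.rho = \<phi> y / of_int m" using poly by blast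
  have y0: "y \<noteq> 0" using z(2) y by auto
  have adj0: "\<phi> (adj y) \<noteq> 0" using ev_mult_adj[OF is_root_rho_complex, of y] y0 by auto
  have "z = (\<phi> x * of_int m) / (of_int n * \<phi> y)" using z x y by simp
  also have "\<dots> = (\<phi> x * of_int m * \<phi> (adj y)) / (of_int n * (\<phi> y * \<phi> (adj y)))"
    using adj0 by simp
  also have "\<dots> = \<phi> (x * of_int m * adj y) / of_int (n * nrm y)"
    unfolding ev_mult_adj[OF is_root_rho_complex] by (simp add: \<phi>_mult)
  finally show "z \<in> {\<phi> x / of_int n | x n. n \<noteq> 0}" using x(1) y0 by fastforce
next
  fix z assume "z \<in> {\<phi> x / of_int n | x n. n \<noteq> 0}"
  then obtain x n where z: "z = \<phi> x / of_int n" "n \<noteq> 0" by blast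
  have "poly (map_poly of_rat [:of_int (c0 x), of_int (c1 x), of_int (c2 x) :: rat:]) Defs.rho = \<phi> x"
    by (simp add: ev_def map_poly_pCons power2_eq_square algebra_simps)
  moreover have "poly (map_poly of_rat [:of_int n :: rat:]) Defs.rho = of_int n"
    by (simp add: map_poly_pCons)
  ultimately show "z \<in> K" unfolding K_def using z
    by (intro CollectI exI[of _ "[:of_int (c0 x), of_int (c1 x), of_int (c2 x):]"] exI[of _ "[:of_int n:]"]) simp
qed

lemma \<phi>_in_K: "\<phi> x \<in> K"
  unfolding K_eq by (intro CollectI exI[of _ x] exI[of _ 1]) simp

lemma K_cases:
  assumes "z \<in> K" obtains x n where "n \<noteq> 0" "z = \<phi> x / of_int n"
  using assms unfolding K_eq by blast

section \<open>Embeddings and roots of the cubic\<close>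

lemma embedding_values:
  fixes \<sigma> :: "complex \<Rightarrow> 'a::field_char_0"
  assumes "\<sigma> \<in> embeddings"
  shows "is_root (\<sigma> Defs.rho)" "n \<noteq> 0 \<Longrightarrow> \<sigma> (\<phi> x / of_int n) = ev (\<sigma> Defs.rho) x / of_int n"
    "\<sigma> (\<phi> x) = ev (\<sigma> Defs.rho) x"
proof -
  have add: "\<sigma> (x + y) = \<sigma> x + \<sigma> y" and mult: "\<sigma> (x * y) = \<sigma> x * \<sigma> y" if "x \<in> K" "y \<in> K" for x y
    using assms that unfolding embeddings_def by blast+
  have one: "\<sigma> 1 = 1" using assms unfolding embeddings_def by blast
  have add': "\<sigma> (\<phi> (x + y)) = \<sigma> (\<phi> x) + \<sigma> (\<phi> y)" and mult': "\<sigma> (\<phi> (x * y)) = \<sigma> (\<phi> x) * \<sigma> (\<phi> y)" for x y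
    using add mult \<phi>_in_K by (simp_all add: ev_add \<phi>_mult)
  have zero: "\<sigma> (\<phi> 0) = 0" using add'[of 0 0] by simp
  have nat: "\<sigma> (\<phi> (of_nat k)) = of_nat k" for k
  proof (induction k)
    case (Suc k)
    have "\<sigma> (\<phi> (of_nat k + 1)) = of_nat k + 1" unfolding add' Suc by (simp add: one)
    then show ?case by (simp add: add.commute)
  qed (use zero in simp)
  have int: "\<sigma> (\<phi> (of_int k)) = of_int k" for k
  proof (cases k rule: int_cases2)
    case (nonneg m)
    then show ?thesis using nat[of m] by simp
  next
    case (nonpos m)
    have "\<sigma> (\<phi> (of_nat m + of_int k)) = 0" using zero nonpos by simp
    then have "of_nat m + \<sigma> (\<phi> (of_int k)) = 0" unfolding add' nat .
    then have "\<sigma> (\<phi> (of_int k)) = - of_nat m" by (simp only: add_eq_0_iff)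
    also have "\<dots> = of_int k" using nonpos by simp
    finally show ?thesis .
  qed
  have sr: "\<sigma> (\<phi> (Cub 0 1 0)) = \<sigma> Defs.rho" by simp
  show val: "\<sigma> (\<phi> x) = ev (\<sigma> Defs.rho) x" for x
  proof -
    have "\<sigma> (\<phi> x) = \<sigma> (\<phi> (of_int (c0 x) + of_int (c1 x) * Cub 0 1 0 + of_int (c2 x) * (Cub 0 1 0 * Cub 0 1 0)))"
      using cub_int_decomp[of x] by (simp only: power2_eq_square)
    also have "\<dots> = ev (\<sigma> Defs.rho) x"
      unfolding add' mult' int sr by (simp add: ev_def power2_eq_square)
    finally show ?thesis .
  qed
  have "(Cub 0 1 0) * (Cub 0 1 0 * Cub 0 1 0) = Cub 1 2 (-1)" by (simp add: cub_eq_iff cub_sel_mult)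
  then have "\<sigma> Defs.rho * (\<sigma> Defs.rho * \<sigma> Defs.rho) = \<sigma> (\<phi> (Cub 1 2 (-1)))" by (metis mult' sr)
  also have "\<dots> = 1 + 2 * \<sigma> Defs.rho - \<sigma> Defs.rho ^ 2" unfolding val by (simp add: ev_def)
  finally show "is_root (\<sigma> Defs.rho)" by (simp add: is_root_def power3_eq_cube mult.assoc)
  assume n: "n \<noteq> 0"
  have "\<phi> x / of_int n \<in> K" using n unfolding K_eq by blast
  then have "\<sigma> ((\<phi> x / of_int n) * \<phi> (of_int n)) = \<sigma> (\<phi> x / of_int n) * of_int n"
    using mult \<phi>_in_K int by metis
  then have "\<sigma> (\<phi> x) = \<sigma> (\<phi> x / of_int n) * of_int n" using n by simp
  then show "\<sigma> (\<phi> x / of_int n) = ev (\<sigma> Defs.rho) x / of_int n" using n by (simp add: val)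
qed

lemma exists_embedding:
  fixes r :: "'a::field_char_0"
  assumes r: "is_root r"
  shows "\<exists>\<sigma>\<in>embeddings. \<sigma> Defs.rho = r"
proof -
  \<comment> \<open>A field element is a fraction in many ways; \<open>uniq\<close> shows, by
    injectivity of \<open>\<phi>\<close>, that the chosen value does not depend on the
    fraction.\<close>
  define \<sigma> :: "complex \<Rightarrow> 'a" where
    "\<sigma> = restrict (\<lambda>z. SOME w. \<exists>x n. n \<noteq> 0 \<and> z = \<phi> x / of_int n \<and> w = ev r x / of_int n) K"
  have val: "\<sigma> (\<phi> x / of_int n) = ev r x / of_int n" if n: "n \<noteq> 0" for x n
  proof -
    have uniq: "w = ev r x / of_int n"
      if w: "\<exists>y m. m \<noteq> 0 \<and> \<phi> x / of_int n = \<phi> y / of_int m \<and> w = ev r y / of_int m" for w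
    proof -
      obtain y m where m: "m \<noteq> 0" "\<phi> x / of_int n = \<phi> y / of_int m" "w = ev r y / of_int m" using w by blast
      have "\<phi> (x * of_int m) = \<phi> (y * of_int n)" using m n by (simp add: \<phi>_mult field_simps)
      then have "x * of_int m = y * of_int n" by (simp only: \<phi>_inject)
      then have "ev r x * of_int m = ev r y * of_int n" by (metis ev_mult[OF r] ev_of_int)
      moreover have "of_int n \<noteq> (0 :: 'a)" "of_int m \<noteq> (0 :: 'a)" using m n by simp_all
      ultimately show ?thesis unfolding m(3) by (simp add: frac_eq_eq)
    qed
    have "\<phi> x / of_int n \<in> K" using n unfolding K_eq by blast
    moreover have "(SOME w. \<exists>y m. m \<noteq> 0 \<and> \<phi> x / of_int n = \<phi> y / of_int m \<and> w = ev r y / of_int m) = ev r x / of_int n"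
      by (rule some_equality, use n in blast, rule uniq)
    ultimately show ?thesis unfolding \<sigma>_def by simp
  qed
  have hom: "\<sigma> (z + w) = \<sigma> z + \<sigma> w \<and> \<sigma> (z * w) = \<sigma> z * \<sigma> w" if zw: "z \<in> K" "w \<in> K" for z w
  proof -
    obtain x n where z: "n \<noteq> 0" "z = \<phi> x / of_int n" by (rule K_cases[OF zw(1)])
    obtain y m where w: "m \<noteq> 0" "w = \<phi> y / of_int m" by (rule K_cases[OF zw(2)])
    have nm: "n * m \<noteq> 0" using z w by simp
    have "z + w = \<phi> (x * of_int m + y * of_int n) / of_int (n * m)"
      using z w by (simp add: ev_add \<phi>_mult field_simps)
    then have "\<sigma> (z + w) = ev r (x * of_int m + y * of_int n) / of_int (n * m)" using val[OF nm] by simp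
    also have "\<dots> = \<sigma> z + \<sigma> w"
      unfolding z(2) w(2) val[OF z(1)] val[OF w(1)] using z w by (simp add: ev_add ev_mult[OF r] field_simps)
    finally have 1: "\<sigma> (z + w) = \<sigma> z + \<sigma> w" .
    have "z * w = \<phi> (x * y) / of_int (n * m)" using z w by (simp add: \<phi>_mult)
    then have "\<sigma> (z * w) = ev r (x * y) / of_int (n * m)" using val[OF nm] by simp
    also have "\<dots> = \<sigma> z * \<sigma> w"
      unfolding z(2) w(2) val[OF z(1)] val[OF w(1)] by (simp add: ev_mult[OF r])
    finally show ?thesis using 1 by blast
  qed
  have "\<sigma> 1 = 1" using val[of 1 1] by simp
  then have "\<sigma> \<in> embeddings" unfolding embeddings_def using hom by (auto simp: \<sigma>_def)
  moreover have "\<sigma> Defs.rho = r" using val[of 1 "Cub 0 1 0"] by simp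
  ultimately show ?thesis by blast
qed

lemma bij_embeddings:
  "bij_betw (\<lambda>\<sigma>. \<sigma> Defs.rho) (embeddings :: (complex \<Rightarrow> 'a::field_char_0) set) {r. is_root r}"
proof (rule bij_betw_imageI)
  show "inj_on (\<lambda>\<sigma>. \<sigma> Defs.rho) (embeddings :: (complex \<Rightarrow> 'a) set)"
  proof (rule inj_onI)
    fix \<sigma> \<tau> :: "complex \<Rightarrow> 'a"
    assume s: "\<sigma> \<in> embeddings" "\<tau> \<in> embeddings" "\<sigma> Defs.rho = \<tau> Defs.rho"
    show "\<sigma> = \<tau>"
    proof (rule extensionalityI)
      show "\<sigma> \<in> extensional K" "\<tau> \<in> extensional K" using s unfolding embeddings_def by blast+
      fix z assume "z \<in> K"
      then obtain x n where "n \<noteq> 0" "z = \<phi> x / of_int n" by (rule K_cases)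
      then show "\<sigma> z = \<tau> z" using s by (simp add: embedding_values)
    qed
  qed
  show "(\<lambda>\<sigma>. \<sigma> Defs.rho) ` (embeddings :: (complex \<Rightarrow> 'a) set) = {r. is_root r}"
  proof (intro equalityI subsetI)
    fix r :: 'a assume "r \<in> (\<lambda>\<sigma>. \<sigma> Defs.rho) ` embeddings"
    then show "r \<in> {r. is_root r}" using embedding_values(1) by blast
  next
    fix r :: 'a assume "r \<in> {r. is_root r}"
    then show "r \<in> (\<lambda>\<sigma>. \<sigma> Defs.rho) ` embeddings" using exists_embedding[of r] by blast
  qed
qed

lemma roots_eq:
  fixes r :: "'a::idom"
  assumes "is_root r"
  shows "{x. is_root x} = {r, r ^ 2 - 2, (r ^ 2 - 2) ^ 2 - 2}"
proof -
  have "x \<in> {r, r ^ 2 - 2, (r ^ 2 - 2) ^ 2 - 2}" if "is_root x" for x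
  proof -
    have "x ^ 3 + x ^ 2 - 2 * x - 1 = 0" using that by (simp add: is_root_def algebra_simps)
    then have "(x - r) * (x - (r ^ 2 - 2)) * (x - ((r ^ 2 - 2) ^ 2 - 2)) = 0"
      unfolding root_factor[OF assms] .
    then show ?thesis by auto
  qed
  moreover have "is_root (r ^ 2 - 2)" "is_root ((r ^ 2 - 2) ^ 2 - 2)" using assms is_root_conj by blast+
  ultimately show ?thesis using assms by blast
qed

lemma totally_positive_iff: "totally_positive (\<phi> x) \<longleftrightarrow> tpos x"
proof -
  have roots: "{r :: real. is_root r} = {rt0, rt1, rt2}"
    using roots_eq[of rt0] by (simp add: rt1_def rt2_def)
  have "totally_positive (\<phi> x) \<longleftrightarrow> (\<forall>\<sigma>\<in>(embeddings :: (complex \<Rightarrow> real) set). ev (\<sigma> Defs.rho) x > 0)"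
    unfolding totally_positive_def by (intro ball_cong refl) (simp add: embedding_values(3))
  also have "\<dots> \<longleftrightarrow> (\<forall>r\<in>(\<lambda>\<sigma>. \<sigma> Defs.rho) ` (embeddings :: (complex \<Rightarrow> real) set). ev r x > 0)" by simp
  also have "(\<lambda>\<sigma>. \<sigma> Defs.rho) ` (embeddings :: (complex \<Rightarrow> real) set) = {rt0, rt1, rt2}"
    using bij_betw_imp_surj_on[OF bij_embeddings[where 'a = real]] roots by simp
  finally show ?thesis by (simp add: tpos_def)
qed

lemma norm_K_eq: "norm_K (\<phi> x) = of_int (nrm x)"
proof -
  have of_real: "is_root (of_real r :: complex)" if "is_root r" for r :: real
  proof -
    have "of_real (r ^ 3) = (of_real (1 + 2 * r - r ^ 2) :: complex)" using that by (simp add: is_root_def)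
    then show ?thesis by (simp add: is_root_def)
  qed
  have roots: "{r :: complex. is_root r} = {of_real rt0, of_real rt1, of_real rt2}"
    using roots_eq[OF of_real[OF rt_root(1)]] by (simp add: rt1_def rt2_def)
  have ev: "ev (of_real r :: complex) x = of_real (ev r x)" for r by (simp add: ev_def)
  have "norm_K (\<phi> x) = (\<Prod>\<sigma>\<in>(embeddings :: (complex \<Rightarrow> complex) set). ev (\<sigma> Defs.rho) x)"
    unfolding norm_K_def by (intro prod.cong refl) (simp add: embedding_values(3))
  also have "\<dots> = (\<Prod>r\<in>{r :: complex. is_root r}. ev r x)"
    by (rule prod.reindex_bij_betw[OF bij_embeddings])
  also have "\<dots> = of_real (ev rt0 x) * of_real (ev rt1 x) * of_real (ev rt2 x)"
  proof -
    have "rt0 \<noteq> rt1" "rt0 \<noteq> rt2" "rt1 \<noteq> rt2" using rt_bounds by linarith+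
    then show ?thesis unfolding roots by (simp add: ev mult.assoc)
  qed
  also have "\<dots> = of_int (nrm x)" unfolding of_real_mult[symmetric] ev_nrm by simp
  finally show ?thesis .
qed

section \<open>The exceptional elements\<close>

text \<open>A nonzero square of trace 4 would have norm at most 64/27; the norm is itself a square,
  hence 1, contrary to \<open>trc_four\<close>.\<close>

lemma trc_square_values:
  assumes "x \<noteq> 0" shows "trc (x ^ 2) = 3 \<or> 5 \<le> trc (x ^ 2)"
proof (rule ccontr)
  assume h: "\<not> ?thesis"
  have t: "tpos (x ^ 2)" by (rule tpos_square[OF assms])
  have 4: "trc (x ^ 2) = 4" using h tpos_trc_ge_3[OF t] by linarith
  have "27 * nrm (x ^ 2) \<le> 64" using tpos_nrm_le_trc[OF t] unfolding 4 by simp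
  moreover have "nrm (x ^ 2) > 0" by (rule tpos_nrm_pos[OF t])
  ultimately have "nrm (x ^ 2) = 1 \<or> nrm (x ^ 2) = 2" by linarith
  moreover have "nrm (x ^ 2) \<noteq> 2"
  proof
    assume "nrm (x ^ 2) = 2"
    then have "even (nrm x ^ 2)" by (simp add: nrm_power)
    then have "4 dvd nrm x ^ 2" by (auto elim!: evenE simp: power_mult_distrib)
    then show False using \<open>nrm (x ^ 2) = 2\<close> by (simp add: nrm_power)
  qed
  ultimately show False using trc_four[OF t 4] by blast
qed

text \<open>Two nonzero squares have traces summing to 3 + 3 or to at least 3 + 5, so trace 7 can
  come only from a single square.\<close>

lemma sum_list_squares_cases:
  fixes xs :: "cub list"
  defines "s \<equiv> \<Sum>x\<leftarrow>xs. x ^ 2"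
  shows "s = 0 \<or> (\<exists>x. x \<noteq> 0 \<and> s = x ^ 2) \<or> trc s = 6 \<or> 8 \<le> trc s"
  unfolding s_def
proof (induction xs)
  case (Cons x xs)
  define s where "s = (\<Sum>x\<leftarrow>xs. x ^ 2)"
  have eq: "(\<Sum>x\<leftarrow>x # xs. x ^ 2) = x ^ 2 + s" by (simp add: s_def)
  show ?case
  proof (cases "x = 0")
    case True
    then show ?thesis using Cons.IH unfolding eq s_def[symmetric] by simp
  next
    case False
    note t = trc_square_values[OF False]
    from Cons.IH consider "s = 0" | y where "y \<noteq> 0" "s = y ^ 2" | "trc s = 6 \<or> 8 \<le> trc s"
      unfolding s_def[symmetric] by blast
    then show ?thesis
    proof cases
      case 1
      then show ?thesis unfolding eq using False by auto
    next
      case (2 y)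
      then have "trc (x ^ 2 + s) = 6 \<or> 8 \<le> trc (x ^ 2 + s)"
        using t trc_square_values[OF 2(1)] unfolding trc_add 2(2) by linarith
      then show ?thesis unfolding eq by blast
    next
      case 3
      then have "8 \<le> trc (x ^ 2 + s)" using t unfolding trc_add by linarith
      then show ?thesis unfolding eq by blast
    qed
  qed
qed simp

lemma nrm_square_neq_7: "nrm (x ^ 2) \<noteq> 7"
proof
  assume h: "nrm (x ^ 2) = 7"
  then have "7 dvd nrm x ^ 2" by (simp add: nrm_power)
  then have "7 dvd nrm x" using prime_dvd_power_int[of 7 "nrm x" 2] by simp
  then have "49 dvd nrm x ^ 2" by (auto elim!: dvdE simp: power_mult_distrib)
  then show False using h by (simp add: nrm_power)
qed

lemma dlt_not_sum_of_squares: "(\<Sum>x\<leftarrow>xs. x ^ 2) \<noteq> dlt"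
proof
  assume h: "(\<Sum>x\<leftarrow>xs. x ^ 2) = dlt"
  have "trc dlt = 7" by (simp add: trc_def dlt_def)
  then consider "dlt = 0" | x where "dlt = x ^ 2"
    using sum_list_squares_cases[of xs] unfolding h by auto
  then show False
    using dlt_nz nrm_square_neq_7 nrm_dlt by cases metis+
qed

lemma dlt_indecomposable:
  assumes "tpos y" "tpos z" shows "dlt \<noteq> y + z"
proof
  assume h: "dlt = y + z"
  have not: False if "y = 1" "dlt = y + z" "tpos z" for y z
  proof -
    have "z = dlt - 1" using that(1,2) by (metis add_diff_cancel_left')
    then have "nrm z = -1" by (simp add: nrm_def dlt_def Let_def)
    then show False using tpos_nrm_pos[OF that(3)] by simp
  qed
  have "trc y + trc z = 7" unfolding trc_add[symmetric] h[symmetric] by (simp add: trc_def dlt_def)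
  then have "trc y = 3 \<or> trc z = 3" using tpos_trc_ge_3[OF assms(1)] tpos_trc_ge_3[OF assms(2)] by linarith
  then have "y = 1 \<or> z = 1" using tpos_trc_3 assms by blast
  then show False using not[of y z] not[of z y] h assms by (auto simp: add.commute)
qed

section \<open>Translation to the number field\<close>

lemma sum_of_four_squares_iff: "sum_of_four_squares (\<phi> a) \<longleftrightarrow> four_squares a"
  unfolding sum_of_four_squares_def four_squares_def O_eq
  by (simp add: \<phi>_power[symmetric] ev_add[symmetric] \<phi>_inject)

lemma sum_of_squares_iff: "sum_of_squares (\<phi> a) \<longleftrightarrow> (\<exists>xs. a = (\<Sum>x\<leftarrow>xs. x ^ 2))"
proof -
  have *: "(\<Sum>x\<leftarrow>map \<phi> xs. x ^ 2) = \<phi> (\<Sum>x\<leftarrow>xs. x ^ 2)" for xs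
    by (induction xs) (simp_all add: \<phi>_power ev_add)
  have "set ys \<subseteq> range \<phi> \<longleftrightarrow> (\<exists>xs. ys = map \<phi> xs)" for ys
    by (metis ex_map_conv subset_iff image_iff list.set_map image_mono subset_UNIV) 
  then show ?thesis
    unfolding sum_of_squares_def O_eq using * \<phi>_inject by (metis (no_types, lifting))
qed

lemma is_unit_O_iff: "is_unit_O (\<phi> v) \<longleftrightarrow> v dvd 1"
proof -
  have "\<phi> v * \<phi> w = 1 \<longleftrightarrow> 1 = v * w" for w
    unfolding \<phi>_mult[symmetric] using \<phi>_inject[of "v * w" 1] by auto
  then show ?thesis unfolding is_unit_O_def O_eq dvd_def by auto
qed

lemma \<phi>_dlt: "1 + Defs.rho + Defs.rho ^ 2 = \<phi> dlt"
  by (simp add: ev_def dlt_def)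

lemma indecomposable_iff:
  "indecomposable (\<phi> a) \<longleftrightarrow> tpos a \<and> (\<forall>y z. tpos y \<and> tpos z \<longrightarrow> a \<noteq> y + z)"
  unfolding indecomposable_def O_eq by (auto simp: totally_positive_iff ev_add[symmetric] \<phi>_inject)

lemma norm_7_iff_unit_multiple:
  assumes "tpos a" shows "nrm a = 7 \<longleftrightarrow> (\<exists>v. v dvd 1 \<and> a = v ^ 2 * dlt)"
proof
  assume "nrm a = 7"
  then obtain v where "v dvd 1" "a = v ^ 2 * dlt" by (rule norm_7_unit_multiple[OF assms])
  then show "\<exists>v. v dvd 1 \<and> a = v ^ 2 * dlt" by blast
next
  assume "\<exists>v. v dvd 1 \<and> a = v ^ 2 * dlt"
  then obtain v where v: "v dvd 1" "a = v ^ 2 * dlt" by blast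
  have "nrm v ^ 2 = 1" using v(1) unfolding unit_iff by (metis one_power2 power2_abs)
  then show "nrm a = 7" by (simp add: v(2) nrm_mult nrm_power nrm_dlt)
qed

text \<open>Multiplication by the square of a unit carries sums of squares and totally positive
  decompositions along, so questions about norm 7 reduce to \<open>dlt\<close>.\<close>

lemma unit_square_dlt:
  assumes "v dvd 1" "a = v ^ 2 * dlt"
  obtains w where "w \<noteq> 0" "w ^ 2 * a = dlt"
proof -
  obtain w where w: "1 = v * w" using assms(1) ..
  have "w ^ 2 * a = (v * w) ^ 2 * dlt" by (simp add: assms(2) power_mult_distrib mult_ac)
  then have "w ^ 2 * a = dlt" unfolding w[symmetric] by simp
  moreover have "w \<noteq> 0" using w by auto
  ultimately show thesis using that by blast
qed

lemma norm_7_not_sum_of_squares: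
  assumes "tpos a" "nrm a = 7" shows "a \<noteq> (\<Sum>x\<leftarrow>xs. x ^ 2)"
proof
  assume h: "a = (\<Sum>x\<leftarrow>xs. x ^ 2)"
  obtain v where "v dvd 1" "a = v ^ 2 * dlt" by (rule norm_7_unit_multiple[OF assms])
  then obtain w where w: "w ^ 2 * a = dlt" by (rule unit_square_dlt)
  have "(\<Sum>x\<leftarrow>map ((*) w) xs. x ^ 2) = w ^ 2 * (\<Sum>x\<leftarrow>xs. x ^ 2)"
    by (induction xs) (simp_all add: power_mult_distrib distrib_left)
  then show False using dlt_not_sum_of_squares[of "map ((*) w) xs"] w h by simp
qed

lemma norm_7_indecomposable:
  assumes "tpos a" "nrm a = 7" "tpos y" "tpos z" shows "a \<noteq> y + z"
proof
  assume h: "a = y + z"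
  obtain v where "v dvd 1" "a = v ^ 2 * dlt" by (rule norm_7_unit_multiple[OF assms(1,2)])
  then obtain w where w: "w \<noteq> 0" "w ^ 2 * a = dlt" by (rule unit_square_dlt)
  have "dlt = w ^ 2 * y + w ^ 2 * z" using w(2) h by (simp add: distrib_left)
  moreover have "tpos (w ^ 2 * y)" "tpos (w ^ 2 * z)" using assms(3,4) tpos_square[OF w(1)] tpos_mult by blast+
  ultimately show False using dlt_indecomposable by blast
qed

text \<open>Every partial sum of squares is 0 or totally positive, so without a decomposition at
  most one summand is nonzero.\<close>

lemma four_squares_decomposable:
  assumes "four_squares a" "\<And>y z. tpos y \<Longrightarrow> tpos z \<Longrightarrow> a \<noteq> y + z"
  shows "\<exists>x. a = x ^ 2"
proof -
  have sq: "x ^ 2 = 0 \<or> tpos (x ^ 2)" for x :: cub using tpos_square[of x] by (cases "x = 0") auto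
  have add: "y + z = 0 \<or> tpos (y + z)" if "y = 0 \<or> tpos y" "z = 0 \<or> tpos z" for y z
    using that by (elim disjE) (simp_all add: tpos_add)
  have split: "y = 0 \<or> z = 0" if "a = y + z" "y = 0 \<or> tpos y" "z = 0 \<or> tpos z" for y z
    using that assms(2) by blast
  obtain p q r s where a: "a = p ^ 2 + (q ^ 2 + (r ^ 2 + s ^ 2))"
    using assms(1) unfolding four_squares_def by (auto simp: add.assoc)
  have "p ^ 2 = 0 \<or> q ^ 2 + (r ^ 2 + s ^ 2) = 0" by (rule split[OF a sq add[OF sq add[OF sq sq]]])
  then show ?thesis
  proof
    assume p: "p ^ 2 = 0"
    then have a1: "a = q ^ 2 + (r ^ 2 + s ^ 2)" using a by simp
    have "q ^ 2 = 0 \<or> r ^ 2 + s ^ 2 = 0" by (rule split[OF a1 sq add[OF sq sq]])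
    then show ?thesis
    proof
      assume "q ^ 2 = 0"
      then have a2: "a = r ^ 2 + s ^ 2" using a1 by simp
      then show ?thesis using split[OF a2 sq sq] by auto
    qed (use a1 in auto)
  qed (use a in auto)
qed

theorem theorem2p3:
  fixes \<alpha> :: complex
  assumes "\<alpha> \<in> \<O>" and "totally_positive \<alpha>"
  shows "(\<not> sum_of_squares \<alpha> \<longleftrightarrow> \<not> sum_of_four_squares \<alpha>) \<and>
         (\<not> sum_of_four_squares \<alpha> \<longleftrightarrow> norm_K \<alpha> = 7) \<and>
         (norm_K \<alpha> = 7 \<longleftrightarrow> (\<exists>u. is_unit_O u \<and> \<alpha> = u\<^sup>2 * (1 + rho + rho\<^sup>2))) \<and>
         ((\<exists>u. is_unit_O u \<and> \<alpha> = u\<^sup>2 * (1 + rho + rho\<^sup>2)) \<longleftrightarrow>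
            indecomposable \<alpha> \<and> \<not> (\<exists>x\<in>\<O>. \<alpha> = x\<^sup>2))"
proof -
  obtain a where a: "\<alpha> = \<phi> a" using assms(1) unfolding O_eq by blast
  have pos: "tpos a" using assms(2) unfolding a totally_positive_iff .
  have norm: "norm_K \<alpha> = 7 \<longleftrightarrow> nrm a = 7"
    unfolding a norm_K_eq by (metis of_int_eq_iff of_int_numeral)
  have four: "sum_of_four_squares \<alpha> \<longleftrightarrow> nrm a \<noteq> 7"
  proof -
    have "nrm a \<noteq> 7" if f: "four_squares a"
    proof
      assume n: "nrm a = 7"
      obtain p q r s where "a = p ^ 2 + q ^ 2 + r ^ 2 + s ^ 2" using f unfolding four_squares_def by blast
      then have "a = (\<Sum>x\<leftarrow>[p, q, r, s]. x ^ 2)" by (simp add: add.assoc)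
      then show False using norm_7_not_sum_of_squares[OF pos n] by blast
    qed
    then show ?thesis unfolding a sum_of_four_squares_iff using tpos_four_squares[OF pos] by blast
  qed
  have sums: "sum_of_squares \<alpha> \<longleftrightarrow> nrm a \<noteq> 7"
  proof
    assume "sum_of_squares \<alpha>"
    then show "nrm a \<noteq> 7"
      unfolding a sum_of_squares_iff using norm_7_not_sum_of_squares[OF pos] by blast
  next
    assume "nrm a \<noteq> 7"
    then obtain p q r s where "a = p ^ 2 + q ^ 2 + r ^ 2 + s ^ 2"
      using tpos_four_squares[OF pos] unfolding four_squares_def by blast
    then have "a = (\<Sum>x\<leftarrow>[p, q, r, s]. x ^ 2)" by (simp add: add.assoc)
    then show "sum_of_squares \<alpha>" unfolding a sum_of_squares_iff by blast
  qed
  have unit: "(\<exists>u. is_unit_O u \<and> \<alpha> = u\<^sup>2 * (1 + rho + rho\<^sup>2)) \<longleftrightarrow> nrm a = 7"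
  proof -
    have eq: "\<alpha> = (\<phi> v)\<^sup>2 * (1 + rho + rho\<^sup>2) \<longleftrightarrow> a = v ^ 2 * dlt" for v
      unfolding a \<phi>_dlt \<phi>_power[symmetric] \<phi>_mult[symmetric] \<phi>_inject ..
    have "(\<exists>u. is_unit_O u \<and> \<alpha> = u\<^sup>2 * (1 + rho + rho\<^sup>2)) \<longleftrightarrow>
        (\<exists>v. is_unit_O (\<phi> v) \<and> \<alpha> = (\<phi> v)\<^sup>2 * (1 + rho + rho\<^sup>2))"
    proof
      assume "\<exists>u. is_unit_O u \<and> \<alpha> = u\<^sup>2 * (1 + rho + rho\<^sup>2)"
      then obtain u where u: "is_unit_O u" "\<alpha> = u\<^sup>2 * (1 + rho + rho\<^sup>2)" by blast
      then obtain v where "u = \<phi> v" unfolding is_unit_O_def O_eq by blast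
      then show "\<exists>v. is_unit_O (\<phi> v) \<and> \<alpha> = (\<phi> v)\<^sup>2 * (1 + rho + rho\<^sup>2)" using u by blast
    qed blast
    then show ?thesis unfolding eq is_unit_O_iff norm_7_iff_unit_multiple[OF pos] .
  qed
  have indec: "indecomposable \<alpha> \<and> \<not> (\<exists>x\<in>\<O>. \<alpha> = x\<^sup>2) \<longleftrightarrow> nrm a = 7"
  proof -
    have sq: "(\<exists>x\<in>\<O>. \<alpha> = x\<^sup>2) \<longleftrightarrow> (\<exists>x. a = x ^ 2)"
      unfolding a O_eq by (simp add: \<phi>_power[symmetric] \<phi>_inject)
    show ?thesis
    proof
      assume h: "indecomposable \<alpha> \<and> \<not> (\<exists>x\<in>\<O>. \<alpha> = x\<^sup>2)"
      show "nrm a = 7"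
      proof (rule ccontr)
        assume "nrm a \<noteq> 7"
        then have "four_squares a" by (rule tpos_four_squares[OF pos])
        then have "\<exists>x. a = x ^ 2"
          using h unfolding a indecomposable_iff by (intro four_squares_decomposable) blast+
        then show False using h sq by blast
      qed
    next
      assume n: "nrm a = 7"
      then have "\<not> (\<exists>x. a = x ^ 2)" using nrm_square_neq_7 by blast
      then show "indecomposable \<alpha> \<and> \<not> (\<exists>x\<in>\<O>. \<alpha> = x\<^sup>2)"
        using norm_7_indecomposable[OF pos n] pos unfolding sq unfolding a indecomposable_iff by blast
    qed
  qed
  show ?thesis unfolding sums four norm unit indec by simp
qed

end
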